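(* Let $G,H$ be reflexive undirected graphs, $\alpha,\beta:G\to H$ homomorphisms, $q\in V(G)$ and $Q$ a reduced walk from $\alpha(q)$ to $\beta(q)$. Then $Q$ is $H$-realizable for $\alpha,\beta,q$ if and only if (i) $Q$ is topologically valid for $\alpha,\beta,q$, and (ii) for every $\alpha$-tight closed walk in $G$, every vertex $v$ on this walk and every walk $W$ in $G$ from $v$ to $q$, we have $Q=\alpha(W)^{-1}\cdot\beta(W)$ in $\pi(H)$. Furthermore, there is an algorithm running in time $O(|V(G)|^2+|V(G)|\cdot|Q|)$ that, given a reduced walk $Q$, constructs an $H$-recoloring sequence $S$ from $\alpha$ to $\beta$ or certifies that $Q$ fails one of conditions (i), (ii); the sequence $S$ satisfies $S(q)=Q$ and $S(v)$ is reduced for every $v\in V(G)$.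
   Context: Reflexive: every vertex has a loop; $G,H$ connected with at least two vertices. Walks, inverses $W^{-1}$, image walks $\alpha(W)$ as usual. Reduction deletes $(v_iv_{i+1})(v_{i+1}v_{i+2})$ when $v_i=v_{i+2}$, or a loop step; reduced means no reduction applies; $\pi(H)$ is walks up to equal reduction with concatenation. A closed walk $(v_1v_2)\cdots(v_{n-1}v_1)$ is cyclically reduced if it is reduced and $v_2\ne v_{n-1}$; a closed walk $C$ in $G$ is $\alpha$-tight if $\alpha(C)$ is cyclically reduced. $Q$ is topologically valid for $\alpha,\beta,q$ if for every closed walk $C$ in $G$ from $q$ to $q$, $\beta(C)=Q^{-1}\cdot\alpha(C)\cdot Q$ in $\pi(H)$. An $H$-recoloring sequence from $\alpha$ to $\beta$ is a sequence $\sigma_0=\alpha,\dots,\sigma_\ell=\beta$ of homomorphisms $G\to H$ with $\sigma_i,\sigma_{i+1}$ differing on exactly one vertex $u$ and $\sigma_i(u)\sigma_{i+1}(u)\in E(H)$; it has the push-or-pull property if whenever $u$ changes color from $a$ to $b$, every neighbor of $u$ has color $a$ or $b$; $S(v)$ is the walk of successive colors of $v$. $Q$ is $H$-realizable for $\alpha,\beta,q$ if there is an $H$-recoloring sequence $S$ from $\alpha$ to $\beta$ with the push-or-pull property such that $Q=S(q)$ in $\pi(H)$. *)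

theory Defs
  imports "Graph_Theory.Digraph_Component"
begin

text \<open>An undirected graph is a symmetric digraph: the edge $uv$ is the pair of arcs
  $(u,v)$, $(v,u)$, and a loop is the arc $(v,v)$.\<close>

definition reflexive_graph :: "'a pair_pre_digraph \<Rightarrow> bool" where
  "reflexive_graph G \<longleftrightarrow>
     pair_sym_digraph G \<and> (\<forall>v\<in>pverts G. (v, v) \<in> parcs G) \<and>
     connected (with_proj G) \<and> (\<exists>u\<in>pverts G. \<exists>v\<in>pverts G. u \<noteq> v)"

definition graph_hom ::
  "'a pair_pre_digraph \<Rightarrow> 'b pair_pre_digraph \<Rightarrow> ('a \<Rightarrow> 'b) \<Rightarrow> bool" where
  "graph_hom G H f \<longleftrightarrow>
     (\<forall>v\<in>pverts G. f v \<in> pverts H) \<and> (\<forall>(u, v)\<in>parcs G. (f u, f v) \<in> parcs H)"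

text \<open>Walks are lists of arcs, so $W^{-1}$ is \<^const>\<open>rev_path\<close> and the product of two
  walks is \<^const>\<open>append\<close>.\<close>

abbreviation walk :: "'a pair_pre_digraph \<Rightarrow> 'a \<Rightarrow> ('a \<times> 'a) awalk \<Rightarrow> 'a \<Rightarrow> bool" where
  "walk G \<equiv> pre_digraph.awalk (with_proj G)"

definition image_walk :: "('a \<Rightarrow> 'b) \<Rightarrow> ('a \<times> 'a) awalk \<Rightarrow> ('b \<times> 'b) awalk" where
  "image_walk f W = map (map_prod f f) W"

inductive reduction :: "('a \<times> 'a) awalk \<Rightarrow> ('a \<times> 'a) awalk \<Rightarrow> bool" where
  backtrack: "reduction (xs @ (a, b) # (b, a) # ys) (xs @ ys)"
| loop: "reduction (xs @ (a, a) # ys) (xs @ ys)"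

definition reduced :: "('a \<times> 'a) awalk \<Rightarrow> bool" where
  "reduced W \<longleftrightarrow> (\<nexists>W'. reduction W W')"

text \<open>Equality in $\pi(H)$ of two walks from $x$ to $y$. That both lists really are such walks
  is part of the definition: an equation between products is false if one of the products
  is not composable.\<close>

definition pi_eq ::
  "'b pair_pre_digraph \<Rightarrow> 'b \<Rightarrow> 'b \<Rightarrow> ('b \<times> 'b) awalk \<Rightarrow> ('b \<times> 'b) awalk \<Rightarrow> bool" where
  "pi_eq H x y P Q \<longleftrightarrow> walk H x P y \<and> walk H x Q y \<and>
     (\<exists>R. reduced R \<and> reduction\<^sup>*\<^sup>* P R \<and> reduction\<^sup>*\<^sup>* Q R)"

text \<open>The trivial closed walk has no $v_2$ and $v_{n-1}$, so it is not cyclically reduced.\<close>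

definition cyclically_reduced :: "('a \<times> 'a) awalk \<Rightarrow> bool" where
  "cyclically_reduced C \<longleftrightarrow> C \<noteq> [] \<and> reduced C \<and> snd (hd C) \<noteq> fst (last C)"

definition tight_closed_walk ::
  "'a pair_pre_digraph \<Rightarrow> ('a \<Rightarrow> 'b) \<Rightarrow> 'a \<Rightarrow> ('a \<times> 'a) awalk \<Rightarrow> bool" where
  "tight_closed_walk G \<alpha> r C \<longleftrightarrow> walk G r C r \<and> cyclically_reduced (image_walk \<alpha> C)"

definition valid_on ::
  "'b pair_pre_digraph \<Rightarrow> ('a \<Rightarrow> 'b) \<Rightarrow> ('a \<Rightarrow> 'b) \<Rightarrow> 'a \<Rightarrow> ('b \<times> 'b) awalk \<Rightarrow>
     ('a \<times> 'a) awalk \<Rightarrow> bool" where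
  "valid_on H \<alpha> \<beta> q Q C \<longleftrightarrow>
     pi_eq H (\<beta> q) (\<beta> q) (image_walk \<beta> C) (rev_path Q @ image_walk \<alpha> C @ Q)"

definition topologically_valid ::
  "'a pair_pre_digraph \<Rightarrow> 'b pair_pre_digraph \<Rightarrow> ('a \<Rightarrow> 'b) \<Rightarrow> ('a \<Rightarrow> 'b) \<Rightarrow> 'a \<Rightarrow>
     ('b \<times> 'b) awalk \<Rightarrow> bool" where
  "topologically_valid G H \<alpha> \<beta> q Q \<longleftrightarrow> (\<forall>C. walk G q C q \<longrightarrow> valid_on H \<alpha> \<beta> q Q C)"

definition respects_walk ::
  "'b pair_pre_digraph \<Rightarrow> ('a \<Rightarrow> 'b) \<Rightarrow> ('a \<Rightarrow> 'b) \<Rightarrow> 'a \<Rightarrow> ('b \<times> 'b) awalk \<Rightarrow>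
     ('a \<times> 'a) awalk \<Rightarrow> bool" where
  "respects_walk H \<alpha> \<beta> q Q W \<longleftrightarrow>
     pi_eq H (\<alpha> q) (\<beta> q) Q (rev_path (image_walk \<alpha> W) @ image_walk \<beta> W)"

definition respects_tight_walks ::
  "'a pair_pre_digraph \<Rightarrow> 'b pair_pre_digraph \<Rightarrow> ('a \<Rightarrow> 'b) \<Rightarrow> ('a \<Rightarrow> 'b) \<Rightarrow> 'a \<Rightarrow>
     ('b \<times> 'b) awalk \<Rightarrow> bool" where
  "respects_tight_walks G H \<alpha> \<beta> q Q \<longleftrightarrow>
     (\<forall>r C v W. tight_closed_walk G \<alpha> r C \<longrightarrow> v \<in> set (pawalk_verts r C) \<longrightarrow> walk G v W q \<longrightarrow>
        respects_walk H \<alpha> \<beta> q Q W)"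

text \<open>Colorings are total functions; only their values on the vertices of $G$ matter.\<close>

definition recoloring_sequence ::
  "'a pair_pre_digraph \<Rightarrow> 'b pair_pre_digraph \<Rightarrow> ('a \<Rightarrow> 'b) \<Rightarrow> ('a \<Rightarrow> 'b) \<Rightarrow>
     ('a \<Rightarrow> 'b) list \<Rightarrow> bool" where
  "recoloring_sequence G H \<alpha> \<beta> S \<longleftrightarrow>
     S \<noteq> [] \<and> (\<forall>\<sigma>\<in>set S. graph_hom G H \<sigma>) \<and>
     (\<forall>v\<in>pverts G. hd S v = \<alpha> v) \<and> (\<forall>v\<in>pverts G. last S v = \<beta> v) \<and>
     (\<forall>i. Suc i < length S \<longrightarrow>
        (\<exists>u\<in>pverts G. (S ! i) u \<noteq> (S ! Suc i) u \<and> ((S ! i) u, (S ! Suc i) u) \<in> parcs H \<and>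
           (\<forall>v\<in>pverts G. v \<noteq> u \<longrightarrow> (S ! i) v = (S ! Suc i) v)))"

definition push_or_pull :: "'a pair_pre_digraph \<Rightarrow> ('a \<Rightarrow> 'b) list \<Rightarrow> bool" where
  "push_or_pull G S \<longleftrightarrow>
     (\<forall>i u w. Suc i < length S \<longrightarrow> (u, w) \<in> parcs G \<longrightarrow> (S ! i) u \<noteq> (S ! Suc i) u \<longrightarrow>
        (S ! i) w \<in> {(S ! i) u, (S ! Suc i) u})"

text \<open>$S(v)$ has one arc for each change of color of $v$.\<close>

definition color_walk :: "('a \<Rightarrow> 'b) list \<Rightarrow> 'a \<Rightarrow> ('b \<times> 'b) awalk" where
  "color_walk S v =
     (let cs = map (\<lambda>\<sigma>. \<sigma> v) S in filter (\<lambda>(a, b). a \<noteq> b) (zip cs (tl cs)))"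

definition realizable ::
  "'a pair_pre_digraph \<Rightarrow> 'b pair_pre_digraph \<Rightarrow> ('a \<Rightarrow> 'b) \<Rightarrow> ('a \<Rightarrow> 'b) \<Rightarrow> 'a \<Rightarrow>
     ('b \<times> 'b) awalk \<Rightarrow> bool" where
  "realizable G H \<alpha> \<beta> q Q \<longleftrightarrow>
     (\<exists>S. recoloring_sequence G H \<alpha> \<beta> S \<and> push_or_pull G S \<and>
          pi_eq H (\<alpha> q) (\<beta> q) Q (color_walk S q))"

definition recoloring_instance ::
  "'a pair_pre_digraph \<Rightarrow> 'b pair_pre_digraph \<Rightarrow> ('a \<Rightarrow> 'b) \<Rightarrow> ('a \<Rightarrow> 'b) \<Rightarrow> 'a \<Rightarrow>
     ('b \<times> 'b) awalk \<Rightarrow> bool" where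
  "recoloring_instance G H \<alpha> \<beta> q Q \<longleftrightarrow>
     reflexive_graph G \<and> finite (pverts G) \<and> reflexive_graph H \<and>
     graph_hom G H \<alpha> \<and> graph_hom G H \<beta> \<and> q \<in> pverts G \<and>
     walk H (\<alpha> q) Q (\<beta> q) \<and> reduced Q"


section \<open>Running time\<close>

text \<open>Algorithms are structured programs for a unit-cost random access machine with addition,
  truncated subtraction and comparison of natural numbers, but no multiplication. A program
  uses finitely many registers and one-dimensional arrays (which are the usual interleaved
  memory segments), and reads the two input graphs through adjacency-matrix queries.
  Each assignment and each test costs one unit; as the expressions of a program have a fixed
  size, charging for their evaluation would change times by a constant factor only.\<close>

datatype aexp =
    Num nat
  | Reg nat
  | Arr nat aexp
  | Add aexp aexp
  | Sub aexp aexp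

datatype bexp =
    Less aexp aexp
  | Equal aexp aexp
  | EdgeG aexp aexp
  | EdgeH aexp aexp
  | Neg bexp
  | Conj bexp bexp

datatype com =
    Skip
  | Assign nat aexp
  | Store nat aexp aexp
  | Seq com com
  | Cond bexp com com
  | Loop bexp com

record state =
  reg :: "nat \<Rightarrow> nat"
  arr :: "nat \<Rightarrow> nat \<Rightarrow> nat"

primrec aval :: "state \<Rightarrow> aexp \<Rightarrow> nat" where
  "aval s (Num k) = k"
| "aval s (Reg x) = reg s x"
| "aval s (Arr a e) = arr s a (aval s e)"
| "aval s (Add e f) = aval s e + aval s f"
| "aval s (Sub e f) = aval s e - aval s f"

primrec bval ::
  "nat pair_pre_digraph \<Rightarrow> nat pair_pre_digraph \<Rightarrow> state \<Rightarrow> bexp \<Rightarrow> bool" where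
  "bval G H s (Less e f) \<longleftrightarrow> aval s e < aval s f"
| "bval G H s (Equal e f) \<longleftrightarrow> aval s e = aval s f"
| "bval G H s (EdgeG e f) \<longleftrightarrow> (aval s e, aval s f) \<in> parcs G"
| "bval G H s (EdgeH e f) \<longleftrightarrow> (aval s e, aval s f) \<in> parcs H"
| "bval G H s (Neg b) \<longleftrightarrow> \<not> bval G H s b"
| "bval G H s (Conj b c) \<longleftrightarrow> bval G H s b \<and> bval G H s c"

text \<open>\<open>exec G H c s t s'\<close>: on the input graphs $G$, $H$, the program \<open>c\<close> started in state
  \<open>s\<close> halts in state \<open>s'\<close> after \<open>t\<close> steps.\<close>

inductive exec ::
  "nat pair_pre_digraph \<Rightarrow> nat pair_pre_digraph \<Rightarrow> com \<Rightarrow> state \<Rightarrow> nat \<Rightarrow> state \<Rightarrow> bool"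
  for G H where
  Skip: "exec G H Skip s 1 s"
| Assign: "exec G H (Assign x e) s 1 (s\<lparr>reg := (reg s)(x := aval s e)\<rparr>)"
| Store: "exec G H (Store a e f) s 1
    (s\<lparr>arr := (arr s)(a := (arr s a)(aval s e := aval s f))\<rparr>)"
| Seq: "exec G H c s t s' \<Longrightarrow> exec G H d s' t' s'' \<Longrightarrow> exec G H (Seq c d) s (t + t') s''"
| Cond_True: "bval G H s b \<Longrightarrow> exec G H c s t s' \<Longrightarrow> exec G H (Cond b c d) s (Suc t) s'"
| Cond_False: "\<not> bval G H s b \<Longrightarrow> exec G H d s t s' \<Longrightarrow> exec G H (Cond b c d) s (Suc t) s'"
| Loop_False: "\<not> bval G H s b \<Longrightarrow> exec G H (Loop b c) s 1 s"
| Loop_True: "bval G H s b \<Longrightarrow> exec G H c s t s' \<Longrightarrow> exec G H (Loop b c) s' t' s'' \<Longrightarrow>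
    exec G H (Loop b c) s (Suc (t + t')) s''"

lemma exec_deterministic:
  assumes "exec G H c s t s'" and "exec G H c s u s''"
  shows "t = u \<and> s' = s''"
  using assms
proof (induction arbitrary: u s'' rule: exec.induct)
  case (Skip s)
  then show ?case by (auto elim: exec.cases)
next
  case (Assign x e s)
  then show ?case by (auto elim: exec.cases)
next
  case (Store a e f s)
  then show ?case by (auto elim: exec.cases)
next
  case (Seq c s t s' d t' s2)
  from Seq.prems obtain v w s3 where "exec G H c s v s3" "exec G H d s3 w s''" "u = v + w"
    by (auto elim: exec.cases)
  then show ?case using Seq.IH by blast
next
  case (Cond_True s b c t s' d)
  from Cond_True.prems Cond_True.hyps obtain v where "exec G H c s v s''" "u = Suc v"
    by (auto elim: exec.cases)
  then show ?case using Cond_True.IH by blast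
next
  case (Cond_False s b d t s' c)
  from Cond_False.prems Cond_False.hyps obtain v where "exec G H d s v s''" "u = Suc v"
    by (auto elim: exec.cases)
  then show ?case using Cond_False.IH by blast
next
  case (Loop_False s b c)
  then show ?case by (auto elim: exec.cases)
next
  case (Loop_True s b c t s' t' s2)
  from Loop_True.prems Loop_True.hyps obtain v w s3
    where "exec G H c s v s3" "exec G H (Loop b c) s3 w s''" "u = Suc (v + w)"
    by (auto elim: exec.cases)
  then show ?case using Loop_True.IH by blast
qed

text \<open>The vertices of the input graphs are $0,\dots,|V(G)|-1$ and $0,\dots,|V(H)|-1$, and $Q$ is
  given by its $|Q|+1$ vertices. All memory not holding input is zero.\<close>

definition input_state ::
  "nat pair_pre_digraph \<Rightarrow> nat pair_pre_digraph \<Rightarrow> (nat \<Rightarrow> nat) \<Rightarrow> (nat \<Rightarrow> nat) \<Rightarrow> nat \<Rightarrow>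
     (nat \<times> nat) awalk \<Rightarrow> state" where
  "input_state G H \<alpha> \<beta> q Q =
     (let n = card (pverts G);
          load = (\<lambda>xs i. if i < length xs then xs ! i else 0)
      in \<lparr> reg = load [n, card (pverts H), q, length Q],
           arr = (\<lambda>_ _. 0)
             (0 := load (map \<alpha> [0..<n]),
              1 := load (map \<beta> [0..<n]),
              2 := load (pawalk_verts (\<alpha> q) Q)) \<rparr>)"

fun colorings :: "('a \<Rightarrow> 'b) \<Rightarrow> ('a \<times> 'b) list \<Rightarrow> ('a \<Rightarrow> 'b) list" where
  "colorings \<sigma> [] = [\<sigma>]"
| "colorings \<sigma> ((u, c) # moves) = \<sigma> # colorings (\<sigma>(u := c)) moves"

definition output_walk :: "(nat \<Rightarrow> nat) \<Rightarrow> nat \<Rightarrow> (nat \<times> nat) awalk" where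
  "output_walk vs k = map (\<lambda>i. (vs i, vs (Suc i))) [0..<k]"

text \<open>Register 0 holds the verdict.
  Verdict 0: a recoloring sequence, listed as its moves (vertex and new color) in arrays 0 and 1;
    the number of moves is in register 1.
  Verdict 1: \<^const>\<open>topologically_valid\<close> fails, certified by a closed walk in array 0.
  Verdict 2: \<^const>\<open>respects_tight_walks\<close> fails, certified by a tight closed walk in array 0
    and by a walk to \<open>q\<close> in array 1, which starts at a vertex of the former.
  Walks are listed by their vertices; their lengths are in registers 1 and 2.\<close>

definition correct_output ::
  "nat pair_pre_digraph \<Rightarrow> nat pair_pre_digraph \<Rightarrow> (nat \<Rightarrow> nat) \<Rightarrow> (nat \<Rightarrow> nat) \<Rightarrow> nat \<Rightarrow>
     (nat \<times> nat) awalk \<Rightarrow> state \<Rightarrow> bool" where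
  "correct_output G H \<alpha> \<beta> q Q s \<longleftrightarrow>
     (reg s 0 = 0 \<and>
        (let S = colorings \<alpha> (map (\<lambda>i. (arr s 0 i, arr s 1 i)) [0..<reg s 1])
         in recoloring_sequence G H \<alpha> \<beta> S \<and> color_walk S q = Q \<and>
            (\<forall>v\<in>pverts G. reduced (color_walk S v)))) \<or>
     (reg s 0 = 1 \<and>
        (let C = output_walk (arr s 0) (reg s 1)
         in walk G q C q \<and> \<not> valid_on H \<alpha> \<beta> q Q C)) \<or>
     (reg s 0 = 2 \<and>
        (let r = arr s 0 0; C = output_walk (arr s 0) (reg s 1);
             v = arr s 1 0; W = output_walk (arr s 1) (reg s 2)
         in tight_closed_walk G \<alpha> r C \<and> v \<in> set (pawalk_verts r C) \<and> walk G v W q \<and>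
            \<not> respects_walk H \<alpha> \<beta> q Q W))"

end

theory Submission
  imports Defs
begin

text \<open>Walks up to reduction are the elements of the free group on the arcs of \<open>H\<close>, with
  $(a,b)^{-1} = (b,a)$. A push or a pull carries every edge $uv$ along, so a sequence with the
  push-or-pull property satisfies $\alpha(uv)\,S(v) = S(u)\,\beta(uv)$, which is (i); and it never
  moves a vertex of an $\alpha$-tight closed walk, which gives (ii).

  Conversely, (i) determines for every vertex $v$ a reduced walk $S(v)$ from $\alpha(v)$ to
  $\beta(v)$. Let a neighbor $w$ block $v$ if its color is neither that of $v$ nor the next one on
  $S(v)$. Then $S(w)$ starts with a step to the color of $v$, so a cycle of blocking vertices is
  $\alpha$-tight although their walks are not trivial, against (ii). Hence the blocking relation has
  a topological order. Proceed in rounds, in each of which every vertex that has not yet arrived makes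
  one move, in this order: a vertex that blocks another one at the start of some round already did so
  initially, so the same order serves in all rounds and no move is ever blocked.

  As the order is fixed, moves cost constant time each. For (i), the walks $S(v)$ are computed along a
  spanning tree. That the remaining edges are respected amounts to equalities between vertex lists with
  at most their first and last vertices removed; these are $4|V(G)|$ lists, so by transitivity linearly
  many comparisons suffice for all edges.\<close>

section \<open>Reduction of walks and the group $\pi$\<close>

text \<open>Each edge gives an equation that multiplies a walk by one letter on either side, so a
  statement about first steps must control cancellation at both ends; requiring walks to be nonempty
  keeps the letter on the right away from the first one. The group is taken over all pairs,
  composable or not: products are total and equations are solved by group algebra, while being a
  walk in \<open>H\<close> is tracked apart.

  The time bound is tight for the data alone. A tree edge adds at most two letters, so a walk has at
  most |Q| + 2|V(G)| letters, and writing down all of them already has the order of the bound.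
  Comparing the walks at the ends of an edge costs as much as reading one walk, so one comparison
  per edge would be too slow. These walks agree up to a shift by one vertex at each end, which turns
  each edge into an equality between trimmed lists.

  Termination and running time are proved together, by one potential for each loop.\<close>

definition cons_red :: "'a \<times> 'a \<Rightarrow> ('a \<times> 'a) awalk \<Rightarrow> ('a \<times> 'a) awalk" where
  "cons_red e xs = (if fst e = snd e then xs
     else if xs \<noteq> [] \<and> hd xs = prod.swap e then tl xs else e # xs)"

text \<open>Letters are read from the right, so that each acts on a walk that is already reduced.
  Reduction preserves \<open>nf\<close> because a cancelled pair of letters acts trivially (van der
  Waerden's argument); this replaces a proof of confluence.\<close>

definition nf :: "('a \<times> 'a) awalk \<Rightarrow> ('a \<times> 'a) awalk" where
  "nf xs = foldr cons_red xs []"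

lemma nf_simps [simp]: "nf [] = []" "nf (e # xs) = cons_red e (nf xs)"
  by (simp_all add: nf_def)

lemma reduced_iff:
  "reduced xs \<longleftrightarrow> (\<forall>ys a b zs. xs \<noteq> ys @ (a, b) # (b, a) # zs \<and> xs \<noteq> ys @ (a, a) # zs)"
  unfolding reduced_def reduction.simps by blast

lemma reduced_appendD: "reduced (xs @ ys) \<Longrightarrow> reduced xs \<and> reduced ys"
  unfolding reduced_iff by (metis append.assoc append_Cons)

lemma reduced_Nil [simp]: "reduced []"
  by (simp add: reduced_iff)

lemma reduced_Cons:
  "reduced (e # xs) \<longleftrightarrow>
     fst e \<noteq> snd e \<and> (xs \<noteq> [] \<longrightarrow> hd xs \<noteq> prod.swap e) \<and> reduced xs" (is "?l \<longleftrightarrow> ?r")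
proof
  assume l: ?l
  then have "reduced xs" using reduced_appendD[of "[e]" xs] by simp
  moreover have "fst e \<noteq> snd e" using l[unfolded reduced_iff, rule_format, of "[]"]
    by (cases e) auto
  moreover have "xs \<noteq> [] \<longrightarrow> hd xs \<noteq> prod.swap e"
    using l[unfolded reduced_iff, rule_format, of "[]"] by (cases e; cases xs) auto
  ultimately show ?r by simp
next
  assume ?r
  then show ?l unfolding reduced_iff by (auto simp: Cons_eq_append_conv)
qed

lemma reduced_nf: "reduced (nf xs)"
  by (induction xs) (auto simp: cons_red_def reduced_Cons neq_Nil_conv)

lemma reduced_nf_id: "reduced xs \<Longrightarrow> nf xs = xs"
  by (induction xs) (auto simp: cons_red_def reduced_Cons)

lemma reduction_context: "reduction xs ys \<Longrightarrow> reduction (us @ xs @ vs) (us @ ys @ vs)"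
proof (induction rule: reduction.induct)
  case (backtrack xs a b ys)
  then show ?case using reduction.backtrack[of "us @ xs" a b "ys @ vs"] by simp
next
  case (loop xs a ys)
  then show ?case using reduction.loop[of "us @ xs" a "ys @ vs"] by simp
qed

lemma reductions_Cons: "reduction\<^sup>*\<^sup>* xs ys \<Longrightarrow> reduction\<^sup>*\<^sup>* (e # xs) (e # ys)"
proof (induction rule: rtranclp_induct)
  case (step y z)
  then show ?case using reduction_context[of y z "[e]" "[]"] by auto
qed simp

lemma reductions_nf: "reduction\<^sup>*\<^sup>* xs (nf xs)"
proof (induction xs)
  case (Cons e xs)
  have "reduction\<^sup>*\<^sup>* (e # nf xs) (cons_red e (nf xs))"
    using reduction.loop[of "[]" "fst e" "nf xs"]
      reduction.backtrack[of "[]" "fst e" "snd e" "tl (nf xs)"]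
    by (cases e; cases "nf xs") (auto simp: cons_red_def)
  then show ?case using reductions_Cons[OF Cons.IH, of e] by simp
qed simp

text \<open>Reducedness is essential: if \<open>(b, a)\<close> has removed the first letter
  \<open>(a, b)\<close> of \<open>xs\<close>, the letter after it must not be \<open>(b, a)\<close>,
  or \<open>(a, b)\<close> would be absorbed instead of restored.\<close>

lemma cons_red_cancel: "reduced xs \<Longrightarrow> cons_red (a, b) (cons_red (b, a) xs) = xs"
  by (cases xs) (auto simp: cons_red_def reduced_Cons)

lemma nf_append: "nf (xs @ ys) = foldr cons_red xs (nf ys)"
  by (simp add: nf_def)

lemma nf_reduction: "reduction xs ys \<Longrightarrow> nf xs = nf ys"
  by (induction rule: reduction.induct)
    (auto simp: nf_append cons_red_cancel reduced_nf, simp add: cons_red_def)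

lemma nf_reductions: "reduction\<^sup>*\<^sup>* xs ys \<Longrightarrow> nf xs = nf ys"
  by (induction rule: rtranclp_induct) (auto simp: nf_reduction)

lemma nf_nf_append [simp]: "nf (nf xs @ ys) = nf (xs @ ys)" "nf (xs @ nf ys) = nf (xs @ ys)"
proof -
  have "reduction\<^sup>*\<^sup>* (xs @ ys) (zs @ ys)" if "reduction\<^sup>*\<^sup>* xs zs" for zs
    using that
  proof (induction rule: rtranclp_induct)
    case (step y z)
    then show ?case using reduction_context[of y z "[]" ys] by auto
  qed simp
  from this[OF reductions_nf] show "nf (nf xs @ ys) = nf (xs @ ys)"
    by (rule nf_reductions[symmetric])
  show "nf (xs @ nf ys) = nf (xs @ ys)"
    by (simp add: nf_append reduced_nf_id reduced_nf)
qed

lemma nf_rev_path: "nf (rev_path xs @ xs) = []"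
proof (induction xs)
  case (Cons e xs)
  have "nf (rev_path xs @ (snd e, fst e) # e # xs) = nf (rev_path xs @ xs)"
    by (rule nf_reduction) (use reduction.backtrack[of "rev_path xs" "snd e" "fst e" xs] in simp)
  then show ?case using Cons by simp
qed simp

text \<open>The carrier contains all reduced lists of pairs, composable or not, which makes the
  product total. It is the group generated by all pairs, with \<open>(a, a)\<close> trivial and
  \<open>(b, a)\<close> inverse to \<open>(a, b)\<close>.\<close>

typedef 'a word = "{xs :: ('a \<times> 'a) awalk. reduced xs}"
  by (rule exI[of _ "[]"]) simp

definition cls :: "('a \<times> 'a) awalk \<Rightarrow> 'a word" where
  "cls xs = Abs_word (nf xs)"

abbreviation arc :: "'a \<Rightarrow> 'a \<Rightarrow> 'a word" where
  "arc a b \<equiv> cls [(a, b)]"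

lemma cls_eq_iff: "cls xs = cls ys \<longleftrightarrow> nf xs = nf ys"
  by (simp add: cls_def Abs_word_inject reduced_nf)

lemma cls_Rep: "cls (Rep_word x) = x"
  using Rep_word[of x] by (simp add: cls_def reduced_nf_id Rep_word_inverse)

lemma Rep_cls: "Rep_word (cls xs) = nf xs"
  by (simp add: cls_def Abs_word_inverse reduced_nf)

instantiation word :: (type) group_add
begin

definition "x + y = cls (Rep_word x @ Rep_word y)"
definition "0 = cls []"
definition "- x = cls (rev_path (Rep_word x))"
definition "x - y = x + (- y :: 'a word)"

instance
proof
  fix x y z :: "'a word"
  show "x + y + z = x + (y + z)"
    by (simp add: plus_word_def Rep_cls cls_eq_iff)
  show "0 + x = x" "x + 0 = x"
    by (simp_all add: plus_word_def zero_word_def Rep_cls cls_Rep)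
  show "- x + x = 0"
    by (simp add: plus_word_def zero_word_def uminus_word_def Rep_cls cls_eq_iff nf_rev_path)
qed (simp add: minus_word_def)

end

lemma cls_0_iff: "cls xs = 0 \<longleftrightarrow> nf xs = []"
  by (simp add: zero_word_def cls_eq_iff)

lemma cls_Nil [simp]: "cls [] = 0"
  by (simp add: cls_0_iff)

lemma cls_append: "cls (xs @ ys) = cls xs + cls ys"
  by (simp add: plus_word_def Rep_cls cls_eq_iff)

lemma cls_Cons: "xs \<noteq> [] \<Longrightarrow> cls ((a, b) # xs) = arc a b + cls xs"
  using cls_append[of "[(a, b)]" xs] by simp

lemma arc_refl [simp]: "arc a a = 0"
  by (simp add: cls_0_iff cons_red_def)

lemma cls_rev_path: "cls (rev_path xs) = - cls xs"
proof -
  have "cls (rev_path xs) + cls xs = 0"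
    by (simp add: cls_append[symmetric] cls_0_iff nf_rev_path)
  then show ?thesis by (simp add: eq_neg_iff_add_eq_0)
qed

lemma arc_sym: "arc b a = - arc a b"
  using cls_rev_path[of "[(a, b)]"] by simp

lemma arc_cancel [simp]: "arc a b + arc b a = 0"
  by (metis arc_sym add.right_inverse)

lemma arc_cancel' [simp]: "arc a b + (arc b a + x) = x"
  by (metis arc_cancel add.assoc add_0)

text \<open>Splits equality in the groupoid into endpoint conditions and one group identity, which
  can be manipulated freely.\<close>

lemma pi_eq_iff: "pi_eq H x y P Q \<longleftrightarrow> walk H x P y \<and> walk H x Q y \<and> cls P = cls Q"
proof -
  have "(\<exists>R. reduced R \<and> reduction\<^sup>*\<^sup>* P R \<and> reduction\<^sup>*\<^sup>* Q R) \<longleftrightarrow> nf P = nf Q"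
    by (metis nf_reductions reduced_nf reductions_nf)
  then show ?thesis by (simp add: pi_eq_def cls_eq_iff)
qed

section \<open>First and last letters of reduced products\<close>

lemma reduced_snoc:
  assumes "reduced xs" "fst e \<noteq> snd e" "xs = [] \<or> last xs \<noteq> prod.swap e"
  shows "reduced (xs @ [e])"
  using assms
  by (induction xs) (auto simp: reduced_Cons hd_append split: if_splits)

text \<open>\<open>nf\<close> recurses from the left, so the action of a letter on the right end is
  computed separately. Its three outcomes (keep, pop, extend) reappear in the stack machine
  \<open>push\<close> and in the edge test.\<close>

lemma nf_snoc:
  assumes "reduced xs"
  shows "nf (xs @ [e]) = (if fst e = snd e then xs
     else if xs \<noteq> [] \<and> last xs = prod.swap e then butlast xs else xs @ [e])"
proof -
  consider "fst e = snd e" | "fst e \<noteq> snd e" "xs \<noteq> []" "last xs = prod.swap e"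
    | "fst e \<noteq> snd e" "xs = [] \<or> last xs \<noteq> prod.swap e" by blast
  then show ?thesis
  proof cases
    case 1
    then have "nf (xs @ [e]) = nf xs"
      using reduction.loop[of xs "fst e" "[]"] by (intro nf_reduction) (cases e, simp)
    with 1 assms show ?thesis by (simp add: reduced_nf_id)
  next
    case 2
    then have "reduction (butlast xs @ [last xs] @ [e]) (butlast xs)"
      using reduction.backtrack[of "butlast xs" "snd e" "fst e" "[]"] by (cases e) simp
    moreover have "butlast xs @ [last xs] @ [e] = xs @ [e]"
      using append_butlast_last_id[OF 2(2)] by simp
    ultimately have "nf (xs @ [e]) = nf (butlast xs)" by (metis nf_reduction)
    moreover have "reduced (butlast xs)"
      using assms 2(2) reduced_appendD[of "butlast xs" "[last xs]"]
      by (metis append_butlast_last_id)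
    ultimately show ?thesis using 2 by (simp add: reduced_nf_id)
  next
    case 3
    then show ?thesis using reduced_snoc[OF assms] by (auto simp: reduced_nf_id)
  qed
qed

text \<open>A letter on the right can change only the last letter of \<open>R\<close>; if
  \<open>R\<close> had a single letter and lost it, \<open>P\<close> would be empty.\<close>

lemma hd_eq_of_snoc:
  assumes "reduced P" "reduced R" "cls P = cls R + arc c d" "P \<noteq> []" "R \<noteq> []"
  shows "hd P = hd R"
proof -
  have "P = nf (R @ [(c, d)])"
    using assms by (simp add: cls_append[symmetric] cls_eq_iff reduced_nf_id)
  moreover have "hd (butlast R) = hd R" if "butlast R \<noteq> []"
    using that assms(5) by (metis append_butlast_last_id hd_append2)
  ultimately show ?thesis
    using assms(4,5) by (auto simp: nf_snoc[OF assms(2)] split: if_splits)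
qed

text \<open>The left letter does not cancel against \<open>R\<close>, and because \<open>R\<close>
  is not empty, the letter on the right cannot reach it either.\<close>

lemma hd_of_Cons_snoc:
  assumes "reduced P" "reduced R" "cls P = arc a a' + cls R + arc c d"
    and "a \<noteq> a'" "R \<noteq> []" "hd R \<noteq> (a', a)"
  shows "P \<noteq> [] \<and> hd P = (a, a')"
proof -
  have r: "reduced ((a, a') # R)" using assms by (simp add: reduced_Cons)
  have e: "cls P = cls ((a, a') # R) + arc c d" using assms by (simp add: cls_Cons)
  then have "P = nf (((a, a') # R) @ [(c, d)])"
    using assms(1) by (simp only: cls_append[symmetric] cls_eq_iff reduced_nf_id)
  then have "P \<noteq> []" using assms(5) by (subst (asm) nf_snoc[OF r]) (auto split: if_splits)
  with hd_eq_of_snoc[OF assms(1) r e] show ?thesis by simp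
qed

section \<open>Walks\<close>

lemma walk_iff: "walk G u p v \<longleftrightarrow> u \<in> pverts G \<and> set p \<subseteq> parcs G \<and> pcas u p v"
  by (simp add: pre_digraph.awalk_def cas_with_proj_eq)

lemma pcas_append: "pcas u (p @ q) w \<longleftrightarrow> (\<exists>v. pcas u p v \<and> pcas v q w)"
  by (induction p arbitrary: u) auto

lemma pcas_rev_path: "pcas v (rev_path p) u \<longleftrightarrow> pcas u p v"
  by (induction p arbitrary: u) (auto simp: pcas_append)

lemma pcas_image: "pcas u p v \<Longrightarrow> pcas (f u) (image_walk f p) (f v)"
  by (induction p arbitrary: u) (auto simp: image_walk_def)

lemma image_walk_simps [simp]:
  "image_walk f [] = []"
  "image_walk f ((a, b) # p) = (f a, f b) # image_walk f p"
  "image_walk f (p @ q) = image_walk f p @ image_walk f q"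
  by (simp_all add: image_walk_def)

lemma image_walk_rev_path: "image_walk f (rev_path p) = rev_path (image_walk f p)"
  by (induction p) auto

lemma set_rev_path: "set (rev_path p) = (\<lambda>(a, b). (b, a)) ` set p"
  by (induction p) auto

lemma pcas_end: "pcas u p v \<Longrightarrow> set p \<subseteq> parcs G \<Longrightarrow> u \<in> pverts G \<Longrightarrow> pair_wf_digraph G \<Longrightarrow> v \<in> pverts G"
  by (induction p arbitrary: u) (auto dest: pair_wf_digraph.in_arcsD2)

locale reflexive =
  fixes G :: "'a pair_pre_digraph"
  assumes refl: "reflexive_graph G"
begin

lemma sym_digraph: "pair_sym_digraph G"
  using refl by (simp add: reflexive_graph_def)

lemma wf_digraph: "pair_wf_digraph G"
  using sym_digraph by (simp add: pair_sym_digraph_def)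

lemma arc_verts: "(u, v) \<in> parcs G \<Longrightarrow> u \<in> pverts G \<and> v \<in> pverts G"
  using wf_digraph pair_wf_digraph.in_arcsD1 pair_wf_digraph.in_arcsD2 by metis

lemma arc_swap: "(u, v) \<in> parcs G \<Longrightarrow> (v, u) \<in> parcs G"
  using sym_digraph
  by (auto simp: pair_sym_digraph_def pair_sym_digraph_axioms_def symmetric_def dest: symD)

lemma arc_loop: "v \<in> pverts G \<Longrightarrow> (v, v) \<in> parcs G"
  using refl by (simp add: reflexive_graph_def)

lemma walk_verts: "walk G u p v \<Longrightarrow> u \<in> pverts G \<and> v \<in> pverts G"
  using pcas_end wf_digraph by (auto simp: walk_iff)

lemma walk_Nil: "v \<in> pverts G \<Longrightarrow> walk G v [] v"
  by (simp add: walk_iff)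

lemma walk_Cons: "(u, v) \<in> parcs G \<Longrightarrow> walk G v p w \<Longrightarrow> walk G u ((u, v) # p) w"
  using arc_verts by (auto simp: walk_iff)

lemma walk_append: "walk G u p v \<Longrightarrow> walk G v q w \<Longrightarrow> walk G u (p @ q) w"
  by (auto simp: walk_iff pcas_append)

lemma walk_rev: "walk G u p v \<Longrightarrow> walk G v (rev_path p) u"
  using walk_verts[of u p v] by (auto simp: walk_iff pcas_rev_path set_rev_path intro: arc_swap)

lemma walk_nf:
  assumes "walk G u p v" shows "walk G u (nf p) v"
proof -
  have "walk G u q v" if "reduction\<^sup>*\<^sup>* p q" for q
    using that
  proof (induction rule: rtranclp_induct)
    case (step y z)
    from step(2,3) show ?case by induction (auto simp: walk_iff pcas_append)
  qed (rule assms)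
  then show ?thesis using reductions_nf .
qed

lemma connected_walk:
  assumes "u \<in> pverts G" "v \<in> pverts G" shows "\<exists>p. walk G u p v"
proof -
  interpret pair_sym_digraph G by (rule sym_digraph)
  have "connected (with_proj G)" using refl by (simp add: reflexive_graph_def)
  then have "strongly_connected (with_proj G)"
    using symmetric_connected_imp_strongly_connected pair_sym_arcs by blast
  then have "u \<rightarrow>\<^sup>*\<^bsub>with_proj G\<^esub> v" using assms by (auto simp: strongly_connected_def)
  then show ?thesis using reachable_awalk by auto
qed

end


section \<open>Image walks and homotopies of colorings\<close>

lemma walk_image:
  assumes "graph_hom G H f" "walk G u p v"
  shows "walk H (f u) (image_walk f p) (f v)"
  using assms pcas_image[of u p v f] by (auto simp: walk_iff image_walk_def graph_hom_def)

text \<open>The commuting square of every edge: \<open>D\<close> is a homotopy from \<alpha> to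
  \<beta> in which \<open>D v\<close> is the track of \<open>v\<close>. It covers both the walks of
  a recoloring sequence and the walks forced by validity.\<close>

definition intertwines ::
  "'a pair_pre_digraph \<Rightarrow> ('a \<Rightarrow> 'b) \<Rightarrow> ('a \<Rightarrow> 'b) \<Rightarrow> ('a \<Rightarrow> 'b word) \<Rightarrow> bool" where
  "intertwines G \<alpha> \<beta> D \<longleftrightarrow>
     (\<forall>(u, v)\<in>parcs G. arc (\<alpha> u) (\<alpha> v) + D v = D u + arc (\<beta> u) (\<beta> v))"

lemma intertwinesD:
  "intertwines G \<alpha> \<beta> D \<Longrightarrow> (u, v) \<in> parcs G \<Longrightarrow>
     arc (\<alpha> u) (\<alpha> v) + D v = D u + arc (\<beta> u) (\<beta> v)"
  by (auto simp: intertwines_def)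

text \<open>Squares of consecutive edges are pasted side by side. For a closed walk at
  \<open>q\<close> this is condition (i); for a walk from a vertex with trivial track it is
  condition (ii).\<close>

lemma intertwines_walk:
  assumes "intertwines G \<alpha> \<beta> D" "set p \<subseteq> parcs G" "pcas u p v"
  shows "cls (image_walk \<alpha> p) + D v = D u + cls (image_walk \<beta> p)"
  using assms(2,3)
proof (induction p arbitrary: u)
  case (Cons e p)
  obtain w where e: "e = (u, w)" using Cons.prems by (cases e) auto
  have c: "cls (image_walk f ((u, w) # p)) = arc (f u) (f w) + cls (image_walk f p)" for f :: "'a \<Rightarrow> 'b"
    using cls_append[of "[(f u, f w)]" "image_walk f p"] by simp
  have IH: "cls (image_walk \<alpha> p) + D v = D w + cls (image_walk \<beta> p)"
    using Cons.IH[of w] Cons.prems e by simp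
  have "cls (image_walk \<alpha> ((u, w) # p)) + D v = arc (\<alpha> u) (\<alpha> w) + (D w + cls (image_walk \<beta> p))"
    using IH by (simp only: c add.assoc)
  also have "\<dots> = D u + cls (image_walk \<beta> ((u, w) # p))"
    using intertwinesD[OF assms(1), of u w] Cons.prems e
    by (simp add: c add.assoc[symmetric] del: image_walk_simps)
  finally show ?case unfolding e .
qed simp

lemma intertwines_trans:
  assumes "intertwines G \<alpha> \<beta> D" "intertwines G \<beta> \<gamma> E"
  shows "intertwines G \<alpha> \<gamma> (\<lambda>v. D v + E v)"
  unfolding intertwines_def
proof clarify
  fix u v assume e: "(u, v) \<in> parcs G"
  have "arc (\<alpha> u) (\<alpha> v) + (D v + E v) = D u + (arc (\<beta> u) (\<beta> v) + E v)"
    by (simp only: intertwinesD[OF assms(1) e] add.assoc[symmetric])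
  also have "\<dots> = D u + E u + arc (\<gamma> u) (\<gamma> v)"
    by (simp only: intertwinesD[OF assms(2) e] add.assoc)
  finally show "arc (\<alpha> u) (\<alpha> v) + (D v + E v) = D u + E u + arc (\<gamma> u) (\<gamma> v)" .
qed

lemma intertwines_cong:
  assumes "intertwines G \<alpha> \<beta> D" "\<And>v. v \<in> pverts G \<Longrightarrow> \<alpha> v = \<alpha>' v \<and> \<beta> v = \<beta>' v \<and> D v = D' v"
    "reflexive_graph G"
  shows "intertwines G \<alpha>' \<beta>' D'"
  using assms(1,2) reflexive.arc_verts[OF reflexive.intro[OF assms(3)]]
  by (auto simp: intertwines_def)

text \<open>Push-or-pull means that the old image of an edge at the moving vertex is the move followed by
  the new image, up to reduction.\<close>

lemma intertwines_push:
  assumes "reflexive_graph G" "\<And>w. w \<in> pverts G \<Longrightarrow> w \<noteq> u \<Longrightarrow> \<sigma> w = \<sigma>' w"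
    "\<And>w. (u, w) \<in> parcs G \<Longrightarrow> \<sigma> w \<in> {\<sigma> u, \<sigma>' u}"
  shows "intertwines G \<sigma> \<sigma>' (\<lambda>v. arc (\<sigma> v) (\<sigma>' v))"
  unfolding intertwines_def
proof clarify
  interpret reflexive G by (rule reflexive.intro) (rule assms)
  fix v w assume e: "(v, w) \<in> parcs G"
  show "arc (\<sigma> v) (\<sigma> w) + arc (\<sigma> w) (\<sigma>' w) = arc (\<sigma> v) (\<sigma>' v) + arc (\<sigma>' v) (\<sigma>' w)"
    using assms(2)[of v] assms(2)[of w] assms(3)[of v] assms(3)[of w] e arc_verts[OF e] arc_swap[OF e]
    by (cases "v = u"; cases "w = u") auto
qed

section \<open>Colorings and their moves\<close>

lemma color_walk_Cons:
  "S \<noteq> [] \<Longrightarrow> color_walk (\<sigma> # S) v =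
     (if \<sigma> v = hd S v then [] else [(\<sigma> v, hd S v)]) @ color_walk S v"
  by (cases S) (auto simp: color_walk_def Let_def)

lemma color_walk_single [simp]: "color_walk [\<sigma>] v = []"
  by (simp add: color_walk_def)

lemma cls_color_walk_Cons:
  "S \<noteq> [] \<Longrightarrow> cls (color_walk (\<sigma> # S) v) = arc (\<sigma> v) (hd S v) + cls (color_walk S v)"
  by (simp add: color_walk_Cons cls_append)

lemma recoloring_sequence_Cons:
  assumes "recoloring_sequence G H \<alpha> \<beta> (\<sigma> # S)" "S \<noteq> []"
  shows "recoloring_sequence G H (hd S) \<beta> S"
    and "\<exists>u\<in>pverts G. \<sigma> u \<noteq> hd S u \<and> (\<sigma> u, hd S u) \<in> parcs H \<and>
      (\<forall>v\<in>pverts G. v \<noteq> u \<longrightarrow> \<sigma> v = hd S v)"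
proof -
  have i: "Suc i < length (\<sigma> # S) \<Longrightarrow>
        (\<exists>u\<in>pverts G. ((\<sigma> # S) ! i) u \<noteq> ((\<sigma> # S) ! Suc i) u \<and>
          (((\<sigma> # S) ! i) u, ((\<sigma> # S) ! Suc i) u) \<in> parcs H \<and>
           (\<forall>v\<in>pverts G. v \<noteq> u \<longrightarrow> ((\<sigma> # S) ! i) v = ((\<sigma> # S) ! Suc i) v))" for i
    using assms(1) unfolding recoloring_sequence_def by blast
  show "recoloring_sequence G H (hd S) \<beta> S"
    unfolding recoloring_sequence_def
  proof (intro conjI allI impI)
    show "\<exists>u\<in>pverts G. (S ! i) u \<noteq> (S ! Suc i) u \<and> ((S ! i) u, (S ! Suc i) u) \<in> parcs H \<and>
      (\<forall>v\<in>pverts G. v \<noteq> u \<longrightarrow> (S ! i) v = (S ! Suc i) v)" if "Suc i < length S" for i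
      using i[of "Suc i"] that by simp
  qed (use assms in \<open>simp_all add: recoloring_sequence_def\<close>)
  show "\<exists>u\<in>pverts G. \<sigma> u \<noteq> hd S u \<and> (\<sigma> u, hd S u) \<in> parcs H \<and>
      (\<forall>v\<in>pverts G. v \<noteq> u \<longrightarrow> \<sigma> v = hd S v)"
    using i[of 0] assms(2) by (simp add: hd_conv_nth)
qed

lemma push_or_pull_Cons:
  assumes "push_or_pull G (\<sigma> # S)" "S \<noteq> []"
  shows "push_or_pull G S"
    and "(u, w) \<in> parcs G \<Longrightarrow> \<sigma> u \<noteq> hd S u \<Longrightarrow> \<sigma> w \<in> {\<sigma> u, hd S u}"
proof -
  have i: "Suc i < length (\<sigma> # S) \<Longrightarrow> (u, w) \<in> parcs G \<Longrightarrow>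
      ((\<sigma> # S) ! i) u \<noteq> ((\<sigma> # S) ! Suc i) u \<Longrightarrow>
      ((\<sigma> # S) ! i) w \<in> {((\<sigma> # S) ! i) u, ((\<sigma> # S) ! Suc i) u}" for i u w
    using assms(1) unfolding push_or_pull_def by blast
  show "push_or_pull G S" unfolding push_or_pull_def using i[of "Suc _"] by auto
  show "(u, w) \<in> parcs G \<Longrightarrow> \<sigma> u \<noteq> hd S u \<Longrightarrow> \<sigma> w \<in> {\<sigma> u, hd S u}"
    using i[of 0] assms(2) by (simp add: hd_conv_nth)
qed

text \<open>The squares of the single moves are stacked. The moves of \<open>v\<close> add up to its
  color walk, as a move of another vertex contributes the trivial letter.\<close>

lemma recoloring_intertwines:
  assumes "reflexive_graph G" "recoloring_sequence G H \<alpha> \<beta> S" "push_or_pull G S"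
  shows "intertwines G \<alpha> \<beta> (\<lambda>v. cls (color_walk S v))"
  using assms(2,3)
proof (induction S arbitrary: \<alpha>)
  case Nil
  then show ?case by (simp add: recoloring_sequence_def)
next
  case (Cons \<sigma> S)
  have \<sigma>: "\<sigma> v = \<alpha> v" if "v \<in> pverts G" for v
    using Cons.prems(1) that by (simp add: recoloring_sequence_def)
  show ?case
  proof (cases "S = []")
    case True
    then have "intertwines G \<sigma> \<sigma> (\<lambda>v. cls (color_walk (\<sigma> # S) v))"
      by (auto simp: intertwines_def)
    then show ?thesis
      by (rule intertwines_cong) (use Cons.prems(1) True assms(1) in \<open>auto simp: recoloring_sequence_def\<close>)
  next
    case False
    note r = recoloring_sequence_Cons[OF Cons.prems(1) False]
      and p = push_or_pull_Cons[OF Cons.prems(2) False]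
    from r(2) obtain u where u: "u \<in> pverts G" "\<sigma> u \<noteq> hd S u"
      "\<forall>v\<in>pverts G. v \<noteq> u \<longrightarrow> \<sigma> v = hd S v" by blast
    have "intertwines G \<sigma> (hd S) (\<lambda>v. arc (\<sigma> v) (hd S v))"
      by (rule intertwines_push[OF assms(1), of u]) (use u p(2) in auto)
    then have "intertwines G \<sigma> \<beta> (\<lambda>v. arc (\<sigma> v) (hd S v) + cls (color_walk S v))"
      by (rule intertwines_trans) (rule Cons.IH[OF r(1) p(1)])
    then show ?thesis
      by (rule intertwines_cong) (use \<sigma> assms(1) False in \<open>auto simp: cls_color_walk_Cons\<close>)
  qed
qed

lemma color_walk_walk:
  assumes "reflexive_graph H" "recoloring_sequence G H \<alpha> \<beta> S" "v \<in> pverts G"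
  shows "walk H (\<alpha> v) (color_walk S v) (\<beta> v)"
  using assms(2)
proof (induction S arbitrary: \<alpha>)
  case Nil
  then show ?case by (simp add: recoloring_sequence_def)
next
  case (Cons \<sigma> S)
  interpret H: reflexive H by (rule reflexive.intro) (rule assms)
  have \<sigma>: "\<sigma> v = \<alpha> v" "\<sigma> v \<in> pverts H"
    using Cons.prems assms(3) by (auto simp: recoloring_sequence_def graph_hom_def)
  show ?case
  proof (cases "S = []")
    case True
    then have "\<alpha> v = \<beta> v" using \<sigma> Cons.prems assms(3)
      by (simp add: recoloring_sequence_def) metis
    then show ?thesis using True \<sigma> by (simp add: H.walk_Nil)
  next
    case False
    note r = recoloring_sequence_Cons[OF Cons.prems False]
    then have "walk H (hd S v) (color_walk S v) (\<beta> v)" using Cons.IH by blast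
    moreover have "\<sigma> v \<noteq> hd S v \<Longrightarrow> (\<sigma> v, hd S v) \<in> parcs H"
      using r(2) assms(3) by metis
    ultimately show ?thesis using \<sigma> False
      by (auto simp: color_walk_Cons intro: H.walk_Cons)
  qed
qed


lemma set_pawalk_verts:
  "pcas u p v \<Longrightarrow> set (pawalk_verts u p) = insert u (fst ` set p \<union> snd ` set p)"
  by (induction p arbitrary: u) auto

lemma pawalk_verts_enter:
  "pcas u p w \<Longrightarrow> v \<in> set (pawalk_verts u p) \<Longrightarrow> v \<noteq> u \<Longrightarrow> \<exists>x. (x, v) \<in> set p"
proof (induction p arbitrary: u)
  case (Cons e p)
  then show ?case by (cases e; cases "v = snd e") auto
qed simp

section \<open>Realizable walks are valid\<close>

text \<open>Two neighbors of \<open>v\<close> on a tight closed walk have distinct colors, both different from the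
  color of \<open>v\<close>, so no push or pull can move \<open>v\<close>.\<close>

lemma tight_neighbors:
  assumes "reflexive_graph G" "tight_closed_walk G \<sigma> r C" "v \<in> set (pawalk_verts r C)"
  obtains w w' where "(v, w) \<in> parcs G" "(v, w') \<in> parcs G" "\<sigma> w \<noteq> \<sigma> v" "\<sigma> w' \<noteq> \<sigma> v" "\<sigma> w \<noteq> \<sigma> w'"
proof -
  interpret reflexive G by (rule reflexive.intro) (rule assms)
  have C: "set C \<subseteq> parcs G" "pcas r C r" and cr: "cyclically_reduced (image_walk \<sigma> C)"
    using assms(2) by (auto simp: tight_closed_walk_def walk_iff)
  then have ne: "C \<noteq> []" by (auto simp: cyclically_reduced_def image_walk_def)
  have arcD: "\<sigma> a \<noteq> \<sigma> b" if ab: "(a, b) \<in> set C" for a b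
  proof -
    obtain C1 C2 where "C = C1 @ (a, b) # C2" using split_list[OF ab] by blast
    then have "reduced ((\<sigma> a, \<sigma> b) # image_walk \<sigma> C2)"
      using cr reduced_appendD by (auto simp: cyclically_reduced_def)
    then show ?thesis by (simp add: reduced_Cons)
  qed
  show ?thesis
  proof (cases "v = r")
    \<comment> \<open>At the base point the two neighbors come from the first and the last arc; here
      reducedness is not enough and the cyclic condition enters.\<close>
    case True
    obtain w where w: "hd C = (r, w)" using C ne by (cases C) (auto simp: prod_eq_iff)
    have "pcas r (butlast C @ [last C]) r" using C ne by simp
    then obtain w' where w': "last C = (w', r)"
      unfolding pcas_append by (cases "last C") auto
    have "(r, w) \<in> set C" "(w', r) \<in> set C"
      using w w' ne by (metis hd_in_set) (metis w' ne last_in_set)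
    moreover have "\<sigma> w \<noteq> \<sigma> w'"
      using cr w w' ne by (simp add: cyclically_reduced_def image_walk_def hd_map last_map)
    ultimately show ?thesis
      using that[of w w'] arcD C arc_swap True by (metis subsetD)
  next
    case False
    obtain x where x: "(x, v) \<in> set C" using pawalk_verts_enter[OF C(2) assms(3) False] by blast
    then obtain C1 C2 where C12: "C = C1 @ (x, v) # C2" by (auto simp: in_set_conv_decomp)
    then have "C2 \<noteq> []" using C(2) False by (auto simp: pcas_append)
    then obtain y C3 where y: "C2 = (v, y) # C3" using C(2) C12
      by (cases C2) (auto simp: pcas_append prod_eq_iff)
    have "reduced ((\<sigma> x, \<sigma> v) # (\<sigma> v, \<sigma> y) # image_walk \<sigma> C3)"
      using cr C12 y reduced_appendD by (auto simp: cyclically_reduced_def)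
    then have "\<sigma> x \<noteq> \<sigma> y" by (auto simp: reduced_Cons)
    moreover have "(v, y) \<in> set C" using C12 y by simp
    ultimately show ?thesis
      using that[of x y] arcD[OF x] arcD[of v y] x C(1) arc_swap[of x v] by fastforce
  qed
qed

text \<open>If no vertex of the walk moves, its image is unchanged, so it is tight for the next
  coloring as well and the argument can be repeated.\<close>

lemma tight_frozen:
  assumes "reflexive_graph G" "recoloring_sequence G H \<alpha> \<beta> S" "push_or_pull G S"
    "tight_closed_walk G \<alpha> r C" "v \<in> set (pawalk_verts r C)"
  shows "color_walk S v = []"
  using assms(2-4)
proof (induction S arbitrary: \<alpha>)
  case Nil
  then show ?case by (simp add: recoloring_sequence_def)
next
  case (Cons \<sigma> S)
  have C: "set C \<subseteq> parcs G" "pcas r C r" "r \<in> pverts G"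
    using Cons.prems(3) by (auto simp: tight_closed_walk_def walk_iff)
  have verts: "set (pawalk_verts r C) \<subseteq> pverts G"
    using C set_pawalk_verts[OF C(2)] reflexive.arc_verts[OF reflexive.intro[OF assms(1)]] by fastforce
  have image: "image_walk f C = image_walk g C"
    if "\<And>v. v \<in> set (pawalk_verts r C) \<Longrightarrow> f v = g v" for f g :: "'a \<Rightarrow> 'b"
    unfolding image_walk_def
    by (rule map_cong) (use that set_pawalk_verts[OF C(2)] in \<open>auto simp: prod_eq_iff image_iff\<close>)
  have \<sigma>: "\<sigma> v = \<alpha> v" if "v \<in> pverts G" for v
    using Cons.prems(1) that by (simp add: recoloring_sequence_def)
  then have tight: "tight_closed_walk G \<sigma> r C"
    using Cons.prems(3) image[OF \<sigma>] verts by (simp add: tight_closed_walk_def subset_iff)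
  show ?case
  proof (cases "S = []")
    case False
    have eq: "\<sigma> w = hd S w" if w: "w \<in> set (pawalk_verts r C)" for w
    proof (rule ccontr)
      assume m: "\<sigma> w \<noteq> hd S w"
      obtain x y where "(w, x) \<in> parcs G" "(w, y) \<in> parcs G" "\<sigma> x \<noteq> \<sigma> w" "\<sigma> y \<noteq> \<sigma> w" "\<sigma> x \<noteq> \<sigma> y"
        using tight_neighbors[OF assms(1) tight w] .
      \<comment> \<open>Both neighbors would need the new color of \<open>w\<close>, the only one
        allowed besides its old color.\<close>
      then show False using push_or_pull_Cons(2)[OF Cons.prems(2) False, OF _ m]
        by (metis insertE singletonD)
    qed
    then have "tight_closed_walk G (hd S) r C"
      using tight image[of \<sigma> "hd S"] by (auto simp: tight_closed_walk_def)
    then have "color_walk S v = []"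
      using Cons.IH recoloring_sequence_Cons(1)[OF Cons.prems(1) False]
        push_or_pull_Cons(1)[OF Cons.prems(2) False] by blast
    then show ?thesis using eq[OF assms(5)] False by (simp add: color_walk_Cons)
  qed simp
qed

lemma realizable_imp_valid:
  assumes I: "recoloring_instance G H \<alpha> \<beta> q Q" and "realizable G H \<alpha> \<beta> q Q"
  shows "topologically_valid G H \<alpha> \<beta> q Q" "respects_tight_walks G H \<alpha> \<beta> q Q"
proof -
  interpret G: reflexive G by (rule reflexive.intro) (use I in \<open>simp add: recoloring_instance_def\<close>)
  interpret H: reflexive H by (rule reflexive.intro) (use I in \<open>simp add: recoloring_instance_def\<close>)
  obtain S where S: "recoloring_sequence G H \<alpha> \<beta> S" "push_or_pull G S"
    and Q: "cls Q = cls (color_walk S q)"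
    using assms(2) by (auto simp: realizable_def pi_eq_iff)
  have wQ: "walk H (\<alpha> q) Q (\<beta> q)" and hom: "graph_hom G H \<alpha>" "graph_hom G H \<beta>"
    using I by (simp_all add: recoloring_instance_def)
  note int = recoloring_intertwines[OF G.refl S]
  show "topologically_valid G H \<alpha> \<beta> q Q"
    unfolding topologically_valid_def valid_on_def pi_eq_iff
  proof (intro allI impI conjI)
    fix C assume C: "walk G q C q"
    then have "cls (image_walk \<alpha> C) + cls Q = cls Q + cls (image_walk \<beta> C)"
      using intertwines_walk[OF int, of C q q] Q by (simp add: walk_iff)
    then show "cls (image_walk \<beta> C) = cls (rev_path Q @ image_walk \<alpha> C @ Q)"
      by (simp add: cls_append cls_rev_path)
    show "walk H (\<beta> q) (image_walk \<beta> C) (\<beta> q)" using walk_image[OF hom(2) C] .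
    show "walk H (\<beta> q) (rev_path Q @ image_walk \<alpha> C @ Q) (\<beta> q)"
      using H.walk_append[OF H.walk_rev[OF wQ] H.walk_append[OF walk_image[OF hom(1) C] wQ]] .
  qed
  show "respects_tight_walks G H \<alpha> \<beta> q Q"
    unfolding respects_tight_walks_def respects_walk_def pi_eq_iff
  proof (intro allI impI conjI wQ)
    fix r C v W
    assume C: "tight_closed_walk G \<alpha> r C" and v: "v \<in> set (pawalk_verts r C)" and W: "walk G v W q"
    \<comment> \<open>The \<open>0\<close> is the track of \<open>v\<close>, which is
      frozen.\<close>
    have "cls (image_walk \<alpha> W) + cls Q = 0 + cls (image_walk \<beta> W)"
      using intertwines_walk[OF int, of W v q] W Q tight_frozen[OF G.refl S C v] by (simp add: walk_iff)
    then show "cls Q = cls (rev_path (image_walk \<alpha> W) @ image_walk \<beta> W)"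
      by (simp add: cls_append cls_rev_path) (metis add.assoc add_0 left_minus)
    \<comment> \<open>The product in condition (ii) has to be composable at \<open>v\<close>; it is,
      because \<open>v\<close> never changes its color.\<close>
    have "\<alpha> v = \<beta> v"
      using color_walk_walk[OF H.refl S(1), of v] tight_frozen[OF G.refl S C v] G.walk_verts[OF W]
      by (simp add: walk_iff)
    then show "walk H (\<alpha> q) (rev_path (image_walk \<alpha> W) @ image_walk \<beta> W) (\<beta> q)"
      using H.walk_append[OF H.walk_rev[OF walk_image[OF hom(1) W]]] walk_image[OF hom(2) W] by simp
  qed
qed


section \<open>Legal sequences of moves\<close>

text \<open>A walk given by its vertices, as the machine stores it. A function instead of a list
  makes shifted windows of the memory walks without any copying.\<close>

definition arcs_of :: "(nat \<Rightarrow> 'a) \<Rightarrow> nat \<Rightarrow> ('a \<times> 'a) awalk" where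
  "arcs_of f k = map (\<lambda>i. (f i, f (Suc i))) [0..<k]"

lemma arcs_of_0 [simp]: "arcs_of f 0 = []"
  by (simp add: arcs_of_def)

lemma length_arcs_of [simp]: "length (arcs_of f k) = k"
  by (simp add: arcs_of_def)

lemma arcs_of_Suc: "arcs_of f (Suc k) = (f 0, f (Suc 0)) # arcs_of (\<lambda>i. f (Suc i)) k"
  by (simp add: arcs_of_def upt_conv_Cons map_Suc_upt[symmetric] del: upt_Suc)

lemma arcs_of_snoc: "arcs_of f (Suc k) = arcs_of f k @ [(f k, f (Suc k))]"
  by (simp add: arcs_of_def)

lemma arcs_of_cong: "(\<And>i. i \<le> k \<Longrightarrow> f i = g i) \<Longrightarrow> arcs_of f k = arcs_of g k"
  by (simp add: arcs_of_def)

lemma hd_arcs_of: "0 < k \<Longrightarrow> hd (arcs_of f k) = (f 0, f (Suc 0))"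
  by (cases k) (simp_all add: arcs_of_Suc)

lemma arcs_of_Nil_iff [simp]: "arcs_of f k = [] \<longleftrightarrow> k = 0"
  by (simp add: arcs_of_def)

lemma pcas_arcs_of: "pcas (f 0) (arcs_of f k) (f k)"
  by (induction k arbitrary: f) (simp_all add: arcs_of_Suc)

lemma set_arcs_of: "set (arcs_of f k) = (\<lambda>i. (f i, f (Suc i))) ` {..<k}"
  by (auto simp: arcs_of_def)

lemma arcs_of_pawalk_verts: "pcas u p v \<Longrightarrow> arcs_of ((!) (pawalk_verts u p)) (length p) = p"
proof (induction p arbitrary: u)
  case (Cons e p)
  then show ?case by (cases p) (auto simp: arcs_of_Suc)
qed simp

lemma reduced_arcs_of:
  "reduced (arcs_of f k) \<longleftrightarrow>
     (\<forall>i<k. f i \<noteq> f (Suc i)) \<and> (\<forall>i. Suc i < k \<longrightarrow> f (Suc (Suc i)) \<noteq> f i)"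
proof (induction k arbitrary: f)
  case (Suc k)
  show ?case
    unfolding arcs_of_Suc[of f k] reduced_Cons Suc.IH
    by (cases k) (auto simp: hd_arcs_of All_less_Suc2)
qed simp

fun final :: "('a \<Rightarrow> 'b) \<Rightarrow> ('a \<times> 'b) list \<Rightarrow> 'a \<Rightarrow> 'b" where
  "final \<sigma> [] = \<sigma>"
| "final \<sigma> ((u, c) # ms) = final (\<sigma>(u := c)) ms"

text \<open>Unlike \<open>color_walk\<close> it filters nothing, so it splits along concatenations
  of moves. On legal lists the two agree, because every legal move changes a color.\<close>

fun trail :: "('a \<Rightarrow> 'b) \<Rightarrow> ('a \<times> 'b) list \<Rightarrow> 'a \<Rightarrow> ('b \<times> 'b) awalk" where
  "trail \<sigma> [] v = []"
| "trail \<sigma> ((u, c) # ms) v = (if u = v then [(\<sigma> v, c)] else []) @ trail (\<sigma>(u := c)) ms v"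

text \<open>Only the surroundings of the moving vertex are inspected; that the new coloring is a
  homomorphism is a consequence.\<close>

fun legal :: "'a pair_pre_digraph \<Rightarrow> 'b pair_pre_digraph \<Rightarrow> ('a \<Rightarrow> 'b) \<Rightarrow> ('a \<times> 'b) list \<Rightarrow> bool" where
  "legal G H \<sigma> [] \<longleftrightarrow> True"
| "legal G H \<sigma> ((u, c) # ms) \<longleftrightarrow> u \<in> pverts G \<and> \<sigma> u \<noteq> c \<and> (\<sigma> u, c) \<in> parcs H \<and>
     (\<forall>w. (u, w) \<in> parcs G \<longrightarrow> \<sigma> w \<in> {\<sigma> u, c}) \<and> legal G H (\<sigma>(u := c)) ms"

lemma final_append: "final \<sigma> (ms @ ms') = final (final \<sigma> ms) ms'"
  by (induction \<sigma> ms rule: final.induct) (auto simp del: fun_upd_apply)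

lemma trail_append: "trail \<sigma> (ms @ ms') v = trail \<sigma> ms v @ trail (final \<sigma> ms) ms' v"
  by (induction \<sigma> ms v rule: trail.induct) (auto simp del: fun_upd_apply)

lemma legal_append: "legal G H \<sigma> (ms @ ms') \<longleftrightarrow> legal G H \<sigma> ms \<and> legal G H (final \<sigma> ms) ms'"
  by (induction \<sigma> ms arbitrary: ms' rule: final.induct) (auto simp del: fun_upd_apply)

lemma colorings_ne [simp]: "colorings \<sigma> ms \<noteq> []"
  by (cases "(\<sigma>, ms)" rule: colorings.cases) auto

lemma hd_colorings [simp]: "hd (colorings \<sigma> ms) = \<sigma>"
  by (cases "(\<sigma>, ms)" rule: colorings.cases) auto

lemma last_colorings: "last (colorings \<sigma> ms) = final \<sigma> ms"
  by (induction \<sigma> ms rule: colorings.induct) (auto simp del: fun_upd_apply)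

lemma color_walk_colorings: "legal G H \<sigma> ms \<Longrightarrow> color_walk (colorings \<sigma> ms) v = trail \<sigma> ms v"
  by (induction \<sigma> ms rule: colorings.induct) (auto simp: color_walk_Cons)

lemma legal_recoloring:
  assumes "reflexive_graph G" "reflexive_graph H" "graph_hom G H \<sigma>" "legal G H \<sigma> ms"
  shows "recoloring_sequence G H \<sigma> (final \<sigma> ms) (colorings \<sigma> ms) \<and> push_or_pull G (colorings \<sigma> ms)"
  using assms(3,4)
proof (induction \<sigma> ms rule: colorings.induct)
  case (1 \<sigma>)
  then show ?case by (simp add: recoloring_sequence_def push_or_pull_def)
next
  case (2 \<sigma> u c ms)
  interpret G: reflexive G by (rule reflexive.intro) (rule assms)
  interpret H: reflexive H by (rule reflexive.intro) (rule assms)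
  let ?S = "colorings (\<sigma>(u := c)) ms"
  have n: "(\<sigma> # ?S) ! i = (case i of 0 \<Rightarrow> \<sigma> | Suc j \<Rightarrow> ?S ! j)" for i
    by (cases i) auto
  have z: "?S ! 0 = \<sigma>(u := c)" by (metis hd_conv_nth hd_colorings colorings_ne)
  \<comment> \<open>An edge at \<open>u\<close> is mapped to a loop at \<open>c\<close> or to an
    edge between \<open>c\<close> and the old color of \<open>u\<close>, so reflexivity and symmetry
    of \<open>H\<close> suffice.\<close>
  have edge: "(x, y) \<in> parcs G \<Longrightarrow> ((\<sigma>(u := c)) x, (\<sigma>(u := c)) y) \<in> parcs H" for x y
    using 2(2,3) G.arc_swap[of x y] H.arc_swap[of "\<sigma> u" c] H.arc_verts[of "\<sigma> u" c]
    by (auto simp: graph_hom_def intro: H.arc_loop)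
  have "graph_hom G H (\<sigma>(u := c))"
    unfolding graph_hom_def
  proof (intro conjI)
    show "\<forall>v\<in>pverts G. (\<sigma>(u := c)) v \<in> pverts H"
      using 2(2,3) H.arc_verts[of "\<sigma> u" c] by (auto simp: graph_hom_def)
  qed (use edge in blast)
  with 2 have IH: "recoloring_sequence G H (\<sigma>(u := c)) (final (\<sigma>(u := c)) ms) ?S" "push_or_pull G ?S"
    by (auto simp del: fun_upd_apply)
  show ?case
  proof
    show "recoloring_sequence G H \<sigma> (final \<sigma> ((u, c) # ms)) (colorings \<sigma> ((u, c) # ms))"
      unfolding recoloring_sequence_def
    proof (intro conjI allI impI)
      fix i assume i: "Suc i < length (colorings \<sigma> ((u, c) # ms))"
      show "\<exists>x\<in>pverts G. (colorings \<sigma> ((u, c) # ms) ! i) x \<noteq> (colorings \<sigma> ((u, c) # ms) ! Suc i) x \<and>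
         ((colorings \<sigma> ((u, c) # ms) ! i) x, (colorings \<sigma> ((u, c) # ms) ! Suc i) x) \<in> parcs H \<and>
         (\<forall>v\<in>pverts G. v \<noteq> x \<longrightarrow>
           (colorings \<sigma> ((u, c) # ms) ! i) v = (colorings \<sigma> ((u, c) # ms) ! Suc i) v)"
      proof (cases i)
        case 0
        then show ?thesis using 2(3) by (intro bexI[of _ u]) (auto simp: z)
      next
        case (Suc j)
        then show ?thesis using i IH(1) by (simp add: recoloring_sequence_def)
      qed
    qed (use 2(2) IH(1) in \<open>auto simp: recoloring_sequence_def last_colorings\<close>)
    show "push_or_pull G (colorings \<sigma> ((u, c) # ms))"
      unfolding push_or_pull_def
    proof (intro allI impI)
      fix i x w
      assume *: "Suc i < length (colorings \<sigma> ((u, c) # ms))" "(x, w) \<in> parcs G"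
        "(colorings \<sigma> ((u, c) # ms) ! i) x \<noteq> (colorings \<sigma> ((u, c) # ms) ! Suc i) x"
      show "(colorings \<sigma> ((u, c) # ms) ! i) w
        \<in> {(colorings \<sigma> ((u, c) # ms) ! i) x, (colorings \<sigma> ((u, c) # ms) ! Suc i) x}"
      proof (cases i)
        case 0
        then show ?thesis using 2(3) * by (auto simp: z split: if_splits)
      next
        case (Suc j)
        then show ?thesis using * IH(2) by (simp add: push_or_pull_def)
      qed
    qed
  qed
qed

section \<open>Moving in rounds\<close>

text \<open>The lists of vertices \<open>sv v 0, \<dots>, sv v (len v)\<close> are the reduced walks which the vertices have to
  follow.\<close>

locale lifting =
  G: reflexive G + H: reflexive H for G :: "'a pair_pre_digraph" and H :: "'b pair_pre_digraph" +
  fixes \<alpha> \<beta> :: "'a \<Rightarrow> 'b" and sv :: "'a \<Rightarrow> nat \<Rightarrow> 'b" and len :: "'a \<Rightarrow> nat"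
  assumes hom: "graph_hom G H \<alpha>" "graph_hom G H \<beta>"
    and sv_0: "v \<in> pverts G \<Longrightarrow> sv v 0 = \<alpha> v"
    and sv_end: "v \<in> pverts G \<Longrightarrow> sv v (len v) = \<beta> v"
    and sv_step: "v \<in> pverts G \<Longrightarrow> i < len v \<Longrightarrow> (sv v i, sv v (Suc i)) \<in> parcs H"
    and sv_reduced: "v \<in> pverts G \<Longrightarrow> reduced (arcs_of (sv v) (len v))"
    and sv_int: "intertwines G \<alpha> \<beta> (\<lambda>v. cls (arcs_of (sv v) (len v)))"
begin

definition rest :: "('a \<Rightarrow> nat) \<Rightarrow> 'a \<Rightarrow> ('b \<times> 'b) awalk" where
  "rest p v = arcs_of (\<lambda>i. sv v (p v + i)) (len v - p v)"

text \<open>The remaining walks form a homotopy from the current coloring to \<beta>. This invariant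
  makes every reachable position look like an initial one.\<close>

definition compat :: "('a \<Rightarrow> nat) \<Rightarrow> bool" where
  "compat p \<longleftrightarrow> intertwines G (\<lambda>v. sv v (p v)) \<beta> (\<lambda>v. cls (rest p v))"

definition blk :: "('a \<Rightarrow> nat) \<Rightarrow> 'a \<Rightarrow> 'a \<Rightarrow> bool" where
  "blk p v w \<longleftrightarrow> (v, w) \<in> parcs G \<and> p v < len v \<and> sv w (p w) \<notin> {sv v (p v), sv v (Suc (p v))}"

text \<open>The relation \<open>blk\<close> at the start; it is the only one for which an order is
  ever computed.\<close>

definition blocks :: "'a \<Rightarrow> 'a \<Rightarrow> bool" where
  "blocks v w \<longleftrightarrow> (v, w) \<in> parcs G \<and> 0 < len v \<and> \<alpha> w \<notin> {\<alpha> v, sv v 1}"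

lemma reduced_rest: "v \<in> pverts G \<Longrightarrow> reduced (rest p v)"
  using sv_reduced[of v] by (auto simp: rest_def reduced_arcs_of)

lemma rest_Nil_iff: "rest p v = [] \<longleftrightarrow> len v \<le> p v"
  by (simp add: rest_def)

lemma hd_rest: "p v < len v \<Longrightarrow> hd (rest p v) = (sv v (p v), sv v (Suc (p v)))"
  by (simp add: rest_def hd_arcs_of)

lemma rest_Cons:
  assumes "p v < len v"
  shows "rest p v = (sv v (p v), sv v (Suc (p v))) # rest (p(v := Suc (p v))) v"
proof -
  have "len v - p v = Suc (len v - Suc (p v))" using assms by simp
  then show ?thesis by (simp add: rest_def arcs_of_Suc)
qed

lemma cls_rest: "p v < len v \<Longrightarrow>
    cls (rest p v) = arc (sv v (p v)) (sv v (Suc (p v))) + cls (rest (p(v := Suc (p v))) v)"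
  using cls_append[of "[_]"] by (simp add: rest_Cons)

lemma rest_upd: "w \<noteq> v \<Longrightarrow> rest (p(v := i)) w = rest p w"
  by (simp add: rest_def)

lemma compat_eq:
  assumes "compat p" "(v, w) \<in> parcs G"
  shows "cls (rest p w) = arc (sv w (p w)) (sv v (p v)) + cls (rest p v) + arc (\<beta> v) (\<beta> w)"
proof -
  have "arc (sv w (p w)) (sv v (p v)) + cls (rest p v) = cls (rest p w) + arc (\<beta> w) (\<beta> v)"
    using assms(1) G.arc_swap[OF assms(2)] by (auto simp: compat_def dest: intertwinesD)
  then show ?thesis by (simp add: add.assoc)
qed

text \<open>As the color of \<open>w\<close> is not the next one of \<open>v\<close>, the letter
  leading from \<open>w\<close> to \<open>v\<close> does not cancel against the walk of
  \<open>v\<close> and stays in front: the blocker itself is about to take the color of the vertex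
  that it blocks.\<close>

lemma blk_imp:
  assumes "compat p" "blk p v w"
  shows "p w < len w \<and> sv w (Suc (p w)) = sv v (p v)"
proof -
  have e: "(v, w) \<in> parcs G" and v: "p v < len v" using assms(2) by (auto simp: blk_def)
  have "rest p w \<noteq> [] \<and> hd (rest p w) = (sv w (p w), sv v (p v))"
    by (rule hd_of_Cons_snoc[OF reduced_rest reduced_rest compat_eq[OF assms(1) e]])
      (use G.arc_verts[OF e] assms(2) v in \<open>auto simp: blk_def rest_Nil_iff hd_rest\<close>)
  then show ?thesis using hd_rest[of p w] by (simp add: rest_Nil_iff not_le)
qed

text \<open>For equal colors the two remaining walks differ by a letter at the end only, so their
  first steps agree. \<open>compat_behind\<close> is the variant in which \<open>v\<close> has to
  make one step to reach the color of \<open>w\<close>.\<close>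

lemma compat_same:
  assumes "compat p" "(v, w) \<in> parcs G" "sv v (p v) = sv w (p w)" "p v < len v" "p w < len w"
  shows "sv w (Suc (p w)) = sv v (Suc (p v))"
proof -
  have "hd (rest p w) = hd (rest p v)"
    by (rule hd_eq_of_snoc[OF reduced_rest reduced_rest, of _ _ _ _ "\<beta> v" "\<beta> w"])
      (use G.arc_verts[OF assms(2)] assms compat_eq[OF assms(1,2)] in \<open>auto simp: rest_Nil_iff\<close>)
  then show ?thesis using assms by (simp add: hd_rest)
qed

lemma compat_behind:
  assumes "compat p" "(v, w) \<in> parcs G" "sv v (Suc (p v)) = sv w (p w)" "Suc (p v) < len v" "p w < len w"
  shows "sv w (Suc (p w)) = sv v (Suc (Suc (p v)))"
proof -
  let ?p = "p(v := Suc (p v))"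
  have "cls (rest p w) = cls (rest ?p v) + arc (\<beta> v) (\<beta> w)"
    using compat_eq[OF assms(1,2)] assms(3,4) by (simp add: cls_rest add.assoc)
  then have "hd (rest p w) = hd (rest ?p v)"
    by (intro hd_eq_of_snoc[OF reduced_rest reduced_rest, of _ _ _ _ "\<beta> v" "\<beta> w"])
      (use G.arc_verts[OF assms(2)] assms in \<open>auto simp: rest_Nil_iff\<close>)
  then show ?thesis using assms by (simp add: hd_rest)
qed

lemma compat_move:
  assumes "compat p" "v \<in> pverts G" "p v < len v" "\<And>w. \<not> blk p v w"
  shows "compat (p(v := Suc (p v)))"
proof -
  let ?p = "p(v := Suc (p v))"
  \<comment> \<open>The move is read backwards, from the new coloring to the old one, so that
    composing it with the old homotopy cancels the letter just walked.\<close>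
  have "intertwines G (\<lambda>v. sv v (?p v)) (\<lambda>v. sv v (p v)) (\<lambda>w. arc (sv w (?p w)) (sv w (p w)))"
    by (rule intertwines_push[OF G.refl, of v]) (use assms(2-4) in \<open>auto simp: blk_def\<close>)
  from intertwines_trans[OF this assms(1)[unfolded compat_def]]
  show ?thesis unfolding compat_def
    by (rule intertwines_cong) (use G.refl assms(3) in \<open>auto simp: cls_rest rest_upd\<close>)
qed

section \<open>Synchronous rounds\<close>

definition pos :: "nat \<Rightarrow> 'a \<Rightarrow> nat" where
  "pos k v = min k (len v)"

text \<open>If \<open>w\<close> did not block \<open>v\<close> one round earlier, its color was that
  of \<open>v\<close> or the next one. Then \<open>compat_same\<close> or
  \<open>compat_behind\<close> puts it, after both have moved, again on the color of
  \<open>v\<close> or the next one, against the assumption.\<close>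

lemma blk_pos_Suc:
  assumes "compat (pos k)" "compat (pos (Suc k))" "blk (pos (Suc k)) v w"
  shows "blk (pos k) v w"
proof -
  have e: "(v, w) \<in> parcs G" and v: "Suc k < len v"
    using assms(3) by (auto simp: blk_def pos_def min_def split: if_splits)
  have w: "Suc k < len w" and wv: "sv w (Suc (Suc k)) = sv v (Suc k)"
    using blk_imp[OF assms(2,3)] v by (auto simp: pos_def min_def split: if_splits)
  have n: "sv w (Suc k) \<notin> {sv v (Suc k), sv v (Suc (Suc k))}"
    using assms(3) v w by (auto simp: blk_def pos_def)
  have "sv w k \<noteq> sv v k"
    using compat_same[OF assms(1) e] n v w by (auto simp: pos_def)
  moreover have "sv w k \<noteq> sv v (Suc k)"
    using compat_behind[OF assms(1) e] n v w by (auto simp: pos_def)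
  ultimately show ?thesis using e v w by (simp add: blk_def pos_def)
qed

lemma blk_pos:
  assumes "\<And>j. j \<le> k \<Longrightarrow> compat (pos j)" "blk (pos k) v w"
  shows "blocks v w"
  using assms
proof (induction k)
  case 0
  then show ?case
    using G.arc_verts[of v w] by (auto simp: blk_def blocks_def pos_def sv_0)
next
  case (Suc k)
  then show ?case using blk_pos_Suc[of k v w] by simp
qed

text \<open>Blockers come first because, by \<open>blk_imp\<close>, their own move takes them to the
  color of the vertex that waits for them.\<close>

definition topological :: "'a list \<Rightarrow> bool" where
  "topological os \<longleftrightarrow> distinct os \<and> set os = pverts G \<and>
     (\<forall>xs v ys w. os = xs @ v # ys \<longrightarrow> blocks v w \<longrightarrow> w \<in> set xs)"

definition pos_in :: "nat \<Rightarrow> 'a set \<Rightarrow> 'a \<Rightarrow> nat" where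
  "pos_in k A v = (if v \<in> A then pos (Suc k) v else pos k v)"

text \<open>By the choice of the order, a vertex which has a move in a round is not blocked when its
  turn comes: neither by a vertex which comes later, as then it was blocked already at the start
  of the round, nor by an earlier one which ran ahead, as that one was itself blocked.\<close>

lemma not_blk_round:
  assumes os: "topological os" "os = xs @ v # ys" and I: "\<And>j. j \<le> k \<Longrightarrow> compat (pos j)"
    and J: "compat (pos_in k (set xs))" and v: "k < len v"
  shows "\<not> blk (pos_in k (set xs)) v w"
proof
  assume b: "blk (pos_in k (set xs)) v w"
  then have e: "(v, w) \<in> parcs G" by (simp add: blk_def)
  have nv: "v \<notin> set xs" using os by (auto simp: topological_def)
  then have pv: "pos_in k (set xs) v = k" using v by (simp add: pos_in_def pos_def)
  note imp = blk_imp[OF J b]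
  show False
  proof (cases "w \<in> set xs")
    case False
    then have "blk (pos k) v w" using b nv by (simp add: blk_def pos_in_def)
    then have "blocks v w" using blk_pos I by blast
    then show False using os False unfolding topological_def by blast
  next
    case True
    then have w: "Suc k < len w" and wv: "sv w (Suc (Suc k)) = sv v k"
      using imp pv by (auto simp: pos_in_def pos_def min_def split: if_splits)
    have n: "sv w (Suc k) \<notin> {sv v k, sv v (Suc k)}"
      using b True pv w by (auto simp: blk_def pos_in_def pos_def)
    have Ik: "compat (pos k)" using I by simp
    have 1: "sv w k \<noteq> sv v k"
      using compat_same[OF Ik e] n v w by (auto simp: pos_def)
    show False
    proof (cases "sv w k = sv v (Suc k)")
      case True
      have "blk (pos k) w v"
        using 1 n w v G.arc_swap[OF e] by (auto simp: blk_def pos_def)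
      then have bl: "blocks w v" using blk_pos I by blast
      obtain x1 x2 where "xs = x1 @ w # x2" using \<open>w \<in> set xs\<close> split_list by metis
      then have "os = x1 @ w # (x2 @ v # ys)" using os(2) by simp
      then have "v \<in> set x1" using os(1) bl unfolding topological_def by blast
      then show False using nv \<open>xs = x1 @ w # x2\<close> by simp
    next
      case False
      \<comment> \<open>A vertex that blocked \<open>v\<close> at the start of the round has
        meanwhile moved to the color of \<open>v\<close>, so it no longer blocks.\<close>
      have "blk (pos k) v w" using 1 False e v w by (simp add: blk_def pos_def)
      from blk_imp[OF Ik this] show False using n w v by (simp add: pos_def)
    qed
  qed
qed

definition round :: "nat \<Rightarrow> 'a list \<Rightarrow> ('a \<times> 'b) list" where
  "round k os = map (\<lambda>v. (v, sv v (Suc k))) (filter (\<lambda>v. k < len v) os)"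

definition rounds :: "'a list \<Rightarrow> nat \<Rightarrow> ('a \<times> 'b) list" where
  "rounds os K = concat (map (\<lambda>k. round k os) [0..<K])"

definition reached :: "('a \<Rightarrow> nat) \<Rightarrow> ('a \<times> 'b) list \<Rightarrow> bool" where
  "reached p ms \<longleftrightarrow> legal G H \<alpha> ms \<and> compat p \<and>
     (\<forall>v\<in>pverts G. final \<alpha> ms v = sv v (p v) \<and> trail \<alpha> ms v = arcs_of (sv v) (p v))"

lemma reached_move:
  assumes "reached p ms" "v \<in> pverts G" "p v < len v" "\<And>w. \<not> blk p v w"
  shows "reached (p(v := Suc (p v))) (ms @ [(v, sv v (Suc (p v)))])"
proof -
  have "final \<alpha> ms w \<in> {sv v (p v), sv v (Suc (p v))}" if "(v, w) \<in> parcs G" for w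
    using that assms(1,3) assms(4)[of w] G.arc_verts[OF that] by (auto simp: reached_def blk_def)
  moreover have "sv v (p v) \<noteq> sv v (Suc (p v))"
    using sv_reduced[OF assms(2)] assms(3) by (simp add: reduced_arcs_of)
  ultimately show ?thesis
    using assms(1-3) compat_move[OF _ assms(2-4)] sv_step[OF assms(2,3)]
    by (auto simp: reached_def legal_append final_append trail_append arcs_of_snoc)
qed

lemma reached_round:
  assumes os: "topological os" and I: "\<And>j. j \<le> k \<Longrightarrow> compat (pos j)" and "reached (pos k) ms"
  shows "os = xs @ ys \<Longrightarrow> reached (pos_in k (set xs)) (ms @ round k xs)"
proof (induction xs arbitrary: ys rule: rev_induct)
  case Nil
  then show ?case using assms(3) by (simp add: pos_in_def[abs_def] round_def)
next
  case (snoc v xs)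
  then have reached: "reached (pos_in k (set xs)) (ms @ round k xs)" and os': "os = xs @ v # ys" by auto
  have v: "v \<in> pverts G" "v \<notin> set xs" using os os' by (auto simp: topological_def)
  show ?case
  proof (cases "k < len v")
    case True
    have pk: "pos_in k (set xs) v = k" using True v by (simp add: pos_in_def pos_def)
    have "reached ((pos_in k (set xs))(v := Suc k)) ((ms @ round k xs) @ [(v, sv v (Suc k))])"
      using reached_move[OF reached v(1)] not_blk_round[OF os os' I _ True] reached True pk by (auto simp: reached_def)
    moreover have "(pos_in k (set xs))(v := Suc k) = pos_in k (set (xs @ [v]))"
      using True by (auto simp: pos_in_def pos_def fun_eq_iff)
    ultimately show ?thesis using True by (simp add: round_def)
  next
    case False
    then have "pos_in k (set (xs @ [v])) = pos_in k (set xs)"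
      using v by (auto simp: pos_in_def pos_def fun_eq_iff)
    then show ?thesis using reached False by (simp add: round_def)
  qed
qed

lemma reached_rounds:
  assumes "topological os"
  shows "reached (pos K) (rounds os K) \<and> (\<forall>j\<le>K. compat (pos j))"
proof (induction K)
  case 0
  have "compat (pos 0)" unfolding compat_def
    by (rule intertwines_cong[OF sv_int]) (use G.refl sv_0 in \<open>auto simp: pos_def rest_def\<close>)
  moreover have "pos 0 = (\<lambda>_. 0)" by (simp add: pos_def fun_eq_iff)
  ultimately show ?case by (simp add: reached_def rounds_def sv_0)
next
  case (Suc K)
  then have "reached (pos_in K (set os)) (rounds os K @ round K os)"
    using reached_round[OF assms, of K "rounds os K" os "[]"] by simp
  \<comment> \<open>The two positions agree on vertices of \<open>G\<close> only, so the invariant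
    is carried over by congruence and not by rewriting.\<close>
  moreover have "pos_in K (set os) v = pos (Suc K) v" if "v \<in> pverts G" for v
    using that assms by (simp add: pos_in_def topological_def)
  moreover have "compat (pos (Suc K))" if "compat (pos_in K (set os))"
    using that unfolding compat_def
    by (rule intertwines_cong) (use G.refl calculation(2) in \<open>auto simp: rest_def\<close>)
  ultimately have "reached (pos (Suc K)) (rounds os (Suc K))"
    by (auto simp: reached_def rounds_def)
  then show ?case using Suc by (auto simp: reached_def le_Suc_eq)
qed

text \<open>Any upper bound \<open>K\<close> on the lengths serves, since rounds after the last
  arrival contain no moves.\<close>

theorem rounds_realize:
  assumes "topological os" "\<And>v. v \<in> pverts G \<Longrightarrow> len v \<le> K"
  shows "recoloring_sequence G H \<alpha> \<beta> (colorings \<alpha> (rounds os K))"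
    and "push_or_pull G (colorings \<alpha> (rounds os K))"
    and "v \<in> pverts G \<Longrightarrow> color_walk (colorings \<alpha> (rounds os K)) v = arcs_of (sv v) (len v)"
proof -
  have reached: "reached (pos K) (rounds os K)" using reached_rounds[OF assms(1)] by blast
  then have l: "legal G H \<alpha> (rounds os K)" by (simp add: reached_def)
  have f: "final \<alpha> (rounds os K) v = \<beta> v" if "v \<in> pverts G" for v
    using reached assms(2) that by (simp add: reached_def pos_def sv_end min_absorb2)
  show "recoloring_sequence G H \<alpha> \<beta> (colorings \<alpha> (rounds os K))"
    using legal_recoloring[OF G.refl H.refl hom(1) l] f by (simp add: recoloring_sequence_def)
  show "push_or_pull G (colorings \<alpha> (rounds os K))"
    using legal_recoloring[OF G.refl H.refl hom(1) l] by simp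
  show "v \<in> pverts G \<Longrightarrow> color_walk (colorings \<alpha> (rounds os K)) v = arcs_of (sv v) (len v)"
    using reached assms(2) by (simp add: color_walk_colorings[OF l] reached_def pos_def min_absorb2)
qed

text \<open>The blocker \<open>f (Suc i)\<close> starts with a step to the color of
  \<open>f i\<close>, by \<open>blk_imp\<close>, while the next vertex, which blocks it, has a color
  other than the target of that step. So the image never backtracks.\<close>

lemma blocked_cycle_tight:
  assumes "0 < n" "f n = f 0" "\<And>i. i < n \<Longrightarrow> blocks (f i) (f (Suc i))"
  shows "tight_closed_walk G \<alpha> (f 0) (arcs_of f n)"
proof -
  have compat0: "compat (\<lambda>_. 0)" unfolding compat_def
    by (rule intertwines_cong[OF sv_int]) (use G.refl sv_0 in \<open>auto simp: rest_def\<close>)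
  have e: "(f i, f (Suc i)) \<in> parcs G" if "i < n" for i
    using assms(3)[OF that] by (simp add: blocks_def)
  have step: "sv (f (Suc i)) 1 = \<alpha> (f i)" if "i < n" for i
    using blk_imp[OF compat0, of "f i" "f (Suc i)"] assms(3)[OF that] G.arc_verts[OF e[OF that]]
    by (auto simp: blk_def blocks_def sv_0)
  have ne: "\<alpha> (f (Suc i)) \<noteq> \<alpha> (f i)" if "i < n" for i
    using assms(3)[OF that] by (auto simp: blocks_def)
  have ne2: "\<alpha> (f (Suc i)) \<noteq> sv (f i) 1" if "i < n" for i
    using assms(3)[OF that] by (auto simp: blocks_def)
  obtain m where m: "n = Suc m" using assms(1) by (cases n) auto
  have img: "image_walk \<alpha> (arcs_of f n) = arcs_of (\<lambda>i. \<alpha> (f i)) n"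
    by (simp add: image_walk_def arcs_of_def)
  have "reduced (arcs_of (\<lambda>i. \<alpha> (f i)) n)"
    using ne ne2 step by (fastforce simp: reduced_arcs_of)
  \<comment> \<open>The same argument at the closing vertex \<open>f n = f 0\<close> gives the
    cyclic condition.\<close>
  moreover have "\<alpha> (f 1) \<noteq> \<alpha> (f m)"
    using step[of m] ne2[of 0] m assms(1,2) by simp
  moreover have "last (arcs_of (\<lambda>i. \<alpha> (f i)) n) = (\<alpha> (f m), \<alpha> (f n))"
    by (simp add: m arcs_of_snoc)
  ultimately have "cyclically_reduced (image_walk \<alpha> (arcs_of f n))"
    using assms(1) by (simp add: img cyclically_reduced_def hd_arcs_of)
  moreover have "walk G (f 0) (arcs_of f n) (f 0)"
    using pcas_arcs_of[of f n] assms(2) e G.arc_verts[OF e[OF assms(1)]]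
    by (auto simp: walk_iff set_arcs_of)
  ultimately show ?thesis by (simp add: tight_closed_walk_def)
qed

end


section \<open>Valid walks are realizable\<close>

text \<open>Validity forces a vertex to follow this walk, where \<open>W\<close> is any walk from the vertex to \<open>q\<close>.\<close>

definition transport ::
  "('a \<Rightarrow> 'b) \<Rightarrow> ('a \<Rightarrow> 'b) \<Rightarrow> ('b \<times> 'b) awalk \<Rightarrow> ('a \<times> 'a) awalk \<Rightarrow> 'b word" where
  "transport \<alpha> \<beta> Q W = cls (image_walk \<alpha> W) + cls Q - cls (image_walk \<beta> W)"

lemma transport_Nil: "transport \<alpha> \<beta> Q [] = cls Q"
  by (simp add: transport_def)

lemma transport_Cons:
  fixes \<alpha> \<beta> :: "'a \<Rightarrow> 'b"
  shows "transport \<alpha> \<beta> Q ((u, v) # W) = arc (\<alpha> u) (\<alpha> v) + transport \<alpha> \<beta> Q W + arc (\<beta> v) (\<beta> u)"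
proof -
  have c: "cls (image_walk f ((u, v) # W)) = arc (f u) (f v) + cls (image_walk f W)" for f :: "'a \<Rightarrow> 'b"
    using cls_append[of "[(f u, f v)]" "image_walk f W"] by simp
  show ?thesis
    unfolding transport_def c arc_sym[of "\<beta> v" "\<beta> u"]
    by (simp add: minus_add add.assoc diff_conv_add_uminus del: add_uminus_conv_diff)
qed

text \<open>Validity on the closed walk that goes back along \<open>W\<close> to \<open>u\<close>,
  through the edge and home along \<open>W'\<close> is the commuting square of the edge. One closed
  walk per edge is involved, so a violated square yields a certificate.\<close>

lemma valid_on_transport:
  fixes \<alpha> \<beta> :: "'a \<Rightarrow> 'b"
  assumes "valid_on H \<alpha> \<beta> q Q (rev_path W @ (u, v) # W')"
  shows "arc (\<alpha> u) (\<alpha> v) + transport \<alpha> \<beta> Q W' = transport \<alpha> \<beta> Q W + arc (\<beta> u) (\<beta> v)"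
proof -
  have c: "cls (image_walk f (rev_path W @ (u, v) # W')) =
    - cls (image_walk f W) + arc (f u) (f v) + cls (image_walk f W')" for f :: "'a \<Rightarrow> 'b"
    using cls_append[of "[(f u, f v)]" "image_walk f W'"]
    by (simp add: cls_append image_walk_rev_path cls_rev_path add.assoc)
  have "cls (image_walk \<beta> (rev_path W @ (u, v) # W')) =
    - cls Q + (cls (image_walk \<alpha> (rev_path W @ (u, v) # W')) + cls Q)"
    using assms
    by (simp only: valid_on_def pi_eq_iff cls_append[of "rev_path Q"] cls_append[of _ Q] cls_rev_path)
  then have "cls Q + (- cls (image_walk \<beta> W) + arc (\<beta> u) (\<beta> v) + cls (image_walk \<beta> W')) =
    - cls (image_walk \<alpha> W) + arc (\<alpha> u) (\<alpha> v) + cls (image_walk \<alpha> W') + cls Q"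
    unfolding c by simp
  then have "cls (image_walk \<alpha> W) +
      (cls Q + (- cls (image_walk \<beta> W) + arc (\<beta> u) (\<beta> v) + cls (image_walk \<beta> W'))) +
      - cls (image_walk \<beta> W') =
    arc (\<alpha> u) (\<alpha> v) + cls (image_walk \<alpha> W') + cls Q + - cls (image_walk \<beta> W')"
    by (simp add: add.assoc)
  then show ?thesis
    by (simp add: transport_def add.assoc diff_conv_add_uminus del: add_uminus_conv_diff)
qed

lemma walk_transport:
  assumes "reflexive_graph H" "graph_hom G H \<alpha>" "graph_hom G H \<beta>"
    "walk G v W q" "walk H (\<alpha> q) Q (\<beta> q)"
  shows "walk H (\<alpha> v) (Rep_word (transport \<alpha> \<beta> Q W)) (\<beta> v)"
proof -
  interpret reflexive H by (rule reflexive.intro) (rule assms)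
  have "Rep_word (transport \<alpha> \<beta> Q W) = nf (image_walk \<alpha> W @ Q @ rev_path (image_walk \<beta> W))"
    unfolding Rep_cls[symmetric]
    by (simp add: transport_def cls_append cls_rev_path add.assoc diff_conv_add_uminus
        del: add_uminus_conv_diff)
  moreover have "walk H (\<alpha> v) (image_walk \<alpha> W @ Q @ rev_path (image_walk \<beta> W)) (\<beta> v)"
    by (intro walk_append[OF walk_image[OF assms(2,4)]] walk_append[OF assms(5)]
        walk_rev[OF walk_image[OF assms(3,4)]])
  ultimately show ?thesis by (simp add: walk_nf)
qed

lemma respects_walk_transport:
  assumes "respects_walk H \<alpha> \<beta> q Q W"
  shows "transport \<alpha> \<beta> Q W = 0"
proof -
  have "cls Q = - cls (image_walk \<alpha> W) + cls (image_walk \<beta> W)"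
    using assms by (simp add: respects_walk_def pi_eq_iff cls_append cls_rev_path)
  then show ?thesis by (simp add: transport_def)
qed

text \<open>An empty list of arcs does not determine its vertex, so
  \<open>sv v 0 = \<alpha> v\<close> is demanded separately; the last vertex then follows from the
  endpoint of the transported walk.\<close>

lemma lifting_of_transport:
  fixes G :: "'a pair_pre_digraph" and H :: "'b pair_pre_digraph"
  assumes I: "recoloring_instance G H \<alpha> \<beta> q Q"
    and W: "\<And>v. v \<in> pverts G \<Longrightarrow> walk G v (W v) q"
    and S: "\<And>v. v \<in> pverts G \<Longrightarrow> arcs_of (sv v) (len v) = Rep_word (transport \<alpha> \<beta> Q (W v))"
    and sv0: "\<And>v. v \<in> pverts G \<Longrightarrow> sv v 0 = \<alpha> v"
    and int: "intertwines G \<alpha> \<beta> (\<lambda>v. transport \<alpha> \<beta> Q (W v))"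
  shows "lifting G H \<alpha> \<beta> sv len"
proof -
  interpret G: reflexive G by (rule reflexive.intro) (use I in \<open>simp add: recoloring_instance_def\<close>)
  interpret H: reflexive H by (rule reflexive.intro) (use I in \<open>simp add: recoloring_instance_def\<close>)
  have hom: "graph_hom G H \<alpha>" "graph_hom G H \<beta>" and wQ: "walk H (\<alpha> q) Q (\<beta> q)"
    using I by (simp_all add: recoloring_instance_def)
  have w: "walk H (\<alpha> v) (arcs_of (sv v) (len v)) (\<beta> v)" if "v \<in> pverts G" for v
    using walk_transport[OF H.refl hom W[OF that] wQ] S[OF that] by simp
  show ?thesis
  proof
    fix v i assume v: "v \<in> pverts G"
    show "sv v (len v) = \<beta> v"
    proof -
      have "pcas (\<alpha> v) (arcs_of (sv v) (len v)) (sv v (len v))"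
        using pcas_arcs_of[of "sv v" "len v"] sv0[OF v] by simp
      moreover have "pcas u p x \<Longrightarrow> pcas u p y \<Longrightarrow> x = y" for u x y :: 'b and p
        by (induction p arbitrary: u) auto
      ultimately show ?thesis using w[OF v] by (auto simp: walk_iff)
    qed
    show "i < len v \<Longrightarrow> (sv v i, sv v (Suc i)) \<in> parcs H"
      using w[OF v] by (auto simp: walk_iff set_arcs_of)
    show "reduced (arcs_of (sv v) (len v))"
      using S[OF v] Rep_word[of "transport \<alpha> \<beta> Q (W v)"] by simp
  next
    show "intertwines G \<alpha> \<beta> (\<lambda>v. cls (arcs_of (sv v) (len v)))"
      by (rule intertwines_cong[OF int]) (use S G.refl in \<open>simp_all add: cls_Rep\<close>)
  qed (use hom sv0 in simp_all)
qed

lemma ex_topological_list: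
  assumes "finite A" "wf R"
  shows "\<exists>os. distinct os \<and> set os = A \<and>
    (\<forall>xs v ys w. os = xs @ v # ys \<longrightarrow> w \<in> A \<longrightarrow> (w, v) \<in> R \<longrightarrow> w \<in> set xs)"
  using assms(1)
proof (induction "card A" arbitrary: A)
  case 0
  then show ?case by auto
next
  case (Suc n)
  then have "A \<noteq> {}" by auto
  then obtain a where a: "a \<in> A" "\<And>w. (w, a) \<in> R \<Longrightarrow> w \<notin> A"
    using wfE_min[OF assms(2)] by (metis all_not_in_conv)
  have "n = card (A - {a})" "finite (A - {a})" using Suc.hyps(2) Suc.prems a(1) by simp_all
  from Suc.hyps(1)[OF this] obtain os where
    os: "distinct os" "set os = A - {a}" and
    os3: "\<forall>xs v ys w. os = xs @ v # ys \<longrightarrow> w \<in> A - {a} \<longrightarrow> (w, v) \<in> R \<longrightarrow> w \<in> set xs"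
    by blast
  show ?case
  proof (intro exI[of _ "a # os"] conjI allI impI)
    fix xs v ys w assume *: "a # os = xs @ v # ys" "w \<in> A" "(w, v) \<in> R"
    then show "w \<in> set xs"
      using a(2) os3[rule_format, of "tl xs" v ys w] by (cases xs) auto
  qed (use os a in auto)
qed

lemma (in lifting) ex_topological:
  assumes "finite (pverts G)"
    and "\<And>r C v. tight_closed_walk G \<alpha> r C \<Longrightarrow> v \<in> set (pawalk_verts r C) \<Longrightarrow> len v = 0"
  shows "\<exists>os. topological os"
proof -
  define R where "R = {(w, v). blocks v w}"
  have bv: "v \<in> pverts G \<and> w \<in> pverts G \<and> 0 < len v" if "blocks v w" for v w
    using that G.arc_verts by (auto simp: blocks_def)
  have "R \<subseteq> pverts G \<times> pverts G" using bv by (auto simp: R_def)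
  then have "finite R" using assms(1) finite_subset by blast
  moreover have "acyclic R"
    unfolding acyclic_def
  proof (intro allI notI)
    fix v assume "(v, v) \<in> R\<^sup>+"
    then obtain n where n: "0 < n" "(v, v) \<in> R ^^ n" by (auto simp: trancl_power)
    then obtain g where g: "g 0 = v" "g n = v" "\<And>i. i < n \<Longrightarrow> (g i, g (Suc i)) \<in> R"
      by (auto simp: relpow_fun_conv)
    \<comment> \<open>\<open>R\<close> points from the blocker to the blocked vertex, so the cycle
      is traversed backwards.\<close>
    define f where "f i = g (n - i)" for i
    have b: "blocks (f i) (f (Suc i))" if "i < n" for i
      using g(3)[of "n - Suc i"] that by (simp add: f_def R_def Suc_diff_Suc)
    have "tight_closed_walk G \<alpha> (f 0) (arcs_of f n)"
      using n g b by (intro blocked_cycle_tight) (auto simp: f_def)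
    moreover have "f 0 \<in> set (pawalk_verts (f 0) (arcs_of f n))"
      by (cases n) (simp_all add: arcs_of_Suc)
    ultimately have "len (f 0) = 0" by (rule assms(2))
    then show False using bv b n(1) by fastforce
  qed
  ultimately have "wf R" by (rule finite_acyclic_wf)
  from ex_topological_list[OF assms(1) this] obtain os where
    os: "distinct os" "set os = pverts G"
    "\<And>xs v ys w. os = xs @ v # ys \<Longrightarrow> w \<in> pverts G \<Longrightarrow> (w, v) \<in> R \<Longrightarrow> w \<in> set xs"
    by blast
  have "topological os" unfolding topological_def
  proof (intro conjI allI impI)
    fix xs v ys w assume "os = xs @ v # ys" "blocks v w"
    then show "w \<in> set xs" using os(3) bv by (auto simp: R_def)
  qed (use os in auto)
  then show ?thesis ..
qed

lemma valid_imp_realizable: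
  fixes G :: "'a pair_pre_digraph" and H :: "'b pair_pre_digraph"
  assumes I: "recoloring_instance G H \<alpha> \<beta> q Q"
    and valid: "topologically_valid G H \<alpha> \<beta> q Q" and tight: "respects_tight_walks G H \<alpha> \<beta> q Q"
  shows "realizable G H \<alpha> \<beta> q Q"
proof -
  interpret G: reflexive G by (rule reflexive.intro) (use I in \<open>simp add: recoloring_instance_def\<close>)
  interpret H: reflexive H by (rule reflexive.intro) (use I in \<open>simp add: recoloring_instance_def\<close>)
  have hom: "graph_hom G H \<alpha>" "graph_hom G H \<beta>" and wQ: "walk H (\<alpha> q) Q (\<beta> q)"
    and q: "q \<in> pverts G" and fin: "finite (pverts G)" and red: "reduced Q"
    using I by (simp_all add: recoloring_instance_def)
  define W where "W v = (SOME p. walk G v p q)" for v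
  have W: "walk G v (W v) q" if "v \<in> pverts G" for v
    using G.connected_walk[OF that q] unfolding W_def by (rule someI_ex)
  \<comment> \<open>Stated for arbitrary walks to \<open>q\<close>: applied to a loop, it shows that
    the transport does not depend on the walk.\<close>
  have transport_step: "arc (\<alpha> u) (\<alpha> v) + transport \<alpha> \<beta> Q W2 = transport \<alpha> \<beta> Q W1 + arc (\<beta> u) (\<beta> v)"
    if "(u, v) \<in> parcs G" "walk G u W1 q" "walk G v W2 q" for u v W1 W2
    using that valid G.walk_append[OF G.walk_rev[OF that(2)] G.walk_Cons[OF that(1,3)]]
    by (intro valid_on_transport) (auto simp: topologically_valid_def)
  define S where "S v = Rep_word (transport \<alpha> \<beta> Q (W v))" for v
  define sv where "sv v i = pawalk_verts (\<alpha> v) (S v) ! i" for v i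
  define len where "len v = length (S v)" for v
  have S: "arcs_of (sv v) (len v) = S v" "sv v 0 = \<alpha> v" if "v \<in> pverts G" for v
  proof -
    have w: "pcas (\<alpha> v) (S v) (\<beta> v)"
      using walk_transport[OF H.refl hom W[OF that] wQ] by (simp add: S_def walk_iff)
    show "arcs_of (sv v) (len v) = S v"
      using arcs_of_pawalk_verts[OF w] by (simp add: len_def sv_def[abs_def])
    show "sv v 0 = \<alpha> v" using w by (cases "S v") (auto simp: sv_def)
  qed
  interpret lifting G H \<alpha> \<beta> sv len
  proof (rule lifting_of_transport[OF I W])
    show "intertwines G \<alpha> \<beta> (\<lambda>v. transport \<alpha> \<beta> Q (W v))"
      unfolding intertwines_def using transport_step W G.arc_verts by fast
  qed (use S in \<open>simp_all add: S_def\<close>)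
  have "\<exists>os. topological os"
  proof (rule ex_topological[OF fin])
    fix r C v assume C: "tight_closed_walk G \<alpha> r C" "v \<in> set (pawalk_verts r C)"
    then have "v \<in> pverts G"
      using set_pawalk_verts[of r C r] G.arc_verts
      by (auto simp: tight_closed_walk_def walk_iff)
    then have "transport \<alpha> \<beta> Q (W v) = 0"
      using C tight W by (intro respects_walk_transport[of H _ _ q]) (auto simp: respects_tight_walks_def)
    then show "len v = 0"
      using Rep_cls[of "[]"] by (simp add: len_def S_def)
  qed
  then obtain os where os: "topological os" ..
  define K where "K = (\<Sum>v\<in>pverts G. len v)"
  have K: "len v \<le> K" if "v \<in> pverts G" for v
    unfolding K_def using that fin by (intro member_le_sum) auto
  note r = rounds_realize[OF os K]
  \<comment> \<open>The loop at \<open>q\<close> compares the chosen walk from \<open>q\<close> to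
    itself with the trivial one.\<close>
  have "cls (S q) = cls Q"
    using transport_step[OF G.arc_loop[OF q] W[OF q] G.walk_Nil[OF q]]
    by (simp add: S_def cls_Rep transport_Nil)
  then have "cls Q = cls (color_walk (colorings \<alpha> (rounds os K)) q)"
    using r(3)[OF _ q] S(1)[OF q] by simp
  then have "pi_eq H (\<alpha> q) (\<beta> q) Q (color_walk (colorings \<alpha> (rounds os K)) q)"
    using wQ color_walk_walk[OF H.refl r(1) q] by (simp add: pi_eq_iff)
  then show ?thesis using r(1,2) by (auto simp: realizable_def)
qed

section \<open>Weakest preconditions with time\<close>

text \<open>Total correctness: an execution exists, and its time is passed to \<open>P\<close>. By
  \<open>exec_deterministic\<close> it is the only one.\<close>

definition wp ::
  "nat pair_pre_digraph \<Rightarrow> nat pair_pre_digraph \<Rightarrow> com \<Rightarrow> state \<Rightarrow> (nat \<Rightarrow> state \<Rightarrow> bool) \<Rightarrow> bool" where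
  "wp G H c s P \<longleftrightarrow> (\<exists>t s'. exec G H c s t s' \<and> P t s')"

lemma wp_Skip [simp]: "wp G H Skip s P \<longleftrightarrow> P 1 s"
  unfolding wp_def using exec.Skip[of G H s] by (fastforce elim: exec.cases)

lemma wp_Assign [simp]: "wp G H (Assign x e) s P \<longleftrightarrow> P 1 (s\<lparr>reg := (reg s)(x := aval s e)\<rparr>)"
  unfolding wp_def using exec.Assign[of G H x e s] by (fastforce elim: exec.cases)

lemma wp_Store [simp]:
  "wp G H (Store a e f) s P \<longleftrightarrow>
     P 1 (s\<lparr>arr := (arr s)(a := (arr s a)(aval s e := aval s f))\<rparr>)"
  unfolding wp_def using exec.Store[of G H a e f s] by (fastforce elim: exec.cases)

lemma wp_Seq [simp]:
  "wp G H (Seq c d) s P \<longleftrightarrow> wp G H c s (\<lambda>t s'. wp G H d s' (\<lambda>t' s''. P (t + t') s''))"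
  (is "?l \<longleftrightarrow> ?r")
proof
  assume ?l
  then obtain u s'' where e: "exec G H (Seq c d) s u s''" "P u s''" by (auto simp: wp_def)
  from e(1) obtain t s' t' where "exec G H c s t s'" "exec G H d s' t' s''" "u = t + t'"
    by (cases rule: exec.cases) auto
  with e(2) show ?r by (auto simp: wp_def)
qed (auto simp: wp_def intro: exec.Seq)

lemma wp_Cond [simp]:
  "wp G H (Cond b c d) s P \<longleftrightarrow>
     (if bval G H s b then wp G H c s (\<lambda>t. P (Suc t)) else wp G H d s (\<lambda>t. P (Suc t)))"
  (is "?l \<longleftrightarrow> ?r")
proof
  assume ?l
  then obtain u s'' where e: "exec G H (Cond b c d) s u s''" "P u s''" by (auto simp: wp_def)
  from e(1) show ?r by (cases rule: exec.cases) (use e(2) in \<open>auto simp: wp_def\<close>)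
qed (auto simp: wp_def split: if_splits intro: exec.Cond_True exec.Cond_False)

lemma wp_mono: "wp G H c s P \<Longrightarrow> (\<And>t s'. P t s' \<Longrightarrow> P' t s') \<Longrightarrow> wp G H c s P'"
  by (auto simp: wp_def)

text \<open>The potential \<open>\<phi>\<close> is the termination measure and the remaining time at
  once; each iteration, including its test, is paid by the drop of \<open>\<phi>\<close>. The extra
  step in the postcondition is the failing test.\<close>

lemma wp_Loop:
  assumes "I s"
    and step: "\<And>s. I s \<Longrightarrow> bval G H s b \<Longrightarrow> wp G H c s (\<lambda>t s'. I s' \<and> Suc t + \<phi> s' \<le> \<phi> s)"
    and post: "\<And>t s'. I s' \<Longrightarrow> \<not> bval G H s' b \<Longrightarrow> t + \<phi> s' \<le> Suc (\<phi> s) \<Longrightarrow> P t s'"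
  shows "wp G H (Loop b c) s P"
proof -
  have "\<exists>t s'. exec G H (Loop b c) s t s' \<and> I s' \<and> \<not> bval G H s' b \<and> t + \<phi> s' \<le> Suc (\<phi> s)"
    using assms(1)
  proof (induction "\<phi> s" arbitrary: s rule: less_induct)
    case less
    show ?case
    proof (cases "bval G H s b")
      case False
      then show ?thesis using less.prems exec.Loop_False[of G H s b c] by (intro exI[of _ 1] exI[of _ s]) simp
    next
      case True
      then obtain t s' where s': "exec G H c s t s'" "I s'" "Suc t + \<phi> s' \<le> \<phi> s"
        using step[OF less.prems True] by (auto simp: wp_def)
      with less.hyps[of s'] obtain u s'' where
        "exec G H (Loop b c) s' u s''" "I s''" "\<not> bval G H s'' b" "u + \<phi> s'' \<le> Suc (\<phi> s')"
        by auto
      with exec.Loop_True[OF True s'(1)] s'(3) show ?thesis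
        by (intro exI[of _ "Suc (t + u)"] exI[of _ s'']) auto
    qed
  qed
  then show ?thesis using post by (auto simp: wp_def)
qed

definition frame :: "nat set \<Rightarrow> nat set \<Rightarrow> state \<Rightarrow> state \<Rightarrow> bool" where
  "frame R A s s' \<longleftrightarrow>
     (\<forall>x. x \<notin> R \<longrightarrow> reg s' x = reg s x) \<and> (\<forall>a. a \<notin> A \<longrightarrow> arr s' a = arr s a)"

lemma frame_refl [simp]: "frame R A s s"
  by (simp add: frame_def)

lemma frame_trans: "frame R A s s' \<Longrightarrow> frame R' A' s' s'' \<Longrightarrow> R \<union> R' \<subseteq> X \<Longrightarrow> A \<union> A' \<subseteq> Y \<Longrightarrow> frame X Y s s''"
  unfolding frame_def by (metis UnCI subset_iff)


text \<open>A double loop is programmed as one loop whose iterations advance either the inner index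
  \<open>w\<close> or the outer index \<open>i\<close>, resetting \<open>w\<close>. Each may spend
  \<open>K\<close>; the excess of \<open>M + 2\<close> over \<open>M\<close> pays for the iteration
  that resets.\<close>

definition pot :: "nat \<Rightarrow> nat \<Rightarrow> nat \<Rightarrow> nat \<Rightarrow> nat \<Rightarrow> nat" where
  "pot K N M i w = K * ((N - i) * (M + 2) + (M - w))"

lemma pot_step: "w < M \<Longrightarrow> pot K N M i (Suc w) + K = pot K N M i w"
  by (simp add: pot_def Suc_diff_Suc[symmetric] algebra_simps)

lemma pot_next: "i < N \<Longrightarrow> pot K N M (Suc i) 0 + K \<le> pot K N M i w"
  by (simp add: pot_def Suc_diff_Suc[symmetric] algebra_simps)

lemma pot_0: "pot K N M 0 0 = K * (N * (M + 2) + M)"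
  by (simp add: pot_def)

abbreviation seq (infixr ";;" 60) where "c ;; d \<equiv> Seq c d"
abbreviation assign (infix "::=" 65) where "x ::= e \<equiv> Assign x e"

text \<open>The vertex list of \<open>v\<close>, a walk with \<open>LEN v\<close> edges, is stored in \<open>MEM\<close> from position \<open>PTR v\<close>
  on; that of \<open>q\<close> is the input array of \<open>Q\<close> itself. The registers are used as follows.
  \<^item> 4, 5, 6: end and head of the queue, neighbor (\<open>bfs\<close>)
  \<^item> 7, \<dots>, 13: index in the queue, first free cell, vertex, parent, length, index and value of the
    letter (\<open>rows\<close>)
  \<^item> 17, 18, 19: the edge under test, failure flag; 20, 21: the items to compare; 24: whether a
    comparison is needed (\<open>edges\<close>)
  \<^item> 28, \<dots>, 33: stack height, number of finished vertices, root, top of the stack, neighbor, cycle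
    flag (\<open>dfs\<close>)\<close>

abbreviation (input) "MEM \<equiv> 2 :: nat"
abbreviation (input) "PTR \<equiv> 3 :: nat"
abbreviation (input) "LEN \<equiv> 4 :: nat"
abbreviation (input) "ORD \<equiv> 5 :: nat"
abbreviation (input) "PAR \<equiv> 6 :: nat"
abbreviation (input) "DEP \<equiv> 7 :: nat"
abbreviation (input) "VIS \<equiv> 8 :: nat"
abbreviation (input) "CLS \<equiv> 9 :: nat"
abbreviation (input) "STATE \<equiv> 10 :: nat"
abbreviation (input) "SCAN \<equiv> 11 :: nat"
abbreviation (input) "STACK \<equiv> 12 :: nat"
abbreviation (input) "POS \<equiv> 13 :: nat"
abbreviation (input) "TOP \<equiv> 14 :: nat"

text \<open>The queue is read but never shortened, so \<open>ORD\<close> is at the end an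
  enumeration of all vertices in which parents precede their children.\<close>

definition bfs :: com where
  "bfs =
    Store ORD (Num 0) (Reg 2);; Store VIS (Reg 2) (Num 1);; Store DEP (Reg 2) (Num 0);;
    4 ::= Num 1;; 5 ::= Num 0;; 6 ::= Num 0;;
    Loop (Less (Reg 5) (Reg 4))
      (Cond (Less (Reg 6) (Reg 0))
        (Cond (Conj (EdgeG (Arr ORD (Reg 5)) (Reg 6)) (Equal (Arr VIS (Reg 6)) (Num 0)))
          (Store VIS (Reg 6) (Num 1);; Store PAR (Reg 6) (Arr ORD (Reg 5));;
           Store DEP (Reg 6) (Add (Arr DEP (Arr ORD (Reg 5))) (Num 1));;
           Store ORD (Reg 4) (Reg 6);; 4 ::= Add (Reg 4) (Num 1))
          Skip;;
         6 ::= Add (Reg 6) (Num 1))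
        (5 ::= Add (Reg 5) (Num 1);; 6 ::= Num 0))"

locale instance_nat =
  fixes G H :: "nat pair_pre_digraph" and \<alpha> \<beta> :: "nat \<Rightarrow> nat" and q :: nat
    and Q :: "(nat \<times> nat) awalk" and n :: nat
  assumes inst: "recoloring_instance G H \<alpha> \<beta> q Q" and verts: "pverts G = {..<n}"
begin

sublocale G: reflexive G
  by (rule reflexive.intro) (use inst in \<open>simp add: recoloring_instance_def\<close>)

sublocale H: reflexive H
  by (rule reflexive.intro) (use inst in \<open>simp add: recoloring_instance_def\<close>)

lemma q: "q < n"
  using inst verts by (auto simp: recoloring_instance_def)

lemma edge_less: "(u, v) \<in> parcs G \<Longrightarrow> u < n \<and> v < n"
  using G.arc_verts verts by auto

definition "input s \<longleftrightarrow> reg s 0 = n \<and> reg s 2 = q \<and> reg s 3 = length Q \<and>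
  (\<forall>v<n. arr s 0 v = \<alpha> v) \<and> (\<forall>v<n. arr s 1 v = \<beta> v)"

section \<open>Spanning tree\<close>

definition tree :: "nat \<Rightarrow> (nat \<Rightarrow> nat) \<Rightarrow> (nat \<Rightarrow> nat) \<Rightarrow> (nat \<Rightarrow> nat) \<Rightarrow> bool" where
  "tree k ord par dep \<longleftrightarrow> ord 0 = q \<and> dep q = 0 \<and> inj_on ord {..<k} \<and> ord ` {..<k} \<subseteq> {..<n} \<and>
     (\<forall>j. 0 < j \<longrightarrow> j < k \<longrightarrow> (ord j, par (ord j)) \<in> parcs G \<and>
        dep (ord j) = Suc (dep (par (ord j))) \<and> par (ord j) \<in> ord ` {..<j})"

definition bfs_inv where
  "bfs_inv ord par dep vis k i w \<longleftrightarrow> tree k ord par dep \<and> 0 < k \<and> i \<le> k \<and> w \<le> n \<and>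
     (\<forall>v<n. vis v = (0::nat) \<longleftrightarrow> v \<notin> ord ` {..<k}) \<and>
     (\<forall>j<i. \<forall>v. (ord j, v) \<in> parcs G \<longrightarrow> v \<in> ord ` {..<k}) \<and>
     (\<forall>v<w. (ord i, v) \<in> parcs G \<longrightarrow> i < k \<longrightarrow> v \<in> ord ` {..<k})"

lemma tree_card: "tree k ord par dep \<Longrightarrow> k \<le> n"
  using card_mono[of "{..<n}" "ord ` {..<k}"] by (auto simp: tree_def card_image)

lemma tree_extend:
  assumes "tree k ord par dep" "i < k" "(ord i, w) \<in> parcs G" "w \<notin> ord ` {..<k}" "0 < k"
  shows "tree (Suc k) (ord(k := w)) (par(w := ord i)) (dep(w := Suc (dep (ord i))))"
proof -
  have w: "ord j \<noteq> w" if "j < k" for j using assms(4) that by auto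
  have im: "(ord(k := w)) ` {..<j} = ord ` {..<j}" if "j \<le> k" for j
    using that by (intro image_cong) auto
  have wq: "w \<noteq> q" using assms(1,5) w[of 0] by (auto simp: tree_def)
  have "ord i \<noteq> w" using w assms(2) by blast
  have inj: "inj_on (ord(k := w)) {..<Suc k}"
    using assms(1,4) by (auto simp: tree_def lessThan_Suc inj_on_def)
  have pw: "par (ord j) \<noteq> w" if "0 < j" "j < k" for j
  proof -
    have "par (ord j) \<in> ord ` {..<j}" using assms(1) that by (simp add: tree_def)
    then show ?thesis using w that by (metis imageE lessThan_iff less_trans)
  qed
  show ?thesis
    unfolding tree_def
  proof (intro conjI allI impI inj)
    fix j assume j: "0 < j" "j < Suc k"
    have "(ord(k := w)) j \<in> insert w (ord ` {..<k})" by (use j in auto)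
    show "((ord(k := w)) j, (par(w := ord i)) ((ord(k := w)) j)) \<in> parcs G"
      using assms w j G.arc_swap[OF assms(3)] by (auto simp: tree_def)
    show "(dep(w := Suc (dep (ord i)))) ((ord(k := w)) j) =
      Suc ((dep(w := Suc (dep (ord i)))) ((par(w := ord i)) ((ord(k := w)) j)))"
      using assms(1) w[of j] pw[of j] j \<open>ord i \<noteq> w\<close> by (auto simp: tree_def)
    show "(par(w := ord i)) ((ord(k := w)) j) \<in> (ord(k := w)) ` {..<j}"
      using assms(1,2) w[of j] j im[of j] by (auto simp: tree_def)
  qed (use assms wq edge_less[OF assms(3)] im[of k] in \<open>auto simp: tree_def lessThan_Suc\<close>)
qed

lemma bfs_inv_visit:
  assumes "bfs_inv ord par dep vis k i w" "i < k" "w < n" "(ord i, w) \<in> parcs G" "vis w = 0"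
  shows "bfs_inv (ord(k := w)) (par(w := ord i)) (dep(w := Suc (dep (ord i)))) (vis(w := Suc 0))
    (Suc k) i (Suc w)"
proof -
  have im: "(ord(k := w)) ` {..<Suc k} = insert w (ord ` {..<k})"
    by (auto simp: lessThan_Suc)
  have "w \<notin> ord ` {..<k}" using assms by (auto simp: bfs_inv_def)
  then have "tree (Suc k) (ord(k := w)) (par(w := ord i)) (dep(w := Suc (dep (ord i))))"
    using assms by (intro tree_extend) (auto simp: bfs_inv_def)
  then show ?thesis
    unfolding bfs_inv_def im using assms by (auto simp: bfs_inv_def less_Suc_eq)
qed

text \<open>When the queue is exhausted, the visited set is closed under adjacency and contains
  \<open>q\<close>, so it is everything by connectedness; injectivity of \<open>ord\<close> turns
  this into \<open>k = n\<close>.\<close>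

lemma bfs_inv_done:
  assumes "bfs_inv ord par dep vis k k w"
  shows "tree n ord par dep"
proof -
  have closed: "v \<in> ord ` {..<k}" if "(u, v) \<in> parcs G" "u \<in> ord ` {..<k}" for u v
    using assms that by (auto simp: bfs_inv_def)
  have "v \<in> ord ` {..<k}" if v: "v < n" for v
  proof -
    obtain p where "walk G q p v" using G.connected_walk[of q v] q v verts by auto
    then have "set p \<subseteq> parcs G" "pcas q p v" by (auto simp: walk_iff)
    moreover have "u \<in> ord ` {..<k} \<Longrightarrow> set p \<subseteq> parcs G \<Longrightarrow> pcas u p v \<Longrightarrow> v \<in> ord ` {..<k}" for u
    proof (induction p arbitrary: u)
      case (Cons e p)
      then show ?case using closed[of u "snd e"] by (cases e) auto
    qed simp
    moreover have "q \<in> ord ` {..<k}" using assms by (auto simp: bfs_inv_def tree_def)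
    ultimately show ?thesis by blast
  qed
  moreover have t: "tree k ord par dep" using assms by (simp add: bfs_inv_def)
  ultimately have "ord ` {..<k} = {..<n}" by (auto simp: tree_def)
  then have "k = n" using t card_image[of ord "{..<k}"] by (simp add: tree_def)
  with t show ?thesis by simp
qed

lemma bfs_correct:
  assumes "input s" "\<And>v. v < n \<Longrightarrow> arr s VIS v = 0"
  shows "wp G H bfs s (\<lambda>t s'. t \<le> 10 * (n * (n + 2) + n) + 10 \<and>
     frame {4, 5, 6} {ORD, PAR, DEP, VIS} s s' \<and> tree n (arr s' ORD) (arr s' PAR) (arr s' DEP))"
  unfolding bfs_def wp_Seq wp_Assign wp_Store
proof (rule wp_Loop[where I = "\<lambda>s'. frame {4, 5, 6} {ORD, PAR, DEP, VIS} s s' \<and>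
      bfs_inv (arr s' ORD) (arr s' PAR) (arr s' DEP) (arr s' VIS) (reg s' 4) (reg s' 5) (reg s' 6)"
     and \<phi> = "\<lambda>s'. pot 10 n n (reg s' 5) (reg s' 6)"], goal_cases)
  case 1
  then show ?case using assms q by (auto simp: input_def frame_def bfs_inv_def tree_def lessThan_Suc)
next
  case (2 s')
  then have I: "bfs_inv (arr s' 5) (arr s' 6) (arr s' 7) (arr s' 8) (reg s' 4) (reg s' 5) (reg s' 6)"
    and f: "frame {4, 5, 6} {5, 6, 7, 8} s s'" and i: "reg s' 5 < reg s' 4" by auto
  have n: "reg s' 0 = n" using f assms(1) by (simp add: frame_def input_def)
  have i': "reg s' 5 < n" using i I tree_card by (fastforce simp: bfs_inv_def)
  show ?case
  proof (cases "reg s' 6 < n")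
    case True
    show ?thesis
      using True n f pot_step[OF True, of 10 n "reg s' 5"] bfs_inv_visit[OF I i True] I i
      by (auto simp: frame_def bfs_inv_def less_Suc_eq)
  next
    case False
    then have "v \<in> arr s' 5 ` {..<reg s' 4}" if "(arr s' 5 (reg s' 5), v) \<in> parcs G" for v
      using that I i edge_less[OF that] by (auto simp: bfs_inv_def)
    then show ?thesis
      using False n f pot_next[OF i', of 10 n "reg s' 6"] I i
      by (auto simp: frame_def bfs_inv_def less_Suc_eq)
  qed
next
  case (3 t s')
  then have "reg s' 4 = reg s' 5" by (simp add: bfs_inv_def)
  with 3 bfs_inv_done show ?case by (auto simp: pot_0)
qed

end

section \<open>The reduced walks of all vertices\<close>

text \<open>The list of the parent, with the start of the child in front and its end behind, is
  reduced on a stack at the end of \<open>MEM\<close>. The parent's list lies below register 8 and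
  is read while the stack grows.\<close>

definition push :: com where
  "push =
    Loop (Less (Reg 12) (Add (Arr LEN (Reg 10)) (Num 2)))
      (Cond (Less (Reg 12) (Add (Arr LEN (Reg 10)) (Num 1)))
         (13 ::= Arr MEM (Add (Arr PTR (Reg 10)) (Reg 12)))
         (13 ::= Arr 1 (Reg 9));;
       Cond (Equal (Arr MEM (Add (Reg 8) (Reg 11))) (Reg 13))
         Skip
         (Cond (Conj (Less (Num 0) (Reg 11))
                 (Equal (Arr MEM (Add (Reg 8) (Sub (Reg 11) (Num 1)))) (Reg 13)))
            (11 ::= Sub (Reg 11) (Num 1))
            (11 ::= Add (Reg 11) (Num 1);; Store MEM (Add (Reg 8) (Reg 11)) (Reg 13)));;
       12 ::= Add (Reg 12) (Num 1))"

lemma last_arcs_of: "0 < k \<Longrightarrow> last (arcs_of f k) = (f (k - 1), f k)"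
  by (cases k) (simp_all add: arcs_of_snoc)

lemma butlast_arcs_of: "butlast (arcs_of f k) = arcs_of f (k - 1)"
  by (cases k) (simp_all add: arcs_of_snoc)

lemma nf_arcs_of_snoc:
  assumes "arcs_of h l = nf (arcs_of f j)" "h l = f j"
  shows "nf (arcs_of f (Suc j)) =
    (if h l = f (Suc j) then arcs_of h l
     else if 0 < l \<and> h (l - 1) = f (Suc j) then arcs_of h (l - 1)
     else arcs_of h l @ [(h l, f (Suc j))])"
proof -
  have "nf (arcs_of f (Suc j)) = nf (arcs_of h l @ [(h l, f (Suc j))])"
    using assms by (simp add: arcs_of_snoc)
  moreover have "reduced (arcs_of h l)" using assms(1) reduced_nf by metis
  ultimately show ?thesis by (auto simp: nf_snoc last_arcs_of butlast_arcs_of)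
qed

text \<open>\<open>f\<close> is the vertex list before reduction, which is not stored anywhere: two
  letters more than the list of the parent.\<close>

lemma push_correct:
  assumes F: "arr s PTR (reg s 10) + arr s LEN (reg s 10) < reg s 8" and "reg s 11 = 0" "reg s 12 = 0"
    and f: "f 0 = arr s MEM (reg s 8)"
      "\<And>j. j \<le> arr s LEN (reg s 10) \<Longrightarrow> f (Suc j) = arr s MEM (arr s PTR (reg s 10) + j)"
      "f (arr s LEN (reg s 10) + 2) = arr s 1 (reg s 9)"
  shows "wp G H push s (\<lambda>t s'. t \<le> 10 * (arr s LEN (reg s 10) + 2) + 1 \<and>
    frame {11, 12, 13} {MEM} s s' \<and> (\<forall>i<reg s 8. arr s' MEM i = arr s MEM i) \<and>
    arr s' MEM (reg s 8) = f 0 \<and>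
    arr s' MEM (reg s 8 + reg s' 11) = f (arr s LEN (reg s 10) + 2) \<and>
    arcs_of (\<lambda>i. arr s' MEM (reg s 8 + i)) (reg s' 11) =
      nf (arcs_of f (arr s LEN (reg s 10) + 2)))"
  unfolding push_def
proof (rule wp_Loop[where I = "\<lambda>s'. frame {11, 12, 13} {MEM} s s' \<and>
      (\<forall>i<reg s 8. arr s' MEM i = arr s MEM i) \<and> arr s' MEM (reg s 8) = f 0 \<and>
      reg s' 12 \<le> arr s LEN (reg s 10) + 2 \<and>
      arr s' MEM (reg s 8 + reg s' 11) = f (reg s' 12) \<and>
      arcs_of (\<lambda>i. arr s' MEM (reg s 8 + i)) (reg s' 11) = nf (arcs_of f (reg s' 12))"
    and \<phi> = "\<lambda>s'. 10 * (arr s LEN (reg s 10) + 2 - reg s' 12)"], goal_cases)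
  case 1
  then show ?case using assms by simp
next
  case (2 s')
  let ?F = "reg s 8" and ?k = "arr s LEN (reg s 10)" and ?l = "reg s' 11" and ?j = "reg s' 12"
  let ?h = "\<lambda>i. arr s' MEM (?F + i)"
  have fr: "frame {11, 12, 13} {MEM} s s'" and low: "\<forall>i<?F. arr s' MEM i = arr s MEM i"
    and h0: "arr s' MEM ?F = f 0" and hl: "?h ?l = f ?j"
    and h: "arcs_of ?h ?l = nf (arcs_of f ?j)" and j: "?j < ?k + 2"
    using 2 by (auto simp: frame_def)
  have regs: "reg s' 8 = ?F" "reg s' 9 = reg s 9" "reg s' 10 = reg s 10" "arr s' LEN = arr s LEN"
    "arr s' PTR = arr s PTR" "arr s' 1 = arr s 1" using fr by (simp_all add: frame_def)
  define c where "c = f (Suc ?j)"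
  have c: "(if ?j < ?k + 1 then arr s' MEM (arr s PTR (reg s 10) + ?j) else arr s 1 (reg s 9)) = c"
  proof (cases "?j < ?k + 1")
    case True
    then show ?thesis using f(2)[of ?j] low F by (simp add: c_def)
  next
    case False
    then have "?j = Suc ?k" using j by simp
    then show ?thesis using f(3) by (simp add: c_def)
  qed
  have pot: "10 * (?k + 2 - ?j) = 10 * (?k + 2 - Suc ?j) + 10" using j by simp
  note snoc = nf_arcs_of_snoc[OF h hl, folded c_def]
  have upd: "arcs_of (\<lambda>i. if ?F + i = Suc (?F + ?l) then c else ?h i) (Suc ?l) =
      arcs_of ?h ?l @ [(?h ?l, c)]"
    using arcs_of_cong[of ?l "\<lambda>i. if ?F + i = Suc (?F + ?l) then c else ?h i" ?h]
    by (simp add: arcs_of_snoc)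
  consider "?h ?l = c" | "?h ?l \<noteq> c" "0 < ?l" "?h (?l - 1) = c"
    | "?h ?l \<noteq> c" "\<not> (0 < ?l \<and> ?h (?l - 1) = c)"
    by (cases "?h ?l = c"; cases "0 < ?l \<and> ?h (?l - 1) = c") auto
  then show ?case
  proof cases
    case 1
    then show ?thesis using fr low h0 h hl j snoc c pot
      by (cases "?j < ?k + 1") (simp_all add: regs frame_def c_def[symmetric])
  next
    case 2
    then show ?thesis using fr low h0 h hl j snoc c pot
      by (cases "?j < ?k + 1") (simp_all add: regs frame_def c_def[symmetric])
  next
    case 3
    then show ?thesis using fr low h0 h hl j snoc c pot upd
      by (cases "?j < ?k + 1") (auto simp: regs frame_def c_def[symmetric] cong: if_cong)
  qed
next
  case (3 t s')
  then have "reg s' 12 = arr s LEN (reg s 10) + 2" by (auto simp: frame_def)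
  with 3 show ?case by simp
qed

definition rows :: com where
  "rows =
    Store PTR (Reg 2) (Num 0);; Store LEN (Reg 2) (Reg 3);;
    8 ::= Add (Reg 3) (Num 1);; 7 ::= Num 1;;
    Loop (Less (Reg 7) (Reg 0))
      (9 ::= Arr ORD (Reg 7);; 10 ::= Arr PAR (Reg 9);;
       Store MEM (Reg 8) (Arr 0 (Reg 9));; 11 ::= Num 0;; 12 ::= Num 0;;
       push;;
       Store PTR (Reg 9) (Reg 8);; Store LEN (Reg 9) (Reg 11);;
       8 ::= Add (Add (Reg 8) (Reg 11)) (Num 1);; 7 ::= Add (Reg 7) (Num 1))"

section \<open>Tree walks and stored lists\<close>

definition tw :: "(nat \<Rightarrow> nat) \<Rightarrow> (nat \<Rightarrow> nat) \<Rightarrow> nat \<Rightarrow> (nat \<times> nat) awalk" where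
  "tw par dep v = arcs_of (\<lambda>i. (par ^^ i) v) (dep v)"

context instance_nat
begin

lemma tw_q: "tree k ord par dep \<Longrightarrow> tw par dep q = []"
  by (simp add: tree_def tw_def)

lemma tw_step:
  "tree k ord par dep \<Longrightarrow> 0 < j \<Longrightarrow> j < k \<Longrightarrow>
     tw par dep (ord j) = (ord j, par (ord j)) # tw par dep (par (ord j))"
  by (simp add: tree_def tw_def arcs_of_Suc funpow_swap1)

lemma tree_walk:
  assumes "tree n ord par dep" "j < n"
  shows "walk G (ord j) (tw par dep (ord j)) q \<and> (par ^^ dep (ord j)) (ord j) = q"
  using assms(2)
proof (induction j rule: less_induct)
  case (less j)
  show ?case
  proof (cases "j = 0")
    case True
    then show ?thesis using assms q verts tw_q[OF assms(1)]
      by (auto simp: tree_def intro: G.walk_Nil)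
  next
    case False
    then have "par (ord j) \<in> ord ` {..<j}" and e: "(ord j, par (ord j)) \<in> parcs G"
      and d: "dep (ord j) = Suc (dep (par (ord j)))"
      using assms(1) less.prems by (auto simp: tree_def)
    then obtain i where i: "i < j" "par (ord j) = ord i" by blast
    show ?thesis using e d i less.IH[OF i(1)] less.prems tw_step[OF assms(1), of j]
      by (auto simp: funpow_swap1 intro: G.walk_Cons)
  qed
qed

lemma tree_surj: "tree n ord par dep \<Longrightarrow> v < n \<Longrightarrow> \<exists>j<n. v = ord j"
  using card_subset_eq[of "{..<n}" "ord ` {..<n}"]
  by (auto simp: tree_def card_image set_eq_iff image_iff)

definition row :: "(nat \<Rightarrow> nat) \<Rightarrow> (nat \<Rightarrow> nat) \<Rightarrow> (nat \<Rightarrow> nat) \<Rightarrow> (nat \<Rightarrow> nat) \<Rightarrow> (nat \<Rightarrow> nat) \<Rightarrow> nat \<Rightarrow> bool" where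
  "row par dep mem ptr len v \<longleftrightarrow>
     arcs_of (\<lambda>i. mem (ptr v + i)) (len v) = Rep_word (transport \<alpha> \<beta> Q (tw par dep v)) \<and>
     mem (ptr v) = \<alpha> v \<and> mem (ptr v + len v) = \<beta> v"

text \<open>By \<open>transport_Cons\<close> the walk of a child arises from that of its parent by
  one letter in front and one behind. The inner vertices of these letters are the ends of the stored
  list, also when the parent's walk is empty.\<close>

lemma row_extend:
  assumes "tree n ord par dep" "0 < j" "j < n" "row par dep mem ptr len (par (ord j))"
    and "f 0 = \<alpha> (ord j)"
      "\<And>i. i \<le> len (par (ord j)) \<Longrightarrow> f (Suc i) = mem (ptr (par (ord j)) + i)"
      "f (len (par (ord j)) + 2) = \<beta> (ord j)"
  shows "nf (arcs_of f (len (par (ord j)) + 2)) = Rep_word (transport \<alpha> \<beta> Q (tw par dep (ord j)))"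
proof -
  let ?p = "par (ord j)"
  let ?k = "len ?p"
  have f: "f (Suc 0) = \<alpha> ?p" "f (Suc ?k) = \<beta> ?p"
    using assms(4) assms(6)[of 0] assms(6)[of ?k] by (auto simp: row_def)
  have "arcs_of f (Suc (Suc ?k)) =
      [(\<alpha> (ord j), \<alpha> ?p)] @ arcs_of (\<lambda>i. mem (ptr ?p + i)) ?k @ [(\<beta> ?p, \<beta> (ord j))]"
    using assms(5,7) f arcs_of_cong[of ?k "\<lambda>i. f (Suc i)" "\<lambda>i. mem (ptr ?p + i)"] assms(6)
    by (simp add: arcs_of_Suc[of f "Suc ?k"] arcs_of_snoc[of "\<lambda>i. f (Suc i)" ?k])
  then have "cls (arcs_of f (Suc (Suc ?k))) = transport \<alpha> \<beta> Q ((ord j, ?p) # tw par dep ?p)"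
    using assms(4) by (simp only: transport_Cons cls_append row_def cls_Rep add.assoc)
  then show ?thesis
    using tw_step[OF assms(1-3)] Rep_cls[of "arcs_of f (Suc (Suc ?k))"] by simp
qed

text \<open>The parent comes earlier in \<open>ord\<close> and its walk is at most two letters
  shorter, whence the bound \<open>length Q + 2 * j\<close>.\<close>

definition rows_inv where
  "rows_inv ord par dep mem ptr len i free \<longleftrightarrow>
     (\<forall>j<i. row par dep mem ptr len (ord j) \<and>
        ptr (ord j) + len (ord j) < free \<and> len (ord j) \<le> length Q + 2 * j)"

lemma rows_inv_par:
  assumes "tree n ord par dep" "rows_inv ord par dep mem ptr len j free" "0 < j" "j < n"
  shows "row par dep mem ptr len (par (ord j))"
    and "ptr (par (ord j)) + len (par (ord j)) < free"
    and "len (par (ord j)) + 2 \<le> length Q + 2 * j"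
proof -
  obtain i where "i < j" "par (ord j) = ord i"
    using assms by (auto simp: tree_def)
  moreover from this have "row par dep mem ptr len (ord i)" "ptr (ord i) + len (ord i) < free"
    "len (ord i) \<le> length Q + 2 * i"
    using assms(2) by (auto simp: rows_inv_def)
  ultimately show "row par dep mem ptr len (par (ord j))"
    "ptr (par (ord j)) + len (par (ord j)) < free"
    "len (par (ord j)) + 2 \<le> length Q + 2 * j" by auto
qed

lemma rows_inv_extend:
  assumes T: "tree n ord par dep" and R: "rows_inv ord par dep mem ptr len j free"
    and j: "0 < j" "j < n" and low: "\<And>i. i < free \<Longrightarrow> mem' i = mem i"
    and row: "arcs_of (\<lambda>i. mem' (free + i)) l = Rep_word (transport \<alpha> \<beta> Q (tw par dep (ord j)))"
      "mem' free = \<alpha> (ord j)" "mem' (free + l) = \<beta> (ord j)" "l \<le> length Q + 2 * j"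
  shows "rows_inv ord par dep mem' (ptr(ord j := free)) (len(ord j := l)) (Suc j) (Suc (free + l))"
  unfolding rows_inv_def
proof (intro allI impI)
  fix i assume "i < Suc j"
  then consider "i = j" | "i < j" by linarith
  then show "row par dep mem' (ptr(ord j := free)) (len(ord j := l)) (ord i) \<and>
      (ptr(ord j := free)) (ord i) + (len(ord j := l)) (ord i) < Suc (free + l) \<and>
      (len(ord j := l)) (ord i) \<le> length Q + 2 * i"
  proof cases
    case 1
    then show ?thesis using row by (simp add: row_def)
  next
    case 2
    then have ne: "ord i \<noteq> ord j" using T j by (auto simp: tree_def inj_on_def)
    have r: "row par dep mem ptr len (ord i)" "ptr (ord i) + len (ord i) < free"
      "len (ord i) \<le> length Q + 2 * i"
      using R 2 by (auto simp: rows_inv_def)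
    then have "arcs_of (\<lambda>k. mem' (ptr (ord i) + k)) (len (ord i)) =
      arcs_of (\<lambda>k. mem (ptr (ord i) + k)) (len (ord i))"
      by (intro arcs_of_cong) (simp add: low)
    then show ?thesis using r ne low by (simp add: row_def)
  qed
qed

lemma length_nf: "length (nf xs) \<le> length xs"
proof (induction xs)
  case (Cons e xs)
  have "length (cons_red e ys) \<le> Suc (length ys)" for ys :: "('c \<times> 'c) awalk" and e
    by (auto simp: cons_red_def)
  with Cons show ?case by (metis (no_types, lifting) length_Cons nf_simps(2) not_less_eq_eq order_trans)
qed simp

text \<open>\<open>push\<close> spends ten steps per letter on at most
  \<open>length Q + 2 * n\<close> letters; 30 covers the other commands of an iteration.\<close>

abbreviation "rowcost \<equiv> 10 * (length Q + 2 * n) + 30"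

lemma rows_correct:
  assumes "input s" "\<And>i. i \<le> length Q \<Longrightarrow> arr s MEM i = pawalk_verts (\<alpha> q) Q ! i"
    and T: "tree n (arr s ORD) (arr s PAR) (arr s DEP)"
  shows "wp G H rows s (\<lambda>t s'. t \<le> rowcost * n + 5 \<and>
     frame {7, 8, 9, 10, 11, 12, 13} {MEM, PTR, LEN} s s' \<and>
     (\<forall>v<n. row (arr s PAR) (arr s DEP) (arr s' MEM) (arr s' PTR) (arr s' LEN) v \<and>
        arr s' LEN v \<le> length Q + 2 * n))"
  unfolding rows_def wp_Seq[of _ _ "Store _ _ _"] wp_Seq[of _ _ "Assign _ _"] wp_Assign wp_Store
proof (rule wp_Loop[where I = "\<lambda>s'. frame {7, 8, 9, 10, 11, 12, 13} {MEM, PTR, LEN} s s' \<and>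
      0 < reg s' 7 \<and> reg s' 7 \<le> n \<and>
      rows_inv (arr s ORD) (arr s PAR) (arr s DEP) (arr s' MEM) (arr s' PTR) (arr s' LEN) (reg s' 7) (reg s' 8)"
     and \<phi> = "\<lambda>s'. rowcost * (n - reg s' 7)"], goal_cases)
  case 1
  have Q: "pcas (\<alpha> q) Q (\<beta> q)" "reduced Q"
    using inst by (simp_all add: recoloring_instance_def walk_iff)
  have last: "pcas u p v \<Longrightarrow> pawalk_verts u p ! length p = v" for u v :: nat and p
    by (induction p arbitrary: u) auto
  have hd: "pawalk_verts (\<alpha> q) Q ! 0 = \<alpha> q" using Q(1) by (cases Q) auto
  have "arcs_of (arr s MEM) (length Q) = Q"
    using arcs_of_pawalk_verts[OF Q(1)] arcs_of_cong[of "length Q" "arr s MEM"] assms(2) by simp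
  then have "row (arr s PAR) (arr s DEP) (arr s MEM) ((arr s PTR)(q := 0)) ((arr s LEN)(q := length Q)) q"
    using assms(2)[of 0] assms(2)[of "length Q"] hd last[OF Q(1)] Q(2) tw_q[OF T]
    by (simp add: row_def transport_Nil Rep_cls reduced_nf_id)
  then show ?case
    using assms(1) q T by (simp add: input_def frame_def rows_inv_def tree_def)
next
  case (2 s')
  let ?i = "reg s' 7" and ?F = "reg s' 8"
  define v where "v = arr s ORD ?i"
  define p where "p = arr s PAR v"
  have fr: "frame {7, 8, 9, 10, 11, 12, 13} {MEM, PTR, LEN} s s'" using 2 by simp
  have regs: "reg s' 0 = n" "arr s' ORD = arr s ORD" "arr s' PAR = arr s PAR"
    "\<And>v. v < n \<Longrightarrow> arr s' 0 v = \<alpha> v" "\<And>v. v < n \<Longrightarrow> arr s' 1 v = \<beta> v"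
    using fr assms(1) by (simp_all add: frame_def input_def)
  have i: "0 < ?i" "?i < n" using 2 regs by auto
  have v: "v < n" using T i by (auto simp: tree_def v_def)
  have R: "rows_inv (arr s ORD) (arr s PAR) (arr s DEP) (arr s' MEM) (arr s' PTR) (arr s' LEN) ?i ?F"
    using 2 by simp
  note par = rows_inv_par[OF T R i, folded v_def, folded p_def]
  define s1 where "s1 = s'\<lparr>arr := (arr s')(MEM := (arr s' MEM)(?F := \<alpha> v)),
    reg := (reg s')(9 := v, 10 := p, 11 := 0, 12 := 0)\<rparr>"
  define f where "f j = (if j = 0 then \<alpha> v else if j \<le> Suc (arr s' LEN p)
    then arr s' MEM (arr s' PTR p + (j - 1)) else \<beta> v)" for j
  have "nf (arcs_of f (arr s' LEN p + 2)) =
      Rep_word (transport \<alpha> \<beta> Q (tw (arr s PAR) (arr s DEP) v))"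
    unfolding p_def v_def
    by (rule row_extend[OF T i, of "arr s' MEM" "arr s' PTR" "arr s' LEN"])
      (use par in \<open>simp_all add: f_def p_def v_def\<close>)
  note row = this
  have "wp G H push s1 (\<lambda>t s2. t \<le> 10 * (arr s' LEN p + 2) + 1 \<and>
    frame {11, 12, 13} {MEM} s1 s2 \<and> reg s2 11 \<le> arr s' LEN p + 2 \<and>
    rows_inv (arr s ORD) (arr s PAR) (arr s DEP) (arr s2 MEM) ((arr s' PTR)(v := ?F))
      ((arr s' LEN)(v := reg s2 11)) (Suc ?i) (Suc (?F + reg s2 11)))"
  proof (rule wp_mono[OF push_correct[of s1 f]], goal_cases)
    case (7 t s2)
    then have l: "reg s2 11 \<le> arr s' LEN p + 2"
      using length_nf[of "arcs_of f (arr s' LEN p + 2)"]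
      by (simp add: s1_def) (metis length_arcs_of)
    moreover have "rows_inv (arr s ORD) (arr s PAR) (arr s DEP) (arr s2 MEM) ((arr s' PTR)(v := ?F))
      ((arr s' LEN)(v := reg s2 11)) (Suc ?i) (Suc (?F + reg s2 11))"
      unfolding v_def
      by (rule rows_inv_extend[OF T R i])
        (use 7 l par row in \<open>simp_all add: s1_def f_def v_def[symmetric]\<close>)
    ultimately show ?case using 7 by (simp add: s1_def)
  qed (use par regs v in \<open>auto simp: s1_def f_def\<close>)
  moreover have "rowcost * (n - ?i) = rowcost * (n - Suc ?i) + rowcost"
    using i by (simp add: Suc_diff_Suc[symmetric])
  moreover have "s'\<lparr>arr := (arr s')(MEM := (arr s' MEM)(?F := \<alpha> v)),
    reg := (reg s')(9 := v, 10 := p, 11 := 0, 12 := 0)\<rparr> = s1" by (simp add: s1_def)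
  ultimately show ?case
    using fr i par(3) regs v
    by (simp add: v_def[symmetric] p_def[symmetric] del: mult_Suc_right)
      (erule wp_mono, simp add: frame_def s1_def)
next
  case (3 t s')
  have "reg s' 0 = n" using 3(1) assms(1) by (simp add: frame_def input_def)
  then have "reg s' 7 = n" using 3 by simp
  then have "rows_inv (arr s ORD) (arr s PAR) (arr s DEP) (arr s' MEM) (arr s' PTR) (arr s' LEN) n (reg s' 8)"
    using 3(1) by simp
  then have r: "row (arr s PAR) (arr s DEP) (arr s' MEM) (arr s' PTR) (arr s' LEN) v \<and>
      arr s' LEN v \<le> length Q + 2 * n" if "v < n" for v
    using tree_surj[OF T that] by (fastforce simp: rows_inv_def)
  have "t + rowcost * (n - reg s' 7) \<le> Suc (rowcost * (n - 1))" using 3(3) by simp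
  also have "rowcost * (n - 1) \<le> rowcost * n" by (rule mult_left_mono) simp_all
  finally have "t + 4 \<le> rowcost * n + 5" by linarith
  then show ?case using 3(1) r by simp
qed

end

section \<open>Checking the edges\<close>

definition matched :: "(nat \<Rightarrow> 'a) \<Rightarrow> nat \<Rightarrow> (nat \<Rightarrow> 'a) \<Rightarrow> nat \<Rightarrow> bool" where
  "matched f k g l \<longleftrightarrow> k = l \<and> (\<forall>i\<le>k. f i = g i)"

lemma arcs_of_eq_iff: "f 0 = g 0 \<Longrightarrow> arcs_of f k = arcs_of g l \<longleftrightarrow> matched f k g l"
proof
  assume 0: "f 0 = g 0" and e: "arcs_of f k = arcs_of g l"
  then have "k = l" using length_arcs_of by metis
  moreover have "f i = g i" if "i \<le> k" for i
  proof (cases i)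
    case (Suc j)
    then have "arcs_of f k ! j = (f j, f i)" "arcs_of g l ! j = (g j, g i)"
      using that \<open>k = l\<close> by (simp_all add: arcs_of_def)
    then show ?thesis using e by simp
  qed (simp add: 0)
  ultimately show "matched f k g l" by (simp add: matched_def)
qed (auto simp: matched_def intro: arcs_of_cong)

text \<open>The three outcomes of \<open>nf_snoc\<close>. Where \<open>g\<close> would have to be
  extended, the last vertex of \<open>f\<close> is dropped instead, so that only trimmed lists are
  compared.\<close>

lemma matched_ends:
  assumes "reduced (arcs_of f k)" "reduced (arcs_of g l)" "f 0 = g 0"
  shows "cls (arcs_of f k) = cls (arcs_of g l) + arc (g l) (f k) \<longleftrightarrow>
    (if f k = g l then matched f k g l
     else if 0 < l \<and> g (l - 1) = f k then matched f k g (l - 1)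
     else matched f (k - 1) g l)"
proof -
  have "cls (arcs_of f k) = cls (arcs_of g l) + arc (g l) (f k) \<longleftrightarrow>
    arcs_of f k = nf (arcs_of g l @ [(g l, f k)])"
    using assms(1) by (simp only: cls_append[symmetric] cls_eq_iff reduced_nf_id)
  also have "nf (arcs_of g l @ [(g l, f k)]) =
    (if f k = g l then arcs_of g l
     else if 0 < l \<and> g (l - 1) = f k then arcs_of g (l - 1)
     else arcs_of g l @ [(g l, f k)])"
    using assms(2) by (auto simp: nf_snoc last_arcs_of butlast_arcs_of)
  finally have nf: "cls (arcs_of f k) = cls (arcs_of g l) + arc (g l) (f k) \<longleftrightarrow> arcs_of f k =
    (if f k = g l then arcs_of g l
     else if 0 < l \<and> g (l - 1) = f k then arcs_of g (l - 1)
     else arcs_of g l @ [(g l, f k)])" .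
  \<comment> \<open>For \<open>k = 0\<close> the truncated \<open>k - 1\<close> is harmless: the
    left side is false, and so is the right side, since it would make the last vertices
    equal.\<close>
  have snoc: "arcs_of f k = arcs_of g l @ [(g l, f k)] \<longleftrightarrow> matched f (k - 1) g l" if "f k \<noteq> g l"
  proof -
    have "arcs_of f k = arcs_of g l @ [(g l, f k)] \<longleftrightarrow>
        0 < k \<and> arcs_of f (k - 1) = arcs_of g l \<and> f (k - 1) = g l"
      by (cases k) (simp_all add: arcs_of_snoc)
    also have "\<dots> \<longleftrightarrow> matched f (k - 1) g l"
      using that assms(3) by (cases k; cases l) (auto simp: arcs_of_eq_iff[of f g, OF assms(3)] matched_def)
    finally show ?thesis .
  qed
  note eq = arcs_of_eq_iff[of f g, OF assms(3)]
  consider "f k = g l" | "f k \<noteq> g l" "0 < l \<and> g (l - 1) = f k" | "f k \<noteq> g l" "\<not> (0 < l \<and> g (l - 1) = f k)"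
    by blast
  then show ?thesis
  proof cases
    case 1
    show ?thesis unfolding nf if_P[OF 1] by (rule eq)
  next
    case 2
    show ?thesis unfolding nf if_not_P[OF 2(1)] if_P[OF 2(2)] by (rule eq)
  next
    case 3
    show ?thesis unfolding nf if_not_P[OF 3(1)] if_not_P[OF 3(2)] by (rule snoc[OF 3(1)])
  qed
qed

lemma reduced_arcs_of_Suc:
  "reduced (arcs_of f k) \<Longrightarrow> reduced (arcs_of (\<lambda>i. f (Suc i)) (k - 1))"
  by (cases k) (simp_all add: arcs_of_Suc reduced_Cons)

lemma cls_arcs_of_Suc:
  "0 < k \<Longrightarrow> cls (arcs_of f k) = arc (f 0) (f (Suc 0)) + cls (arcs_of (\<lambda>i. f (Suc i)) (k - 1))"
  using cls_append[of "[(f 0, f (Suc 0))]" "arcs_of (\<lambda>i. f (Suc i)) (k - 1)"]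
  by (cases k) (simp_all add: arcs_of_Suc)

text \<open>The letter between the two starts is trivial or absorbed by dropping the first vertex of
  one list. Otherwise it does not cancel, so the right side, unless it collapses, starts with a
  letter with which the walk of \<open>f\<close> does not start; only trivial walks remain.\<close>

lemma transported_starts:
  assumes "reduced (arcs_of f k)" "reduced (arcs_of g l)"
  defines "T \<equiv> cls (arcs_of f k) = arc (f 0) (g 0) + cls (arcs_of g l) + arc (g l) (f k)"
  shows "f 0 = g 0 \<Longrightarrow> T \<longleftrightarrow> cls (arcs_of f k) = cls (arcs_of g l) + arc (g l) (f k)"
    and "0 < k \<Longrightarrow> f (Suc 0) = g 0 \<Longrightarrow>
      T \<longleftrightarrow> cls (arcs_of (\<lambda>i. f (Suc i)) (k - 1)) = cls (arcs_of g l) + arc (g l) (f k)"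
    and "0 < l \<Longrightarrow> g (Suc 0) = f 0 \<Longrightarrow>
      T \<longleftrightarrow> cls (arcs_of f k) = cls (arcs_of (\<lambda>i. g (Suc i)) (l - 1)) + arc (g l) (f k)"
    and "f 0 \<noteq> g 0 \<Longrightarrow> \<not> (0 < k \<and> f (Suc 0) = g 0) \<Longrightarrow> \<not> (0 < l \<and> g (Suc 0) = f 0) \<Longrightarrow>
      T \<longleftrightarrow> k = 0 \<and> l = 0"
proof -
  show "f 0 = g 0 \<Longrightarrow> T \<longleftrightarrow> cls (arcs_of f k) = cls (arcs_of g l) + arc (g l) (f k)"
    by (simp add: T_def)
  show "T \<longleftrightarrow> cls (arcs_of (\<lambda>i. f (Suc i)) (k - 1)) = cls (arcs_of g l) + arc (g l) (f k)"
    if "0 < k" "f (Suc 0) = g 0"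
    unfolding T_def cls_arcs_of_Suc[OF that(1)] that(2) by (simp add: add.assoc)
  show "T \<longleftrightarrow> cls (arcs_of f k) = cls (arcs_of (\<lambda>i. g (Suc i)) (l - 1)) + arc (g l) (f k)"
    if "0 < l" "g (Suc 0) = f 0"
    unfolding T_def cls_arcs_of_Suc[OF that(1)] that(2) by (simp add: add.assoc)
  assume ne: "f 0 \<noteq> g 0" and k: "\<not> (0 < k \<and> f (Suc 0) = g 0)" and l: "\<not> (0 < l \<and> g (Suc 0) = f 0)"
  show "T \<longleftrightarrow> k = 0 \<and> l = 0"
  proof
    assume "k = 0 \<and> l = 0"
    then show T by (simp add: T_def)
  next
    assume T: T
    let ?R = "(f 0, g 0) # arcs_of g l"
    have red: "reduced ?R" using assms(2) ne l by (auto simp: reduced_Cons hd_arcs_of)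
    have R: "cls ?R = arc (f 0) (g 0) + cls (arcs_of g l)"
      using cls_append[of "[(f 0, g 0)]" "arcs_of g l"] by simp
    have "k = 0"
    proof (rule ccontr)
      assume k0: "k \<noteq> 0"
      have "hd (arcs_of f k) = hd ?R"
        by (rule hd_eq_of_snoc[OF assms(1) red, of "g l" "f k"]) (use T R k0 in \<open>simp_all add: T_def\<close>)
      then show False using k k0 by (simp add: hd_arcs_of)
    qed
    \<comment> \<open>With \<open>k = 0\<close> the right side has to vanish, but one letter cancels
      at most the last of the \<open>l + 1\<close> letters of \<open>?R\<close>.\<close>
    then have "cls ?R + arc (g l) (f 0) = 0" using T R by (simp add: T_def)
    then have nil: "nf (?R @ [(g l, f 0)]) = []" by (simp only: cls_append[symmetric] cls_0_iff)
    have "l = 0" using nil[unfolded nf_snoc[OF red]] by (auto split: if_splits)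
    with \<open>k = 0\<close> show "k = 0 \<and> l = 0" by simp
  qed
qed

text \<open>A trimmed list is only a new pointer and a new length into the same memory, so each item
  takes constant time. Register 15 holds \<open>2 * n\<close>, computed by addition.\<close>

definition make_items :: com where
  "make_items =
    Store PTR (Add (Reg 0) (Reg 14)) (Add (Arr PTR (Reg 14)) (Num 1));;
     Store LEN (Add (Reg 0) (Reg 14)) (Sub (Arr LEN (Reg 14)) (Num 1));;
     Store PTR (Add (Reg 15) (Reg 14)) (Arr PTR (Reg 14));;
     Store LEN (Add (Reg 15) (Reg 14)) (Sub (Arr LEN (Reg 14)) (Num 1));;
     Store PTR (Add (Reg 15) (Add (Reg 0) (Reg 14))) (Add (Arr PTR (Reg 14)) (Num 1));;
     Store LEN (Add (Reg 15) (Add (Reg 0) (Reg 14))) (Sub (Arr LEN (Reg 14)) (Num 2));;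
     14 ::= Add (Reg 14) (Num 1)"

definition items :: com where
  "items =
    15 ::= Add (Reg 0) (Reg 0);; 16 ::= Add (Reg 15) (Reg 15);; 14 ::= Num 0;;
    Loop (Less (Reg 14) (Reg 0))
      make_items;;
    14 ::= Num 0;;
    Loop (Less (Reg 14) (Reg 16)) (Store CLS (Reg 14) (Reg 14);; 14 ::= Add (Reg 14) (Num 1))"

text \<open>Executes the case distinction of \<open>transported_starts\<close>; in its last case the
  edge is decided at once and register 24 becomes 0. \<open>trim\<close> does the same for
  \<open>matched_ends\<close>.\<close>

definition select :: com where
  "select =
    24 ::= Num 1;; 20 ::= Reg 17;; 21 ::= Reg 18;;
    Cond (Equal (Arr 0 (Reg 17)) (Arr 0 (Reg 18))) Skip
      (Cond (Conj (Less (Num 0) (Arr LEN (Reg 17)))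
              (Equal (Arr MEM (Add (Arr PTR (Reg 17)) (Num 1))) (Arr 0 (Reg 18))))
         (20 ::= Add (Reg 0) (Reg 17))
         (Cond (Conj (Less (Num 0) (Arr LEN (Reg 18)))
                 (Equal (Arr MEM (Add (Arr PTR (Reg 18)) (Num 1))) (Arr 0 (Reg 17))))
            (21 ::= Add (Reg 0) (Reg 18))
            (24 ::= Num 0;;
             Cond (Less (Num 0) (Add (Arr LEN (Reg 17)) (Arr LEN (Reg 18)))) (19 ::= Num 1) Skip)))"

definition trim :: com where
  "trim =
    Cond (Equal (Arr 1 (Reg 17)) (Arr 1 (Reg 18))) Skip
      (Cond (Conj (Less (Num 0) (Arr LEN (Reg 21)))
               (Equal (Arr MEM (Add (Arr PTR (Reg 21)) (Sub (Arr LEN (Reg 21)) (Num 1)))) (Arr 1 (Reg 17))))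
         (21 ::= Add (Reg 15) (Reg 21))
         (20 ::= Add (Reg 15) (Reg 20)))"

text \<open>The classes are kept by plain labels. A scan of all labels per merge is affordable,
  because there are fewer than \<open>4 * n\<close> merges.\<close>

definition relabel :: com where
  "relabel =
    25 ::= Arr CLS (Reg 20);; 26 ::= Arr CLS (Reg 21);; 22 ::= Num 0;;
    Loop (Less (Reg 22) (Reg 16))
      (Cond (Equal (Arr CLS (Reg 22)) (Reg 25)) (Store CLS (Reg 22) (Reg 26)) Skip;;
       22 ::= Add (Reg 22) (Num 1))"

definition compare :: com where
  "compare =
    Cond (Equal (Arr LEN (Reg 20)) (Arr LEN (Reg 21)))
      (22 ::= Num 0;;
       Loop (Conj (Less (Reg 22) (Add (Arr LEN (Reg 20)) (Num 1)))
               (Equal (Arr MEM (Add (Arr PTR (Reg 20)) (Reg 22))) (Arr MEM (Add (Arr PTR (Reg 21)) (Reg 22)))))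
         (22 ::= Add (Reg 22) (Num 1));;
       Cond (Less (Reg 22) (Add (Arr LEN (Reg 20)) (Num 1))) (19 ::= Num 1) relabel)
      (19 ::= Num 1)"

definition check :: com where
  "check = select;; Cond (Equal (Reg 24) (Num 1))
     (trim;; Cond (Equal (Arr CLS (Reg 20)) (Arr CLS (Reg 21))) Skip compare) Skip"

text \<open>After a failure register 18 is not advanced, so registers 17 and 18 still hold the
  violated edge when the certificate is written.\<close>

definition edges :: com where
  "edges =
    17 ::= Num 0;; 18 ::= Num 0;; 19 ::= Num 0;;
    Loop (Conj (Equal (Reg 19) (Num 0)) (Less (Reg 17) (Reg 0)))
      (Cond (Less (Reg 18) (Reg 0))
        (Cond (EdgeG (Reg 17) (Reg 18)) check Skip;;
         Cond (Equal (Reg 19) (Num 0)) (18 ::= Add (Reg 18) (Num 1)) Skip)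
        (17 ::= Add (Reg 17) (Num 1);; 18 ::= Num 0))"

definition same :: "(nat \<Rightarrow> nat) \<Rightarrow> (nat \<Rightarrow> nat) \<Rightarrow> (nat \<Rightarrow> nat) \<Rightarrow> nat \<Rightarrow> nat \<Rightarrow> bool" where
  "same mem ptr len x y \<longleftrightarrow>
     matched (\<lambda>i. mem (ptr x + i)) (len x) (\<lambda>i. mem (ptr y + i)) (len y)"

lemma relabel_correct:
  "wp G H relabel s (\<lambda>t s'. t \<le> 4 * reg s 16 + 4 \<and> frame {22, 25, 26} {CLS} s s' \<and>
     arr s' CLS = (\<lambda>j. if j < reg s 16 \<and> arr s CLS j = arr s CLS (reg s 20)
       then arr s CLS (reg s 21) else arr s CLS j))"
  unfolding relabel_def wp_Seq[of _ _ "Assign _ _"] wp_Assign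
proof (rule wp_Loop[where I = "\<lambda>s'. frame {22, 25, 26} {CLS} s s' \<and> reg s' 22 \<le> reg s 16 \<and>
       reg s' 25 = arr s CLS (reg s 20) \<and> reg s' 26 = arr s CLS (reg s 21) \<and>
       arr s' CLS = (\<lambda>j. if j < reg s' 22 \<and> arr s CLS j = arr s CLS (reg s 20)
         then arr s CLS (reg s 21) else arr s CLS j)"
     and \<phi> = "\<lambda>s'. 4 * (reg s 16 - reg s' 22)"], goal_cases)
  case 1
  then show ?case by (simp add: frame_def)
next
  case (2 s')
  then have lt: "reg s' 22 < reg s 16" by (simp add: frame_def)
  then have "4 * (reg s 16 - reg s' 22) = 4 * (reg s 16 - Suc (reg s' 22)) + 4" by simp
  with 2 lt show ?case by (auto simp: frame_def fun_eq_iff less_Suc_eq)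
next
  case (3 t s')
  then have "reg s' 22 = reg s 16" by (auto simp: frame_def)
  with 3 show ?case by simp
qed

lemma compare_correct:
  assumes "reg s 19 = 0"
  shows "wp G H compare s (\<lambda>t s'. t \<le> 2 * arr s LEN (reg s 20) + 4 * reg s 16 + 15 \<and>
     frame {19, 22, 25, 26} {CLS} s s' \<and>
     (if same (arr s MEM) (arr s PTR) (arr s LEN) (reg s 20) (reg s 21)
      then reg s' 19 = 0 \<and> arr s' CLS = (\<lambda>j. if j < reg s 16 \<and> arr s CLS j = arr s CLS (reg s 20)
       then arr s CLS (reg s 21) else arr s CLS j)
      else reg s' 19 = 1 \<and> arr s' CLS = arr s CLS))"
proof (cases "arr s LEN (reg s 20) = arr s LEN (reg s 21)")
  case False
  then show ?thesis by (simp add: compare_def same_def matched_def frame_def)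
next
  case True
  let ?k = "arr s LEN (reg s 20)"
  let ?f = "\<lambda>i. arr s MEM (arr s PTR (reg s 20) + i)" and ?g = "\<lambda>i. arr s MEM (arr s PTR (reg s 21) + i)"
  have *: "wp G H (Loop (Conj (Less (Reg 22) (Add (Arr LEN (Reg 20)) (Num 1)))
               (Equal (Arr MEM (Add (Arr PTR (Reg 20)) (Reg 22))) (Arr MEM (Add (Arr PTR (Reg 21)) (Reg 22)))))
         (22 ::= Add (Reg 22) (Num 1))) (s\<lparr>reg := (reg s)(22 := 0)\<rparr>)
     (\<lambda>t s'. t \<le> 2 * (?k + 1) + 1 \<and> frame {22} {} s s' \<and> (\<forall>i<reg s' 22. ?f i = ?g i) \<and>
        (reg s' 22 \<le> ?k \<longrightarrow> ?f (reg s' 22) \<noteq> ?g (reg s' 22)))"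
  proof (rule wp_Loop[where I = "\<lambda>s'. frame {22} {} s s' \<and> (\<forall>i<reg s' 22. ?f i = ?g i)"
       and \<phi> = "\<lambda>s'. 2 * (?k + 1 - reg s' 22)"], goal_cases)
    case (2 s')
    then have "reg s' 22 < ?k + 1" by (simp add: frame_def)
    then have "2 * (?k + 1 - reg s' 22) = 2 * (?k + 1 - Suc (reg s' 22)) + 2" by simp
    with 2 show ?case by (auto simp: frame_def less_Suc_eq)
  qed (auto simp: frame_def)
  show ?thesis
    using True assms unfolding compare_def
    apply simp
    apply (rule wp_mono[OF *[simplified]])
    subgoal for t s'
      using relabel_correct[of G H s']
      apply (cases "reg s' 22 \<le> ?k")
       apply (auto simp: same_def matched_def frame_def)[1]
      apply (auto simp: same_def matched_def frame_def elim!: wp_mono)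
      done
    done
qed


section \<open>Correctness of the edge test\<close>

context instance_nat
begin

definition "rows_ok mem ptr len \<longleftrightarrow>
  (\<forall>v<n. reduced (arcs_of (\<lambda>i. mem (ptr v + i)) (len v)) \<and>
     mem (ptr v) = \<alpha> v \<and> mem (ptr v + len v) = \<beta> v)"

text \<open>The items \<open>v\<close>, \<open>n + v\<close>, \<open>2 * n + v\<close> and \<open>3 * n + v\<close> are the vertex list of \<open>v\<close> without its
  first or last vertex. Truncated subtraction only matters for lists which are too short to be
  trimmed; \<open>matched_ends\<close> allows for it.\<close>

definition "items_ok ptr len \<longleftrightarrow>
  (\<forall>v<n. ptr (n + v) = Suc (ptr v) \<and> len (n + v) = len v - 1) \<and>
  (\<forall>x<2 * n. ptr (2 * n + x) = ptr x \<and> len (2 * n + x) = len x - (1 :: nat))"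

definition "edge_ok mem ptr len u v \<longleftrightarrow>
  cls (arcs_of (\<lambda>i. mem (ptr u + i)) (len u)) =
    arc (\<alpha> u) (\<alpha> v) + cls (arcs_of (\<lambda>i. mem (ptr v + i)) (len v)) + arc (\<beta> v) (\<beta> u)"

text \<open>The interface between \<open>select\<close> and \<open>trim\<close>: the choice of items
  has absorbed the letter between the first vertices, and only the letter between the last vertices
  is left.\<close>

definition "pair_ok mem ptr len u v x y \<longleftrightarrow>
  reduced (arcs_of (\<lambda>i. mem (ptr x + i)) (len x)) \<and> reduced (arcs_of (\<lambda>i. mem (ptr y + i)) (len y)) \<and>
  mem (ptr x) = mem (ptr y) \<and> mem (ptr x + len x) = \<beta> u \<and> mem (ptr y + len y) = \<beta> v \<and>
  (edge_ok mem ptr len u v \<longleftrightarrow>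
    cls (arcs_of (\<lambda>i. mem (ptr x + i)) (len x)) =
      cls (arcs_of (\<lambda>i. mem (ptr y + i)) (len y)) + arc (\<beta> v) (\<beta> u))"

definition "edges_pre s \<longleftrightarrow> input s \<and> reg s 15 = 2 * n \<and> reg s 16 = 4 * n \<and>
  rows_ok (arr s MEM) (arr s PTR) (arr s LEN) \<and> items_ok (arr s PTR) (arr s LEN) \<and>
  (\<forall>x<4 * n. arr s LEN x \<le> length Q + 2 * n)"

lemma edges_pre_frame:
  assumes "edges_pre s" "frame R A s s'" "{0, 2, 3, 15, 16} \<inter> R = {}" "{0, 1, MEM, PTR, LEN} \<inter> A = {}"
  shows "edges_pre s'"
proof -
  have "reg s' x = reg s x" if "x \<in> {0, 2, 3, 15, 16}" for x
    using assms(2,3) that unfolding frame_def by blast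
  moreover have "arr s' x = arr s x" if "x \<in> {0, 1, MEM, PTR, LEN}" for x
    using assms(2,4) that unfolding frame_def by blast
  ultimately show ?thesis using assms(1) by (simp add: edges_pre_def input_def)
qed

lemma select_correct:
  assumes pre: "edges_pre s" and u: "reg s 17 = u" "u < n" and v: "reg s 18 = v" "v < n"
    and "reg s 19 = 0"
  defines "mem \<equiv> arr s MEM" and "ptr \<equiv> arr s PTR" and "len \<equiv> arr s LEN"
  shows "wp G H select s (\<lambda>t s'. t \<le> 10 \<and> frame {19, 20, 21, 24} {} s s' \<and>
     (reg s' 24 = 0 \<and> reg s' 19 = (if edge_ok mem ptr len u v then 0 else 1) \<or>
      reg s' 24 = 1 \<and> reg s' 19 = 0 \<and> reg s' 20 < 2 * n \<and> reg s' 21 < 2 * n \<and>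
        pair_ok mem ptr len u v (reg s' 20) (reg s' 21)))"
proof -
  let ?f = "\<lambda>i. mem (ptr u + i)" and ?g = "\<lambda>i. mem (ptr v + i)"
  have r: "reduced (arcs_of ?f (len u))" "reduced (arcs_of ?g (len v))"
    and ends: "?f 0 = \<alpha> u" "?g 0 = \<alpha> v" "?f (len u) = \<beta> u" "?g (len v) = \<beta> v"
    using pre u v by (auto simp: edges_pre_def rows_ok_def mem_def ptr_def len_def)
  have it: "ptr (n + u) = Suc (ptr u)" "len (n + u) = len u - 1"
    "ptr (n + v) = Suc (ptr v)" "len (n + v) = len v - 1"
    using pre u v by (auto simp: edges_pre_def items_ok_def ptr_def len_def)
  have inp: "reg s 0 = n" "arr s 0 u = \<alpha> u" "arr s 0 v = \<alpha> v"
    using pre u v by (auto simp: edges_pre_def input_def)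
  note starts = transported_starts[OF r, unfolded ends]
  note rs = reduced_arcs_of_Suc[OF r(1)] reduced_arcs_of_Suc[OF r(2)]
  have 1: "pair_ok mem ptr len u v u v" if "\<alpha> u = \<alpha> v"
    using that r ends starts(1) by (simp add: pair_ok_def edge_ok_def)
  have 2: "pair_ok mem ptr len u v (n + u) v" if "0 < len u" "mem (Suc (ptr u)) = \<alpha> v"
    using that r ends starts(2) rs by (simp add: pair_ok_def edge_ok_def it)
  have 3: "pair_ok mem ptr len u v u (n + v)" if "0 < len v" "mem (Suc (ptr v)) = \<alpha> u"
    using that r ends starts(3) rs by (simp add: pair_ok_def edge_ok_def it)
  have 4: "edge_ok mem ptr len u v \<longleftrightarrow> len u = 0 \<and> len v = 0"
    if "\<alpha> u \<noteq> \<alpha> v" "\<not> (0 < len u \<and> mem (Suc (ptr u)) = \<alpha> v)" "\<not> (0 < len v \<and> mem (Suc (ptr v)) = \<alpha> u)"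
    using starts(4) that by (simp add: edge_ok_def)
  show ?thesis
    using 1 2 3 4 u v inp assms(6)
    by (simp add: select_def frame_def mem_def[symmetric] ptr_def[symmetric] len_def[symmetric])
qed

lemma trim_correct:
  assumes pre: "edges_pre s" and u: "reg s 17 = u" "u < n" and v: "reg s 18 = v" "v < n"
    and x: "reg s 20 < 2 * n" and y: "reg s 21 < 2 * n"
    and p: "pair_ok (arr s MEM) (arr s PTR) (arr s LEN) u v (reg s 20) (reg s 21)"
  shows "wp G H trim s (\<lambda>t s'. t \<le> 5 \<and> frame {20, 21} {} s s' \<and> reg s' 20 < 4 * n \<and> reg s' 21 < 4 * n \<and>
     (edge_ok (arr s MEM) (arr s PTR) (arr s LEN) u v \<longleftrightarrow>
      same (arr s MEM) (arr s PTR) (arr s LEN) (reg s' 20) (reg s' 21)))"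
proof -
  have it: "arr s PTR (2 * n + reg s 20) = arr s PTR (reg s 20)" "arr s LEN (2 * n + reg s 20) = arr s LEN (reg s 20) - 1"
    "arr s PTR (2 * n + reg s 21) = arr s PTR (reg s 21)" "arr s LEN (2 * n + reg s 21) = arr s LEN (reg s 21) - 1"
    using pre x y by (auto simp: edges_pre_def items_ok_def)
  have inp: "reg s 15 = 2 * n" "arr s 1 u = \<beta> u" "arr s 1 v = \<beta> v"
    using pre u v by (auto simp: edges_pre_def input_def)
  have *: "edge_ok (arr s MEM) (arr s PTR) (arr s LEN) u v \<longleftrightarrow>
    (let f = \<lambda>i. arr s MEM (arr s PTR (reg s 20) + i); k = arr s LEN (reg s 20);
         g = \<lambda>i. arr s MEM (arr s PTR (reg s 21) + i); l = arr s LEN (reg s 21) in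
     (if f k = g l then matched f k g l
     else if 0 < l \<and> g (l - 1) = f k then matched f k g (l - 1)
     else matched f (k - 1) g l))"
    using p matched_ends[of "\<lambda>i. arr s MEM (arr s PTR (reg s 20) + i)" "arr s LEN (reg s 20)"
        "\<lambda>i. arr s MEM (arr s PTR (reg s 21) + i)" "arr s LEN (reg s 21)"]
    by (simp add: pair_ok_def Let_def)
  have e: "arr s MEM (arr s PTR (reg s 20) + arr s LEN (reg s 20)) = \<beta> u"
    "arr s MEM (arr s PTR (reg s 21) + arr s LEN (reg s 21)) = \<beta> v"
    using p by (auto simp: pair_ok_def)
  have d: "0 < arr s LEN (reg s 21) \<Longrightarrow> arr s PTR (reg s 21) + (arr s LEN (reg s 21) - Suc 0) =
      arr s PTR (reg s 21) + arr s LEN (reg s 21) - Suc 0" by simp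
  show ?thesis
    using x y inp u v d by (auto simp: trim_def frame_def * e Let_def same_def it)
qed

text \<open>An edge amounts to an equality between two items, which is transitive: every comparison of two
  items which finds them equal merges two classes, and one which does not ends the search.\<close>

definition "classes_ok mem ptr len c \<longleftrightarrow>
  (\<forall>x<4 * n. \<forall>y<4 * n. c x = (c y :: nat) \<longrightarrow> same mem ptr len x y)"

text \<open>The label of \<open>x\<close> disappears and no new one is created, so the number of
  labels can pay for the merges.\<close>

lemma classes_ok_merge:
  assumes "classes_ok mem ptr len c" "same mem ptr len x y" "x < 4 * n" "y < 4 * n" "c x \<noteq> c y"
  defines "c' \<equiv> \<lambda>j. if j < 4 * n \<and> c j = c x then c y else c j"
  shows "classes_ok mem ptr len c'" "card (c' ` {..<4 * n}) < card (c ` {..<4 * n})"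
proof -
  have sym: "same mem ptr len a b \<Longrightarrow> same mem ptr len b a"
    and trans: "same mem ptr len a b \<Longrightarrow> same mem ptr len b d \<Longrightarrow> same mem ptr len a d" for a b d
    by (auto simp: same_def matched_def)
  have c: "same mem ptr len a b" if "a < 4 * n" "b < 4 * n" "c a = c b" for a b
    using assms(1) that by (auto simp: classes_ok_def)
  show "classes_ok mem ptr len c'"
    unfolding classes_ok_def
  proof (intro allI impI)
    fix a b assume a: "a < 4 * n" and b: "b < 4 * n" and eq: "c' a = c' b"
    consider "c a = c b" | "c a = c x" "c b = c y" | "c a = c y" "c b = c x"
      using a b eq by (auto simp: c'_def split: if_splits)
    then show "same mem ptr len a b"
    proof cases
      case 1
      then show ?thesis using c a b by blast
    next
      case 2
      then show ?thesis using c[OF a assms(3)] c[OF b assms(4)] assms(2) sym trans by blast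
    next
      case 3
      then show ?thesis using c[OF a assms(4)] c[OF b assms(3)] assms(2) sym trans by blast
    qed
  qed
  have "c' ` {..<4 * n} \<subseteq> c ` {..<4 * n} - {c x}"
    using assms(4,5) by (auto simp: c'_def)
  then have "card (c' ` {..<4 * n}) \<le> card (c ` {..<4 * n} - {c x})"
    by (intro card_mono) auto
  also have "\<dots> < card (c ` {..<4 * n})"
    using assms(3) by (intro card_Diff1_less) auto
  finally show "card (c' ` {..<4 * n}) < card (c ` {..<4 * n})" .
qed

text \<open>Two steps per letter for comparing items of length at most
  \<open>length Q + 2 * n\<close>, and four steps for each of the \<open>4 * n\<close>
  labels.\<close>

abbreviation "mergecost \<equiv> 2 * (length Q + 2 * n) + 16 * n + 20"

text \<open>Amortized: beyond a constant, time is spent only in \<open>compare\<close>. A success is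
  paid by the label that disappears, a failure by the flag, which is raised only once.\<close>

lemma check_correct:
  assumes pre: "edges_pre s" and u: "reg s 17 = u" "u < n" and v: "reg s 18 = v" "v < n"
    and "reg s 19 = 0" and cl: "classes_ok (arr s MEM) (arr s PTR) (arr s LEN) (arr s CLS)"
  shows "wp G H check s (\<lambda>t s'. frame {19, 20, 21, 22, 24, 25, 26} {CLS} s s' \<and>
     reg s' 19 = (if edge_ok (arr s MEM) (arr s PTR) (arr s LEN) u v then 0 else 1) \<and>
     classes_ok (arr s MEM) (arr s PTR) (arr s LEN) (arr s' CLS) \<and>
     t + mergecost * card (arr s' CLS ` {..<4 * n}) \<le>
       20 + mergecost * card (arr s CLS ` {..<4 * n}) + mergecost * reg s' 19)"
  (is "wp G H check s ?P")
proof -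
  show ?thesis
    unfolding check_def wp_Seq[of _ _ select]
  proof (rule wp_mono[OF select_correct[OF pre u v assms(6)]], goal_cases)
    case (1 t1 s1)
    then have f1: "frame {19, 20, 21, 24} {} s s1" by simp
    then have arr1: "arr s1 = arr s" by (auto simp: frame_def)
    show ?case
    proof (cases "reg s1 24 = 1")
      case False
      then show ?thesis using 1 cl by (auto simp: frame_def)
    next
      case True
      have pre1: "edges_pre s1" by (rule edges_pre_frame[OF pre f1]) auto
      have uv1: "reg s1 17 = u" "reg s1 18 = v" using f1 u v by (auto simp: frame_def)
      have p1: "reg s1 20 < 2 * n" "reg s1 21 < 2 * n"
        "pair_ok (arr s1 MEM) (arr s1 PTR) (arr s1 LEN) u v (reg s1 20) (reg s1 21)"
        using 1 True by (auto simp: arr1)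
      have "wp G H trim s1 (\<lambda>t2 s2. wp G H
          (Cond (Equal (Arr CLS (Reg 20)) (Arr CLS (Reg 21))) Skip compare) s2
          (\<lambda>t3. ?P (t1 + Suc (t2 + t3))))"
      proof (rule wp_mono[OF trim_correct[OF pre1 uv1(1) u(2) uv1(2) v(2) p1]], goal_cases)
        case (1 t2 s2)
        then have f2: "frame {20, 21} {} s1 s2" and x: "reg s2 20 < 4 * n" and y: "reg s2 21 < 4 * n"
          and iff: "edge_ok (arr s MEM) (arr s PTR) (arr s LEN) u v \<longleftrightarrow>
            same (arr s MEM) (arr s PTR) (arr s LEN) (reg s2 20) (reg s2 21)"
          and t2: "t2 \<le> 5"
          by (auto simp: arr1)
        have arr2: "arr s2 = arr s" using f2 arr1 by (auto simp: frame_def)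
        have f: "frame {19, 20, 21, 22, 24, 25, 26} {CLS} s s2"
          by (rule frame_trans[OF f1 f2]) auto
        have t1: "t1 \<le> 10" and b1: "reg s1 19 = 0" using \<open>t1 \<le> 10 \<and> _\<close> True by auto
        have b2: "reg s2 19 = 0" using b1 f2 by (simp add: frame_def)
        show ?case
        proof (cases "arr s CLS (reg s2 20) = arr s CLS (reg s2 21)")
          case True
          then have "edge_ok (arr s MEM) (arr s PTR) (arr s LEN) u v"
            using cl x y iff by (simp add: classes_ok_def)
          then show ?thesis using True f t1 t2 b2 cl by (simp add: arr2)
        next
          case False
          have pre2: "edges_pre s2" by (rule edges_pre_frame[OF pre1 f2]) auto
          have r16: "reg s2 16 = 4 * n" and lx: "arr s LEN (reg s2 20) \<le> length Q + 2 * n"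
            using pre2 x by (auto simp: edges_pre_def arr2)
          have "wp G H compare s2 (\<lambda>t3. ?P (t1 + Suc (t2 + Suc t3)))"
          proof (rule wp_mono[OF compare_correct[OF b2]], goal_cases)
            case (1 t3 s3)
            then have f3: "frame {19, 22, 25, 26} {CLS} s2 s3" by simp
            have f': "frame {19, 20, 21, 22, 24, 25, 26} {CLS} s s3"
              by (rule frame_trans[OF f f3]) auto
            have t3: "t3 \<le> 2 * (length Q + 2 * n) + 16 * n + 15" using 1 lx r16 by (simp add: arr2)
            show ?case
            proof (cases "same (arr s MEM) (arr s PTR) (arr s LEN) (reg s2 20) (reg s2 21)")
              case True
              then have c: "arr s3 CLS = (\<lambda>j. if j < 4 * n \<and> arr s CLS j = arr s CLS (reg s2 20)
                 then arr s CLS (reg s2 21) else arr s CLS j)" and b3: "reg s3 19 = 0"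
                using 1 r16 by (simp_all add: arr2 cong: if_cong)
              note m = classes_ok_merge[OF cl True x y False, folded c]
              have "mergecost * Suc (card (arr s3 CLS ` {..<4 * n})) \<le> mergecost * card (arr s CLS ` {..<4 * n})"
                using m(2) by (intro mult_left_mono) simp_all
              then show ?thesis using f' b3 True iff m(1) t1 t2 t3 by simp
            next
              case False
              then have "arr s3 CLS = arr s CLS" "reg s3 19 = 1"
                using 1 by (simp_all add: arr2)
              then show ?thesis using f' False iff cl t1 t2 t3 by simp
            qed
          qed
          then show ?thesis using False by (simp add: arr2)
        qed
      qed
      then show ?thesis
        unfolding wp_Cond wp_Seq bval.simps aval.simps using True by (simp only: if_True simp_thms)
    qed
  qed
qed


lemma items_correct:
  assumes "input s"
  shows "wp G H items s (\<lambda>t s'. t \<le> 20 * n + 8 \<and> frame {14, 15, 16} {PTR, LEN, CLS} s s' \<and>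
     reg s' 15 = 2 * n \<and> reg s' 16 = 4 * n \<and> items_ok (arr s' PTR) (arr s' LEN) \<and>
     (\<forall>v<n. arr s' PTR v = arr s PTR v \<and> arr s' LEN v = arr s LEN v) \<and> (\<forall>j<4 * n. arr s' CLS j = j))"
proof -
  let ?I1 = "\<lambda>s'. frame {14, 15, 16} {PTR, LEN, CLS} s s' \<and> reg s' 15 = 2 * n \<and> reg s' 16 = 4 * n \<and>
     reg s' 14 \<le> n \<and> (\<forall>v<n. arr s' PTR v = arr s PTR v \<and> arr s' LEN v = arr s LEN v) \<and>
     (\<forall>v<reg s' 14. arr s' PTR (n + v) = Suc (arr s PTR v) \<and> arr s' LEN (n + v) = arr s LEN v - 1 \<and>
        arr s' PTR (2 * n + v) = arr s PTR v \<and> arr s' LEN (2 * n + v) = arr s LEN v - 1 \<and>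
        arr s' PTR (2 * n + (n + v)) = Suc (arr s PTR v) \<and> arr s' LEN (2 * n + (n + v)) = arr s LEN v - 2)"
  let ?I2 = "\<lambda>s'. ?I1 s' \<and> reg s' 14 = n"
  have *: "wp G H (Loop (Less (Reg 14) (Reg 0))
      make_items) s1 (\<lambda>t s'. t \<le> 8 * n + 1 \<and> ?I2 s')"
    if s1: "?I1 s1" "reg s1 14 = 0" for s1
  proof (rule wp_Loop[where I = ?I1 and \<phi> = "\<lambda>s'. 8 * (n - reg s' 14)"], goal_cases)
    case 1
    then show ?case by (rule s1)
  next
    case (2 s')
    have r: "reg s' 0 = n" using 2 assms by (simp add: frame_def input_def)
    have lt: "reg s' 14 < n" using 2 r by simp
    then have pot: "8 * (n - reg s' 14) = 8 * (n - Suc (reg s' 14)) + 8" by simp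
    have ne: "v \<noteq> n + reg s' 14" "v \<noteq> 2 * n + reg s' 14" "v \<noteq> 2 * n + (n + reg s' 14)"
      "n + v \<noteq> 2 * n + reg s' 14" "n + v \<noteq> 2 * n + (n + reg s' 14)"
      "2 * n + v \<noteq> n + reg s' 14" "2 * n + v \<noteq> 2 * n + (n + reg s' 14)"
      "2 * n + (n + v) \<noteq> n + reg s' 14" "2 * n + (n + v) \<noteq> 2 * n + reg s' 14" if "v < n" for v
      using that lt by auto
    have I: "?I1 s'" using 2 by blast
    then have f: "frame {14, 15, 16} {PTR, LEN, CLS} s s'" and r2: "reg s' 15 = 2 * n" "reg s' 16 = 4 * n"
      and low: "\<And>v. v < n \<Longrightarrow> arr s' PTR v = arr s PTR v \<and> arr s' LEN v = arr s LEN v" by auto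
    define s2 where "s2 = s'\<lparr>arr := (arr s')
       (PTR := (arr s' PTR)(n + reg s' 14 := Suc (arr s' PTR (reg s' 14)),
          2 * n + reg s' 14 := arr s' PTR (reg s' 14),
          2 * n + (n + reg s' 14) := Suc (arr s' PTR (reg s' 14))),
        LEN := (arr s' LEN)(n + reg s' 14 := arr s' LEN (reg s' 14) - 1,
          2 * n + reg s' 14 := arr s' LEN (reg s' 14) - 1,
          2 * n + (n + reg s' 14) := arr s' LEN (reg s' 14) - 2)),
       reg := (reg s')(14 := Suc (reg s' 14))\<rparr>"
    have "frame {14, 15, 16} {PTR, LEN, CLS} s s2" using f by (simp add: frame_def s2_def)
    moreover have "\<forall>v<n. arr s2 PTR v = arr s PTR v \<and> arr s2 LEN v = arr s LEN v"
      using low ne(1-3) by (simp add: s2_def)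
    moreover have "arr s2 PTR (n + v) = Suc (arr s PTR v) \<and> arr s2 LEN (n + v) = arr s LEN v - 1 \<and>
        arr s2 PTR (2 * n + v) = arr s PTR v \<and> arr s2 LEN (2 * n + v) = arr s LEN v - 1 \<and>
        arr s2 PTR (2 * n + (n + v)) = Suc (arr s PTR v) \<and> arr s2 LEN (2 * n + (n + v)) = arr s LEN v - 2"
      if "v < reg s2 14" for v
    proof (cases "v = reg s' 14")
      case True
      then show ?thesis using low[OF lt] ne[OF lt] by (simp add: s2_def)
    next
      case False
      then have v: "v < reg s' 14" "v < n" using that lt by (auto simp: s2_def)
      then show ?thesis using I ne[OF v(2)] False by (simp add: s2_def)
    qed
    ultimately have "?I1 s2" using lt r2 by (simp add: s2_def)
    moreover have "wp G H make_items s' (\<lambda>t s'. t = 7 \<and> s' = s2)"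
      using r r2 ne[OF lt] lt by (simp add: make_items_def s2_def fun_upd_twist)
    moreover have "reg s2 14 = Suc (reg s' 14)" by (simp add: s2_def)
    ultimately show ?case
      using pot by (elim wp_mono) (simp only:, simp)
  next
    case (3 t s')
    have r: "reg s' 0 = n" using 3 assms by (simp add: frame_def input_def)
    with 3 s1 show ?case by simp
  qed
  have **: "wp G H (Loop (Less (Reg 14) (Reg 16)) (Store CLS (Reg 14) (Reg 14);; 14 ::= Add (Reg 14) (Num 1)))
      s1 (\<lambda>t s'. t \<le> 12 * n + 1 \<and> frame {14} {CLS} s1 s' \<and> (\<forall>j<4 * n. arr s' CLS j = j))"
    if s1: "reg s1 14 = 0" "reg s1 16 = 4 * n" for s1
  proof (rule wp_Loop[where I = "\<lambda>s'. frame {14} {CLS} s1 s' \<and> reg s' 14 \<le> 4 * n \<and>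
      (\<forall>j<reg s' 14. arr s' CLS j = j)" and \<phi> = "\<lambda>s'. 3 * (4 * n - reg s' 14)"], goal_cases)
    case 1
    then show ?case using s1 by simp
  next
    case (2 s')
    then have lt: "reg s' 14 < 4 * n" using s1 by (simp add: frame_def)
    then have "3 * (4 * n - reg s' 14) = 3 * (4 * n - Suc (reg s' 14)) + 3" by simp
    with 2 lt show ?case by (auto simp: frame_def less_Suc_eq)
  next
    case (3 t s')
    then show ?case using s1 by (simp add: frame_def)
  qed
  have ok: "items_ok (arr s' PTR) (arr s' LEN)" if "?I2 s'" for s'
  proof -
    have "arr s' PTR (2 * n + x) = arr s' PTR x \<and> arr s' LEN (2 * n + x) = arr s' LEN x - 1"
      if x: "x < 2 * n" for x
    proof (cases "x < n")
      case False
      then obtain y where "x = n + y" "y < n" using x by (metis add_diff_inverse_nat less_diff_conv2 mult_2 not_less)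
      then show ?thesis using \<open>?I2 s'\<close> by simp
    qed (use \<open>?I2 s'\<close> in simp)
    then show ?thesis using \<open>?I2 s'\<close> by (simp add: items_ok_def)
  qed
  show ?thesis
    unfolding items_def wp_Seq[of _ _ "Assign _ _"] wp_Assign wp_Seq[of _ _ "Loop _ _"]
  proof (rule wp_mono[OF *], goal_cases)
    case (3 t1 s1)
    have "wp G H (Loop (Less (Reg 14) (Reg 16)) (Store CLS (Reg 14) (Reg 14);; 14 ::= Add (Reg 14) (Num 1)))
      (s1\<lparr>reg := (reg s1)(14 := 0)\<rparr>)
      (\<lambda>t s'. t \<le> 12 * n + 1 \<and> frame {14} {CLS} (s1\<lparr>reg := (reg s1)(14 := 0)\<rparr>) s' \<and> (\<forall>j<4 * n. arr s' CLS j = j))"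
      by (rule **) (use 3 in simp_all)
    then show ?case
      unfolding aval.simps
    proof (rule wp_mono, goal_cases)
      case (1 t2 s2)
      then show ?case using 3 ok[of s1] by (auto simp: frame_def)
    qed
  qed (use assms in \<open>auto simp: input_def frame_def\<close>)
qed

text \<open>At most 30 steps for each visited pair of vertices, one merge for each of at most
  \<open>4 * n\<close> labels, and one failing comparison.\<close>

abbreviation "edgecost \<equiv> pot 30 n n 0 0 + mergecost * (4 * n + 1) + 50"

lemma edges_correct:
  assumes pre: "edges_pre s" and cl: "classes_ok (arr s MEM) (arr s PTR) (arr s LEN) (arr s CLS)"
  defines "ok \<equiv> edge_ok (arr s MEM) (arr s PTR) (arr s LEN)"
  shows "wp G H edges s (\<lambda>t s'. t \<le> edgecost \<and> frame {17, 18, 19, 20, 21, 22, 24, 25, 26} {CLS} s s' \<and>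
     (reg s' 19 = 0 \<and> (\<forall>(u, v)\<in>parcs G. ok u v) \<or>
      reg s' 19 = 1 \<and> (reg s' 17, reg s' 18) \<in> parcs G \<and> \<not> ok (reg s' 17) (reg s' 18)))"
  unfolding edges_def wp_Seq[of _ _ "Assign _ _"] wp_Assign
\<comment> \<open>The last summand of the potential is released when the flag is raised: it pays for
  the failing comparison, in whose iteration the pair of vertices does not advance.\<close>
proof (rule wp_Loop[where I = "\<lambda>s'. frame {17, 18, 19, 20, 21, 22, 24, 25, 26} {CLS} s s' \<and>
      classes_ok (arr s MEM) (arr s PTR) (arr s LEN) (arr s' CLS) \<and> reg s' 17 \<le> n \<and>
      (\<forall>u<reg s' 17. \<forall>v. (u, v) \<in> parcs G \<longrightarrow> ok u v) \<and>
      (\<forall>v<reg s' 18. (reg s' 17, v) \<in> parcs G \<longrightarrow> ok (reg s' 17) v) \<and>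
      (reg s' 19 = 0 \<or> reg s' 19 = 1 \<and> (reg s' 17, reg s' 18) \<in> parcs G \<and> \<not> ok (reg s' 17) (reg s' 18))"
   and \<phi> = "\<lambda>s'. pot 30 n n (reg s' 17) (reg s' 18) + mergecost * card (arr s' CLS ` {..<4 * n}) +
      (mergecost + 40) * (1 - reg s' 19)"], goal_cases)
  case 1
  then show ?case using cl by (simp add: frame_def)
next
  case (2 s')
  let ?u = "reg s' 17" and ?v = "reg s' 18"
  have f: "frame {17, 18, 19, 20, 21, 22, 24, 25, 26} {CLS} s s'" and b: "reg s' 19 = 0"
    and cl': "classes_ok (arr s MEM) (arr s PTR) (arr s LEN) (arr s' CLS)"
    and done_u: "\<forall>u<?u. \<forall>v. (u, v) \<in> parcs G \<longrightarrow> ok u v"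
    and done_v: "\<forall>v<?v. (?u, v) \<in> parcs G \<longrightarrow> ok ?u v" using 2 by auto
  have pre': "edges_pre s'" by (rule edges_pre_frame[OF pre f]) auto
  then have r: "reg s' 0 = n" by (simp add: edges_pre_def input_def)
  have u: "?u < n" using 2 r by simp
  have arr: "arr s' MEM = arr s MEM" "arr s' PTR = arr s PTR" "arr s' LEN = arr s LEN"
    using f by (simp_all add: frame_def)
  consider "?v < n" "(?u, ?v) \<in> parcs G" | "?v < n" "(?u, ?v) \<notin> parcs G" | "\<not> ?v < n" by blast
  then show ?case
  proof cases
    case 1
    note pot = pot_step[OF 1(1), of 30 n ?u]
    have cl2: "classes_ok (arr s' MEM) (arr s' PTR) (arr s' LEN) (arr s' CLS)" using cl' by (simp add: arr)
    show ?thesis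
      using 1 r b
      apply (simp del: One_nat_def)
      apply (rule wp_mono[OF check_correct[OF pre' refl u refl 1(1) b cl2]])
      subgoal for t s2
        using f pot 1 done_u done_v u b
        by (cases "ok ?u ?v") (auto simp: frame_def arr ok_def less_Suc_eq)
      done
  next
    case 2
    show ?thesis
      using 2 r b f cl' pot_step[OF 2(1), of 30 n ?u] done_u done_v u
      by (auto simp: frame_def less_Suc_eq)
  next
    case 3
    then have "ok ?u v" if "(?u, v) \<in> parcs G" for v
      using done_v edge_less[OF that] that by simp
    then show ?thesis
      using 3 r b f cl' pot_next[OF u, of 30 n ?v] done_u u
      by (auto simp: frame_def less_Suc_eq)
  qed
next
  case (3 t s')
  have r: "reg s' 0 = n" using 3(1) pre by (simp add: frame_def edges_pre_def input_def)
  have "card (arr s CLS ` {..<4 * n}) \<le> 4 * n"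
    using card_image_le[of "{..<4 * n}" "arr s CLS"] by simp
  then have "mergecost * card (arr s CLS ` {..<4 * n}) \<le> mergecost * (4 * n)"
    by (rule mult_left_mono) simp
  moreover have "t \<le> Suc (pot 30 n n 0 0 + mergecost * card (arr s CLS ` {..<4 * n}) + (mergecost + 40))"
    using 3(3) by simp
  ultimately have t: "t + 3 \<le> edgecost" by (simp only: distrib_left mult_1_right)
  have "ok u v" if "reg s' 19 = 0" "(u, v) \<in> parcs G" for u v
    using 3 that r edge_less[OF that(2)] by auto
  with 3(1) t show ?case by auto
qed

end

section \<open>Topological order by depth-first search\<close>

definition visit :: com where
  "visit =
    Store STACK (Reg 28) (Reg 32);; Store POS (Reg 32) (Reg 28);; Store STATE (Reg 32) (Num 1);;
    28 ::= Add (Reg 28) (Num 1)"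

definition blocked :: bexp where
  "blocked =
    Conj (EdgeG (Reg 31) (Reg 32)) (Conj (Less (Num 0) (Arr LEN (Reg 31)))
      (Conj (Neg (Equal (Arr 0 (Reg 32)) (Arr 0 (Reg 31))))
        (Neg (Equal (Arr 0 (Reg 32)) (Arr MEM (Add (Arr PTR (Reg 31)) (Num 1)))))))"

text \<open>An explicit stack replaces recursion. \<open>SCAN\<close> keeps the progress of every
  vertex and is not advanced when a blocker is entered; the same pair is looked at again when that
  blocker is finished.\<close>

definition dfs :: com where
  "dfs =
    28 ::= Num 0;; 29 ::= Num 0;; 30 ::= Num 0;; 33 ::= Num 0;;
    Loop (Conj (Equal (Reg 33) (Num 0)) (Less (Reg 29) (Reg 0)))
      (Cond (Equal (Reg 28) (Num 0))
        (Cond (Equal (Arr STATE (Reg 30)) (Num 0))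
           (32 ::= Reg 30;; visit)
           (30 ::= Add (Reg 30) (Num 1)))
        (31 ::= Arr STACK (Sub (Reg 28) (Num 1));; 32 ::= Arr SCAN (Reg 31);;
         Cond (Less (Reg 32) (Reg 0))
           (Cond (Conj blocked (Neg (Equal (Arr STATE (Reg 32)) (Num 2))))
              (Cond (Equal (Arr STATE (Reg 32)) (Num 1)) (33 ::= Num 1) visit)
              (Store SCAN (Reg 31) (Add (Reg 32) (Num 1))))
           (Store TOP (Reg 29) (Reg 31);; 29 ::= Add (Reg 29) (Num 1);;
            Store STATE (Reg 31) (Num 2);; 28 ::= Sub (Reg 28) (Num 1))))"

text \<open>\<open>B v w\<close> means that \<open>w\<close> has to precede \<open>v\<close>, so the
  order of finishing is already topological. Consecutive stack entries are related by
  \<open>B\<close>, and \<open>pos\<close> tells where a repeated vertex cuts a cycle out of the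
  stack.\<close>

definition dfs_inv ::
  "(nat \<Rightarrow> nat \<Rightarrow> bool) \<Rightarrow> nat \<Rightarrow> (nat \<Rightarrow> nat) \<Rightarrow> nat \<Rightarrow> (nat \<Rightarrow> nat) \<Rightarrow> nat \<Rightarrow> (nat \<Rightarrow> nat) \<Rightarrow>
     (nat \<Rightarrow> nat) \<Rightarrow> (nat \<Rightarrow> nat) \<Rightarrow> nat \<Rightarrow> bool" where
  "dfs_inv B n stack sp out cnt state scan pos r \<longleftrightarrow>
     inj_on stack {..<sp} \<and> stack ` {..<sp} \<subseteq> {..<n} \<and> (\<forall>j<sp. pos (stack j) = j) \<and>
     inj_on out {..<cnt} \<and> out ` {..<cnt} \<subseteq> {..<n} \<and>
     (\<forall>v<n. state v = (if v \<in> out ` {..<cnt} then 2 else if v \<in> stack ` {..<sp} then 1 else 0)) \<and>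
     out ` {..<cnt} \<inter> stack ` {..<sp} = {} \<and>
     (\<forall>j. Suc j < sp \<longrightarrow> B (stack j) (stack (Suc j))) \<and>
     (\<forall>v<n. scan v \<le> n \<and> (\<forall>w<scan v. B v w \<longrightarrow> w \<in> out ` {..<cnt})) \<and>
     (\<forall>j<cnt. \<forall>w. B (out j) w \<longrightarrow> w \<in> out ` {..<j}) \<and>
     r \<le> n \<and> (\<forall>v<r. state v \<noteq> 0)"

text \<open>Unless a cycle is found, each iteration advances one of three counters: a scan position,
  the state of a vertex from 0 over 1 to 2, or the next root.\<close>

definition dfs_pot :: "nat \<Rightarrow> (nat \<Rightarrow> nat) \<Rightarrow> (nat \<Rightarrow> nat) \<Rightarrow> nat \<Rightarrow> nat" where
  "dfs_pot n scan state r = 15 * ((\<Sum>v<n. n - scan v) + (\<Sum>v<n. 2 - state v) + (n - r))"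

lemma sum_upd_less:
  assumes "v < (n :: nat)" "(h a :: nat) < h (f v)"
  shows "Suc (\<Sum>x<n. h ((f(v := a)) x)) \<le> (\<Sum>x<n. h (f x))"
  unfolding Suc_le_eq
  by (rule sum_strict_mono_ex1) (use assms in auto)

lemma dfs_pot_scan: "v < n \<Longrightarrow> scan v < n \<Longrightarrow>
    dfs_pot n (scan(v := Suc (scan v))) state r + 15 \<le> dfs_pot n scan state r"
  using sum_upd_less[of v n "\<lambda>x. n - x" "Suc (scan v)" scan] diff_less_mono2[of "scan v" "Suc (scan v)" n]
  by (simp add: dfs_pot_def del: fun_upd_apply)

lemma dfs_pot_state: "v < n \<Longrightarrow> state v < a \<Longrightarrow> a \<le> 2 \<Longrightarrow>
    dfs_pot n scan (state(v := a)) r + 15 \<le> dfs_pot n scan state r"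
  using sum_upd_less[of v n "\<lambda>x. 2 - x" a state] diff_less_mono2[of "state v" a 2]
  by (simp add: dfs_pot_def del: fun_upd_apply)

lemma dfs_pot_root: "r < n \<Longrightarrow> dfs_pot n scan state (Suc r) + 15 \<le> dfs_pot n scan state r"
  by (simp add: dfs_pot_def)

lemma dfs_inv_visit:
  assumes I: "dfs_inv B n stack sp out cnt state scan pos r" and w: "w < n" "state w = 0"
    and B: "0 < sp \<Longrightarrow> B (stack (sp - 1)) w"
  shows "dfs_inv B n (stack(sp := w)) (Suc sp) out cnt (state(w := Suc 0)) scan (pos(w := sp)) r"
proof -
  have new: "w \<notin> stack ` {..<sp}" "w \<notin> out ` {..<cnt}"
    using I w by (auto simp: dfs_inv_def split: if_splits)
  have im: "(stack(sp := w)) ` {..<Suc sp} = insert w (stack ` {..<sp})"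
    by (auto simp: lessThan_Suc)
  have ne: "stack j \<noteq> w" if "j < sp" for j using new(1) that by auto
  have "inj_on (stack(sp := w)) {..<Suc sp}"
    using I new(1) by (auto simp: dfs_inv_def lessThan_Suc inj_on_def)
  moreover have "\<forall>j<Suc sp. (pos(w := sp)) ((stack(sp := w)) j) = j"
    using I ne by (auto simp: dfs_inv_def less_Suc_eq)
  moreover have "\<forall>j. Suc j < Suc sp \<longrightarrow> B ((stack(sp := w)) j) ((stack(sp := w)) (Suc j))"
  proof (intro allI impI)
    fix j assume "Suc j < Suc sp"
    then consider "Suc j = sp" | "Suc j < sp" by linarith
    then show "B ((stack(sp := w)) j) ((stack(sp := w)) (Suc j))"
      using I B by cases (auto simp: dfs_inv_def)
  qed
  ultimately show ?thesis
    unfolding dfs_inv_def im using I new w by (auto simp: dfs_inv_def)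
qed

lemma dfs_inv_scan:
  assumes I: "dfs_inv B n stack sp out cnt state scan pos r" and v: "v < n" "scan v < n"
    and "B v (scan v) \<Longrightarrow> state (scan v) = 2"
  shows "dfs_inv B n stack sp out cnt state (scan(v := Suc (scan v))) pos r"
proof -
  have "B v (scan v) \<Longrightarrow> scan v \<in> out ` {..<cnt}"
    using assms by (auto simp: dfs_inv_def split: if_splits)
  then have "\<forall>x<n. (scan(v := Suc (scan v))) x \<le> n \<and>
      (\<forall>w<(scan(v := Suc (scan v))) x. B x w \<longrightarrow> w \<in> out ` {..<cnt})"
    using I v by (auto simp: dfs_inv_def less_Suc_eq)
  with I show ?thesis unfolding dfs_inv_def by (elim conjE, intro conjI) assumption+
qed

lemma dfs_inv_pop:
  assumes I: "dfs_inv B n stack sp out cnt state scan pos r" and sp: "0 < sp"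
    and v: "v = stack (sp - 1)" "n \<le> scan v" and B: "\<And>v w. B v w \<Longrightarrow> w < n"
  shows "dfs_inv B n stack (sp - 1) (out(cnt := v)) (Suc cnt) (state(v := 2)) scan pos r"
proof -
  have new1: "v \<in> stack ` {..<sp}" using sp v(1) by auto
  moreover have "stack ` {..<sp} \<subseteq> {..<n}" "out ` {..<cnt} \<inter> stack ` {..<sp} = {}"
    using I by (simp_all add: dfs_inv_def)
  ultimately have "v \<notin> out ` {..<cnt}" "v < n" by blast+
  note new = new1 this
  obtain k where k: "sp = Suc k" using sp by (cases sp) auto
  have im2: "stack ` {..<sp} = insert v (stack ` {..<sp - 1})"
    using v(1) k by (simp add: lessThan_Suc)
  have nv: "v \<notin> stack ` {..<sp - 1}"
  proof
    have pos: "pos (stack j) = j" if "j < sp" for j using I that by (simp add: dfs_inv_def)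
    assume "v \<in> stack ` {..<sp - 1}"
    then obtain j where "j < k" "stack j = stack k" using v(1) k by auto
    then show False using pos[of j] pos[of k] k by simp
  qed
  have im: "(out(cnt := v)) ` {..<j} = (if j \<le> cnt then out ` {..<j} else insert v (out ` {..<cnt}))"
    if "j \<le> Suc cnt" for j
    using that by (auto simp: le_Suc_eq lessThan_Suc)
  have all: "B v w \<Longrightarrow> w \<in> out ` {..<cnt}" for w
    using I v(2) new(3) B[of v w] by (auto simp: dfs_inv_def)
  have "inj_on (out(cnt := v)) {..<Suc cnt}"
    using I new(2) by (auto simp: dfs_inv_def lessThan_Suc inj_on_def)
  moreover have "inj_on stack {..<sp - 1}"
    using I by (auto simp: dfs_inv_def intro: inj_on_subset)
  moreover have "\<forall>j<Suc cnt. \<forall>w. B ((out(cnt := v)) j) w \<longrightarrow> w \<in> (out(cnt := v)) ` {..<j}"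
  proof (intro allI impI)
    fix j w assume j: "j < Suc cnt" and b: "B ((out(cnt := v)) j) w"
    have "w \<in> out ` {..<j}"
    proof (cases "j = cnt")
      case False
      then show ?thesis using I j b by (simp add: dfs_inv_def)
    qed (use all b in simp)
    then show "w \<in> (out(cnt := v)) ` {..<j}" using im[of j] j by simp
  qed
  moreover have im': "(out(cnt := v)) ` {..<Suc cnt} = insert v (out ` {..<cnt})"
    using im[of "Suc cnt"] by simp
  moreover have "insert v (out ` {..<cnt}) \<subseteq> {..<n}" "stack ` {..<sp - 1} \<subseteq> {..<n}"
    "insert v (out ` {..<cnt}) \<inter> stack ` {..<sp - 1} = {}"
    using I im2 new nv by (auto simp: dfs_inv_def)
  moreover have "\<forall>x<n. (state(v := 2)) x = (if x \<in> insert v (out ` {..<cnt}) then 2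
      else if x \<in> stack ` {..<sp - 1} then 1 else 0)"
    using I im2 by (auto simp: dfs_inv_def)
  moreover have "\<forall>j<sp - 1. pos (stack j) = j"
    "\<forall>j. Suc j < sp - 1 \<longrightarrow> B (stack j) (stack (Suc j))"
    "\<forall>x<n. scan x \<le> n \<and> (\<forall>w<scan x. B x w \<longrightarrow> w \<in> insert v (out ` {..<cnt}))"
    using I by (auto simp: dfs_inv_def)
  moreover have "r \<le> n" "\<forall>x<r. (state(v := 2)) x \<noteq> 0"
  proof -
    have "\<forall>x<r. state x \<noteq> 0" using I unfolding dfs_inv_def by (elim conjE)
    then show "\<forall>x<r. (state(v := 2)) x \<noteq> 0" by simp
  qed (use I in \<open>simp add: dfs_inv_def\<close>)
  ultimately show ?thesis
    unfolding dfs_inv_def im' by (intro conjI)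
qed

context instance_nat
begin

definition "blocks_by mem ptr len v w \<longleftrightarrow>
  (v, w) \<in> parcs G \<and> 0 < len v \<and> \<alpha> w \<noteq> \<alpha> v \<and> \<alpha> w \<noteq> mem (Suc (ptr v) :: nat)"

lemma dfs_correct:
  assumes inp: "input s" and z: "\<And>v. v < n \<Longrightarrow> arr s STATE v = 0" "\<And>v. v < n \<Longrightarrow> arr s SCAN v = 0"
  defines "B \<equiv> blocks_by (arr s MEM) (arr s PTR) (arr s LEN)"
  shows "wp G H dfs s (\<lambda>t s'. t \<le> 15 * (n * n + 3 * n) + 30 \<and>
     frame {28, 29, 30, 31, 32, 33} {STATE, SCAN, STACK, POS, TOP} s s' \<and>
     (reg s' 33 = 0 \<and> inj_on (arr s' TOP) {..<n} \<and> arr s' TOP ` {..<n} = {..<n} \<and>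
        (\<forall>j<n. \<forall>w. B (arr s' TOP j) w \<longrightarrow> w \<in> arr s' TOP ` {..<j}) \<or>
      reg s' 33 = 1 \<and> reg s' 32 < n \<and>
        (let p = arr s' POS (reg s' 32) in
          p < reg s' 28 \<and> reg s' 28 \<le> n \<and> arr s' STACK p = reg s' 32 \<and>
          (\<forall>j. Suc j < reg s' 28 \<longrightarrow> B (arr s' STACK j) (arr s' STACK (Suc j))) \<and>
          B (arr s' STACK (reg s' 28 - 1)) (reg s' 32))))"
proof -
  let ?I = "\<lambda>s'. dfs_inv B n (arr s' STACK) (reg s' 28) (arr s' TOP) (reg s' 29)
      (arr s' STATE) (arr s' SCAN) (arr s' POS) (reg s' 30)"
  have Bn: "B v w \<Longrightarrow> w < n" for v w using edge_less by (auto simp: B_def blocks_by_def)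
  show ?thesis
    unfolding dfs_def wp_Seq[of _ _ "Assign _ _"] wp_Assign
  proof (rule wp_Loop[where I = "\<lambda>s'. frame {28, 29, 30, 31, 32, 33} {STATE, SCAN, STACK, POS, TOP} s s' \<and>
      ?I s' \<and> (reg s' 33 = 0 \<or> reg s' 33 = 1 \<and> reg s' 32 < n \<and> 0 < reg s' 28 \<and>
         arr s' STATE (reg s' 32) = 1 \<and> B (arr s' STACK (reg s' 28 - 1)) (reg s' 32))"
     and \<phi> = "\<lambda>s'. dfs_pot n (arr s' SCAN) (arr s' STATE) (reg s' 30) + 15 * (1 - reg s' 33)"], goal_cases)
    case 1
    then show ?case using z by (simp add: frame_def dfs_inv_def)
  next
    case (2 s')
    let ?sp = "reg s' 28" and ?r = "reg s' 30" and ?v = "arr s' STACK (reg s' 28 - 1)"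
    let ?w = "arr s' SCAN ?v"
    have f: "frame {28, 29, 30, 31, 32, 33} {STATE, SCAN, STACK, POS, TOP} s s'" and I: "?I s'"
      and c: "reg s' 33 = 0" using 2 by auto
    have r: "reg s' 0 = n" "arr s' MEM = arr s MEM" "arr s' PTR = arr s PTR" "arr s' LEN = arr s LEN"
      "\<And>v. v < n \<Longrightarrow> arr s' 0 v = \<alpha> v" using f inp by (auto simp: frame_def input_def)
    have cnt: "reg s' 29 < n" using 2 r by simp
    show ?case
    proof (cases "?sp = 0")
      case True
      \<comment> \<open>An empty stack with all roots tried would mean that all vertices are
        finished, against the loop test.\<close>
      have "?r < n"
      proof (rule ccontr)
        assume "\<not> ?r < n"
        moreover have "?r \<le> n"
          using I unfolding dfs_inv_def by (elim conjE)
        moreover have "\<forall>v<?r. arr s' STATE v \<noteq> 0"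
          using I unfolding dfs_inv_def by (elim conjE)
        ultimately have "arr s' STATE x \<noteq> 0" if "x < n" for x
          using that by simp
        moreover have "arr s' STATE x = (if x \<in> arr s' TOP ` {..<reg s' 29} then 2 else 0)" if "x < n" for x
          using I that True by (simp add: dfs_inv_def)
        ultimately have "{..<n} \<subseteq> arr s' TOP ` {..<reg s' 29}" by (metis lessThan_iff subsetI)
        then have "n \<le> reg s' 29" using surj_card_le[of "{..<reg s' 29}" "{..<n}"] by simp
        with cnt show False by simp
      qed
      show ?thesis
      proof (cases "arr s' STATE ?r = 0")
        case z: True
        show ?thesis
          using True z f c \<open>?r < n\<close> dfs_inv_visit[OF I \<open>?r < n\<close> z]
            dfs_pot_state[of ?r n "arr s' STATE" 1 "arr s' SCAN" ?r]
          by (simp add: visit_def frame_def)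
      next
        case z: False
        then have "dfs_inv B n (arr s' STACK) ?sp (arr s' TOP) (reg s' 29)
          (arr s' STATE) (arr s' SCAN) (arr s' POS) (Suc ?r)"
          using I \<open>?r < n\<close> by (auto simp: dfs_inv_def less_Suc_eq)
        then show ?thesis
          using True z f c \<open>?r < n\<close> dfs_pot_root[of ?r n "arr s' SCAN" "arr s' STATE"]
          by (simp add: frame_def)
      qed
    next
      case sp: False
      then have vs: "?v \<in> arr s' STACK ` {..<?sp}" by auto
      moreover have sub: "arr s' STACK ` {..<?sp} \<subseteq> {..<n}"
        "arr s' TOP ` {..<reg s' 29} \<inter> arr s' STACK ` {..<?sp} = {}"
        using I by (simp_all add: dfs_inv_def)
      ultimately have v: "?v < n" and vt: "?v \<notin> arr s' TOP ` {..<reg s' 29}" by blast+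
      have "arr s' STATE ?v = (if ?v \<in> arr s' TOP ` {..<reg s' 29} then 2
          else if ?v \<in> arr s' STACK ` {..<?sp} then 1 else 0)"
        using I v by (simp add: dfs_inv_def)
      then have sv: "arr s' STATE ?v = 1" using vs vt by simp
      show ?thesis
      proof (cases "?w < n")
        case w: True
        have B: "bval G H (s'\<lparr>reg := (reg s')(31 := ?v, 32 := ?w)\<rparr>) blocked \<longleftrightarrow> B ?v ?w"
          using r w v by (auto simp: blocked_def B_def blocks_by_def)
        have st: "arr s' STATE ?w \<in> {0, 1, 2}" using I w by (auto simp: dfs_inv_def)
        consider "B ?v ?w" "arr s' STATE ?w = 1" | "B ?v ?w" "arr s' STATE ?w = 0"
          | "\<not> B ?v ?w \<or> arr s' STATE ?w = 2" using st by auto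
        then show ?thesis
        proof cases
          case 1
          then show ?thesis using sp w f c I r B by (simp add: frame_def)
        next
          case 2
          then show ?thesis
            using sp w f c r B dfs_inv_visit[OF I w 2(2)]
              dfs_pot_state[of ?w n "arr s' STATE" 1 "arr s' SCAN" ?r]
            by (simp add: visit_def frame_def)
        next
          case 3
          then have "B ?v ?w \<Longrightarrow> arr s' STATE ?w = 2" by blast
          with 3 show ?thesis
            using sp w f c r B dfs_inv_scan[OF I v w]
              dfs_pot_scan[of ?v n "arr s' SCAN" "arr s' STATE" ?r] v
            by (auto simp: frame_def)
        qed
      next
        case w: False
        then show ?thesis
          using sp w f c r dfs_inv_pop[OF I _ refl _ Bn]
            dfs_pot_state[of ?v n "arr s' STATE" 2 "arr s' SCAN" ?r] v sv
          by (simp add: frame_def)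
      qed
    qed
  next
    case (3 t s')
    have f: "frame {28, 29, 30, 31, 32, 33} {STATE, SCAN, STACK, POS, TOP} s s'" and I: "?I s'"
      using 3 by auto
    have r: "reg s' 0 = n" using f inp by (simp add: frame_def input_def)
    have "(\<Sum>v<n. n - arr s SCAN v) = n * n" "(\<Sum>v<n. 2 - arr s STATE v) = n * 2"
      using z by simp_all
    then have t: "t + 4 \<le> 15 * (n * n + 3 * n) + 30"
      using 3(3) by (simp add: dfs_pot_def)
    show ?case
    proof (cases "reg s' 33 = 0")
      case True
      then have "n \<le> reg s' 29" using 3(2) r by simp
      moreover have "reg s' 29 \<le> n"
        using I card_mono[of "{..<n}" "arr s' TOP ` {..<reg s' 29}"] by (auto simp: dfs_inv_def card_image)
      ultimately have n: "reg s' 29 = n" by simp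
      then have "arr s' TOP ` {..<n} = {..<n}"
        using I by (intro card_subset_eq) (auto simp: dfs_inv_def card_image)
      then show ?thesis using f True t I n by (simp add: dfs_inv_def)
    next
      case False
      then have c: "reg s' 33 = 1" "reg s' 32 < n" "0 < reg s' 28" "arr s' STATE (reg s' 32) = 1"
        "B (arr s' STACK (reg s' 28 - 1)) (reg s' 32)" using 3 by auto
      have "arr s' STATE (reg s' 32) = (if reg s' 32 \<in> arr s' TOP ` {..<reg s' 29} then 2
          else if reg s' 32 \<in> arr s' STACK ` {..<reg s' 28} then 1 else 0)"
        using I c(2) by (simp add: dfs_inv_def)
      \<comment> \<open>State 1 marks the vertices on the stack; from this entry to the top the
        stack closes up to a cycle of blockers.\<close>
      then have "reg s' 32 \<in> arr s' STACK ` {..<reg s' 28}"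
        using c(4) by (simp split: if_splits)
      then obtain p where p: "p < reg s' 28" "reg s' 32 = arr s' STACK p" by auto
      then have pos: "arr s' POS (reg s' 32) = p" using I by (simp add: dfs_inv_def)
      have "reg s' 28 \<le> n"
        using I card_mono[of "{..<n}" "arr s' STACK ` {..<reg s' 28}"] by (auto simp: dfs_inv_def card_image)
      moreover have "\<forall>j. Suc j < reg s' 28 \<longrightarrow> B (arr s' STACK j) (arr s' STACK (Suc j))"
        using I by (simp add: dfs_inv_def)
      ultimately show ?thesis unfolding Let_def pos using f t c p by simp
    qed
  qed
qed

end

section \<open>The output\<close>

definition ascend :: "nat \<Rightarrow> com" where
  "ascend a =
    34 ::= Num 0;;
    Loop (Less (Reg 34) (Add (Reg 37) (Num 1)))
      (Store a (Add (Reg 36) (Reg 34)) (Reg 35);; 35 ::= Arr PAR (Reg 35);;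
       34 ::= Add (Reg 34) (Num 1))"

text \<open>The closed walk follows the tree from \<open>q\<close> to the first end of the edge,
  crosses it and returns along the tree. The first path is known only upwards, so it is written from
  its end by counting down.\<close>

definition out_invalid :: com where
  "out_invalid =
    34 ::= Arr DEP (Reg 17);; 35 ::= Reg 17;;
    Loop (Less (Num 0) (Reg 34))
      (Store 0 (Reg 34) (Reg 35);; 35 ::= Arr PAR (Reg 35);; 34 ::= Sub (Reg 34) (Num 1));;
    Store 0 (Num 0) (Reg 35);;
    35 ::= Reg 18;; 36 ::= Add (Arr DEP (Reg 17)) (Num 1);; 37 ::= Arr DEP (Reg 18);;
    ascend 0;;
    0 ::= Num 1;; 1 ::= Add (Reg 36) (Reg 37)"

definition out_cycle :: com where
  "out_cycle =
    36 ::= Arr POS (Reg 32);; 34 ::= Num 0;;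
    Loop (Less (Add (Reg 36) (Reg 34)) (Reg 28))
      (Store 0 (Reg 34) (Arr STACK (Add (Reg 36) (Reg 34)));; 34 ::= Add (Reg 34) (Num 1));;
    Store 0 (Reg 34) (Reg 32);; 38 ::= Reg 34;;
    35 ::= Reg 32;; 36 ::= Num 0;; 37 ::= Arr DEP (Reg 32);;
    ascend 1;;
    0 ::= Num 2;; 1 ::= Reg 38;; 2 ::= Reg 37"

text \<open>Every round scans all vertices, arrived or not; \<open>length Q + 2 * n\<close> rounds
  still fit the bound. Arrays 0 and 1, which held \<alpha> and \<beta>, now receive the moves, and
  the new colors are read from \<open>MEM\<close>.\<close>

definition out_moves :: com where
  "out_moves =
    34 ::= Num 0;; 35 ::= Num 0;; 36 ::= Num 0;; 37 ::= Add (Reg 3) (Add (Reg 0) (Reg 0));;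
    Loop (Less (Reg 34) (Reg 37))
      (Cond (Less (Reg 35) (Reg 0))
        (31 ::= Arr TOP (Reg 35);;
         Cond (Less (Reg 34) (Arr LEN (Reg 31)))
           (Store 0 (Reg 36) (Reg 31);;
            Store 1 (Reg 36) (Arr MEM (Add (Arr PTR (Reg 31)) (Add (Reg 34) (Num 1))));;
            36 ::= Add (Reg 36) (Num 1))
           Skip;;
         35 ::= Add (Reg 35) (Num 1))
        (34 ::= Add (Reg 34) (Num 1);; 35 ::= Num 0));;
    0 ::= Num 0;; 1 ::= Reg 36"

definition order_phase :: com where
  "order_phase = dfs;; Cond (Equal (Reg 33) (Num 1)) out_cycle out_moves"

definition decide :: com where
  "decide = edges;; Cond (Equal (Reg 19) (Num 1)) out_invalid order_phase"

definition main :: com where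
  "main = bfs;; rows;; items;; decide"

lemma arcs_of_append: "arcs_of f (k + l) = arcs_of f k @ arcs_of (\<lambda>i. f (k + i)) l"
  by (induction l) (simp_all add: arcs_of_snoc)

lemma rev_path_arcs_of: "rev_path (arcs_of f k) = arcs_of (\<lambda>i. f (k - i)) k"
proof (induction k)
  case (Suc k)
  have "arcs_of (\<lambda>i. f (Suc k - i)) (Suc k) = (f (Suc k), f k) # arcs_of (\<lambda>i. f (k - i)) k"
    by (simp add: arcs_of_Suc)
  then show ?case using Suc by (simp add: arcs_of_snoc)
qed simp

lemma output_walk_arcs_of: "output_walk = arcs_of"
  by (simp add: output_walk_def arcs_of_def fun_eq_iff)

lemma ascend_correct:
  assumes "a \<noteq> PAR"
  shows "wp G H (ascend a) s (\<lambda>t s'. t \<le> 4 * reg s 37 + 10 \<and> frame {34, 35} {a} s s' \<and>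
     (\<forall>i\<le>reg s 37. arr s' a (reg s 36 + i) = (arr s PAR ^^ i) (reg s 35)) \<and>
     (\<forall>j<reg s 36. arr s' a j = arr s a j))"
  unfolding ascend_def wp_Seq[of _ _ "Assign _ _"] wp_Assign
proof (rule wp_Loop[where I = "\<lambda>s'. frame {34, 35} {a} s s' \<and> reg s' 34 \<le> Suc (reg s 37) \<and>
      reg s' 35 = (arr s PAR ^^ reg s' 34) (reg s 35) \<and>
      (\<forall>i<reg s' 34. arr s' a (reg s 36 + i) = (arr s PAR ^^ i) (reg s 35)) \<and>
      (\<forall>j<reg s 36. arr s' a j = arr s a j)"
    and \<phi> = "\<lambda>s'. 4 * (Suc (reg s 37) - reg s' 34)"], goal_cases)
  case 1
  then show ?case by (simp add: frame_def)
next
  case (2 s')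
  then have lt: "reg s' 34 < Suc (reg s 37)" by (simp add: frame_def)
  then have pot: "4 * (Suc (reg s 37) - reg s' 34) = 4 * (Suc (reg s 37) - Suc (reg s' 34)) + 4" by simp
  from 2 lt pot assms show ?case by (auto simp: frame_def less_Suc_eq)
next
  case (3 t s')
  then have "reg s' 34 = Suc (reg s 37)" by (auto simp: frame_def)
  with 3 show ?case by (auto simp: less_Suc_eq_le)
qed

lemma out_invalid_correct:
  "wp G H out_invalid s (\<lambda>t s'. t \<le> 4 * (arr s DEP (reg s 17) + arr s DEP (reg s 18)) + 50 \<and>
     reg s' 0 = 1 \<and> output_walk (arr s' 0) (reg s' 1) =
       rev_path (tw (arr s PAR) (arr s DEP) (reg s 17)) @
         (reg s 17, reg s 18) # tw (arr s PAR) (arr s DEP) (reg s 18))"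
proof -
  let ?u = "reg s 17" and ?v = "reg s 18" and ?par = "arr s PAR"
  let ?d = "arr s DEP ?u" and ?e = "arr s DEP ?v"
  have 1: "wp G H (Loop (Less (Num 0) (Reg 34))
      (Store 0 (Reg 34) (Reg 35);; 35 ::= Arr PAR (Reg 35);; 34 ::= Sub (Reg 34) (Num 1)))
      (s\<lparr>reg := (reg s)(34 := ?d, 35 := ?u)\<rparr>)
    (\<lambda>t s'. t \<le> 4 * ?d + 1 \<and> frame {34, 35} {0} s s' \<and> reg s' 35 = (?par ^^ ?d) ?u \<and>
      (\<forall>j. 0 < j \<longrightarrow> j \<le> ?d \<longrightarrow> arr s' 0 j = (?par ^^ (?d - j)) ?u))"
  proof (rule wp_Loop[where I = "\<lambda>s'. frame {34, 35} {0} s s' \<and> reg s' 34 \<le> ?d \<and>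
        reg s' 35 = (?par ^^ (?d - reg s' 34)) ?u \<and>
        (\<forall>j. reg s' 34 < j \<longrightarrow> j \<le> ?d \<longrightarrow> arr s' 0 j = (?par ^^ (?d - j)) ?u)"
      and \<phi> = "\<lambda>s'. 4 * reg s' 34"], goal_cases)
    case 1
    then show ?case by (simp add: frame_def)
  next
    case (2 s')
    then obtain k where k: "reg s' 34 = Suc k" by (cases "reg s' 34") auto
    then have "?d - k = Suc (?d - Suc k)" using 2 by (simp add: Suc_diff_Suc)
    with 2 k show ?case by (auto simp: frame_def)
  next
    case (3 t s')
    then show ?case by simp
  qed
  show ?thesis
    apply (simp add: out_invalid_def del: One_nat_def)
    apply (rule wp_mono[OF 1])
    subgoal premises 1 for t1 s1
  proof -
    from 1 have f1: "frame {34, 35} {0} s s1" by simp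
    let ?s = "s1\<lparr>arr := (arr s1)(0 := (arr s1 0)(0 := reg s1 35)),
      reg := (reg s1)(35 := ?v, 36 := Suc ?d, 37 := ?e)\<rparr>"
    have "wp G H (ascend 0) ?s (\<lambda>t s'. t \<le> 4 * ?e + 10 \<and>
       frame {34, 35} {0} ?s s' \<and>
       (\<forall>i\<le>?e. arr s' 0 (Suc ?d + i) = (?par ^^ i) ?v) \<and>
       (\<forall>j<Suc ?d. arr s' 0 j = (?par ^^ (?d - j)) ?u))"
    proof (rule wp_mono[OF ascend_correct], goal_cases)
      case (2 t2 s2)
      have "((arr s1 0)(0 := reg s1 35)) j = (?par ^^ (?d - j)) ?u" if "j \<le> ?d" for j
        using 1 that by (cases j) auto
      then show ?case using 2 f1 by (simp add: frame_def less_Suc_eq_le)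
    qed simp
    moreover have "reg s1 17 = ?u" "reg s1 18 = ?v" "arr s1 DEP = arr s DEP"
      using f1 by (simp_all add: frame_def)
    ultimately show ?thesis
      apply simp
      apply (erule wp_mono)
      subgoal premises p for t2 s2
      proof -
        have "arr s2 0 (Suc ?d + i) = (?par ^^ i) ?v" if "i \<le> ?e" for i using p that by auto
        moreover have "arr s2 0 j = (?par ^^ (?d - j)) ?u" if "j \<le> ?d" for j
          using p that by (auto simp: less_Suc_eq_le)
        moreover have "arr s2 0 ?d = ?u" "arr s2 0 (Suc ?d) = ?v" using calculation(1)[of 0] calculation(2)[of ?d] by auto
        ultimately have "arcs_of (arr s2 0) (?d + (1 + ?e)) =
            rev_path (tw ?par (arr s DEP) ?u) @ (?u, ?v) # tw ?par (arr s DEP) ?v"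
          unfolding arcs_of_append[of _ ?d] arcs_of_append[of _ 1]
          by (auto simp: tw_def rev_path_arcs_of arcs_of_Suc intro!: arcs_of_cong)
        then show ?thesis using p 1 by (simp add: frame_def output_walk_arcs_of)
      qed
      done
  qed
  done
qed

lemma out_cycle_correct:
  assumes "arr s POS (reg s 32) < reg s 28"
  shows "wp G H out_cycle s (\<lambda>t s'. t \<le> 3 * reg s 28 + 4 * arr s DEP (reg s 32) + 50 \<and> reg s' 0 = 2 \<and>
     reg s' 1 = reg s 28 - arr s POS (reg s 32) \<and>
     (\<forall>i<reg s' 1. arr s' 0 i = arr s STACK (arr s POS (reg s 32) + i)) \<and> arr s' 0 (reg s' 1) = reg s 32 \<and>
     arr s' 1 0 = reg s 32 \<and> output_walk (arr s' 1) (reg s' 2) = tw (arr s PAR) (arr s DEP) (reg s 32))"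
proof -
  let ?p = "arr s POS (reg s 32)" and ?sp = "reg s 28" and ?w = "reg s 32"
  let ?d = "arr s DEP ?w"
  have 1: "wp G H (Loop (Less (Add (Reg 36) (Reg 34)) (Reg 28))
      (Store 0 (Reg 34) (Arr STACK (Add (Reg 36) (Reg 34)));; 34 ::= Add (Reg 34) (Num 1)))
      (s\<lparr>reg := (reg s)(36 := ?p, 34 := 0)\<rparr>)
    (\<lambda>t s'. t \<le> 3 * ?sp + 1 \<and> frame {34, 36} {0} s s' \<and> reg s' 34 = ?sp - ?p \<and>
      (\<forall>i<?sp - ?p. arr s' 0 i = arr s STACK (?p + i)))"
  proof (rule wp_Loop[where I = "\<lambda>s'. frame {34, 36} {0} s s' \<and> reg s' 34 \<le> ?sp - ?p \<and> reg s' 36 = ?p \<and>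
        (\<forall>i<reg s' 34. arr s' 0 i = arr s STACK (?p + i))"
      and \<phi> = "\<lambda>s'. 3 * (?sp - ?p - reg s' 34)"], goal_cases)
    case 1
    then show ?case by (simp add: frame_def)
  next
    case (2 s')
    then have lt: "reg s' 34 < ?sp - ?p" by (auto simp: frame_def)
    then have "3 * (?sp - ?p - reg s' 34) = 3 * (?sp - ?p - Suc (reg s' 34)) + 3" by simp
    with 2 lt show ?case by (auto simp: frame_def less_Suc_eq)
  next
    case (3 t s')
    then have "reg s' 34 = ?sp - ?p" by (auto simp: frame_def)
    with 3 show ?case by auto
  qed
  show ?thesis
    apply (simp add: out_cycle_def del: One_nat_def)
    apply (rule wp_mono[OF 1])
    subgoal premises 1 for t1 s1
  proof -
    from 1 have f1: "frame {34, 36} {0} s s1" by simp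
    let ?s = "s1\<lparr>arr := (arr s1)(0 := (arr s1 0)(?sp - ?p := ?w)),
      reg := (reg s1)(38 := ?sp - ?p, 35 := ?w, 36 := 0, 37 := ?d)\<rparr>"
    have "wp G H (ascend 1) ?s (\<lambda>t s'. t \<le> 4 * ?d + 10 \<and>
       frame {34, 35} {1} ?s s' \<and> (\<forall>i\<le>?d. arr s' 1 i = (arr s PAR ^^ i) ?w))"
      by (rule wp_mono[OF ascend_correct]) (use f1 in \<open>simp_all add: frame_def\<close>)
    moreover have "reg s1 32 = ?w" "arr s1 DEP = arr s DEP" "reg s1 34 = ?sp - ?p"
      using f1 1 by (simp_all add: frame_def)
    ultimately show ?thesis
      apply simp
      apply (erule wp_mono)
      subgoal premises p for t2 s2
      proof -
        have "arcs_of (arr s2 1) ?d = tw (arr s PAR) (arr s DEP) ?w"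
          unfolding tw_def by (rule arcs_of_cong) (use p in auto)
        moreover have "arr s2 1 0 = ?w" using p by auto
        ultimately show ?thesis using p 1 by (simp add: frame_def output_walk_arcs_of)
      qed
      done
  qed
  done
qed


section \<open>Outputs and their certificates\<close>

context instance_nat
begin

lemma input_frame:
  "input s \<Longrightarrow> frame R A s s' \<Longrightarrow> {0, 2, 3} \<inter> R = {} \<Longrightarrow> {0, 1} \<inter> A = {} \<Longrightarrow> input s'"
  by (auto simp: input_def frame_def disjoint_iff)

lemma out_moves_correct:
  assumes inp: "input s"
    and L: "lifting G H \<alpha> \<beta> (\<lambda>v i. arr s MEM (arr s PTR v + i)) (arr s LEN)"
  defines "rounds \<equiv> lifting.rounds (\<lambda>v i. arr s MEM (arr s PTR v + i)) (arr s LEN)"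
  shows "wp G H out_moves s (\<lambda>t s'. t \<le> pot 15 (length Q + 2 * n) n 0 0 + 20 \<and> reg s' 0 = 0 \<and>
     map (\<lambda>i. (arr s' 0 i, arr s' 1 i)) [0..<reg s' 1] = rounds (map (arr s TOP) [0..<n]) (length Q + 2 * n))"
proof -
  interpret L: lifting G H \<alpha> \<beta> "\<lambda>v i. arr s MEM (arr s PTR v + i)" "arr s LEN" by (rule L)
  let ?K = "length Q + 2 * n" and ?os = "map (arr s TOP) [0..<n]"
  have n: "reg s 0 = n" "reg s 3 = length Q" using inp by (simp_all add: input_def)
  \<comment> \<open>The clause for \<open>reg s' 34 = ?K\<close> ensures that no partial round has
    been started when the loop ends.\<close>
  let ?I = "\<lambda>s'. frame {31, 34, 35, 36, 37} {0, 1} s s' \<and>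
      reg s' 37 = ?K \<and> reg s' 35 \<le> n \<and> reg s' 34 \<le> ?K \<and> (reg s' 34 = ?K \<longrightarrow> reg s' 35 = 0) \<and>
      map (\<lambda>i. (arr s' 0 i, arr s' 1 i)) [0..<reg s' 36] =
        L.rounds ?os (reg s' 34) @ L.round (reg s' 34) (take (reg s' 35) ?os)"
  have 1: "wp G H (Loop (Less (Reg 34) (Reg 37))
      (Cond (Less (Reg 35) (Reg 0))
        (31 ::= Arr TOP (Reg 35);;
         Cond (Less (Reg 34) (Arr LEN (Reg 31)))
           (Store 0 (Reg 36) (Reg 31);;
            Store 1 (Reg 36) (Arr MEM (Add (Arr PTR (Reg 31)) (Add (Reg 34) (Num 1))));;
            36 ::= Add (Reg 36) (Num 1))
           Skip;;
         35 ::= Add (Reg 35) (Num 1))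
        (34 ::= Add (Reg 34) (Num 1);; 35 ::= Num 0)))
      (s\<lparr>reg := (reg s)(34 := 0, 35 := 0, 36 := 0, 37 := ?K)\<rparr>)
    (\<lambda>t s'. t \<le> pot 15 ?K n 0 0 + 1 \<and>
      map (\<lambda>i. (arr s' 0 i, arr s' 1 i)) [0..<reg s' 36] = L.rounds ?os ?K)"
  proof (rule wp_Loop[where I = ?I and \<phi> = "\<lambda>s'. pot 15 ?K n (reg s' 34) (reg s' 35)"], goal_cases)
    case 1
    then show ?case by (simp add: frame_def L.rounds_def L.round_def)
  next
    case (2 s')
    let ?k = "reg s' 34" and ?i = "reg s' 35"
    have f: "frame {31, 34, 35, 36, 37} {0, 1} s s'"
      and K: "reg s' 37 = ?K" using 2 by auto
    have r: "reg s' 0 = n" "arr s' TOP = arr s TOP" "arr s' LEN = arr s LEN" "arr s' PTR = arr s PTR"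
      "arr s' MEM = arr s MEM"
      using f n by (simp_all add: frame_def)
    have k: "?k < ?K" using 2 K by simp
    have eq: "map (\<lambda>i. (arr s' 0 i, arr s' 1 i)) [0..<reg s' 36] =
        L.rounds ?os ?k @ L.round ?k (take ?i ?os)" using 2 by simp
    show ?case
    proof (cases "?i < n")
      case True
      let ?v = "arr s TOP ?i"
      have take: "take (Suc ?i) ?os = take ?i ?os @ [?v]"
        using True by (simp add: take_Suc_conv_app_nth)
      have upd: "map (\<lambda>i. (((arr s' 0)(reg s' 36 := a)) i, ((arr s' 1)(reg s' 36 := b)) i)) [0..<reg s' 36] =
          map (\<lambda>i. (arr s' 0 i, arr s' 1 i)) [0..<reg s' 36]" for a b
        by simp
      have round: "L.round ?k (take (Suc ?i) ?os) = L.round ?k (take ?i ?os) @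
          (if ?k < arr s LEN ?v then [(?v, arr s MEM (arr s PTR ?v + Suc ?k))] else [])"
        unfolding take by (simp add: L.round_def)
      show ?thesis
      proof (cases "?k < arr s LEN ?v")
        case lt: True
        show ?thesis
          using True lt f K k r pot_step[OF True, of 15 ?K ?k] eq round upd
          by (simp add: frame_def cong: if_cong)
      next
        case lt: False
        show ?thesis
          using True lt f K k r pot_step[OF True, of 15 ?K ?k] eq round
          by (simp add: frame_def)
      qed
    next
      case False
      then have "take ?i ?os = ?os" by simp
      then have "map (\<lambda>i. (arr s' 0 i, arr s' 1 i)) [0..<reg s' 36] =
        L.rounds ?os (Suc ?k) @ L.round (Suc ?k) (take 0 ?os)"
        using eq by (simp add: L.rounds_def L.round_def)
      then show ?thesis
        using False f K k r pot_next[OF k, of 15 n ?i] by (simp add: frame_def)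
    qed
  next
    case (3 t s')
    then have "reg s' 34 = ?K" by auto
    with 3 show ?case by (simp add: L.round_def)
  qed
  have "reg s 3 + (reg s 0 + reg s 0) = ?K" using n by simp
  then show ?thesis
    apply (simp add: out_moves_def rounds_def del: One_nat_def)
    apply (rule wp_mono[OF 1])
    apply simp
    done
qed

lemma lifting_of_rows:
  assumes T: "tree n ord par dep"
    and R: "\<And>v. v < n \<Longrightarrow> row par dep mem ptr len v"
    and E: "\<forall>(u, v)\<in>parcs G. edge_ok mem ptr len u v"
  shows "lifting G H \<alpha> \<beta> (\<lambda>v i. mem (ptr v + i)) len"
proof (rule lifting_of_transport[OF inst, of "tw par dep"])
  fix v assume "v \<in> pverts G"
  then have v: "v < n" using verts by simp
  show "walk G v (tw par dep v) q" using tree_walk[OF T] tree_surj[OF T v] by auto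
  show "arcs_of (\<lambda>i. mem (ptr v + i)) (len v) = Rep_word (transport \<alpha> \<beta> Q (tw par dep v))"
    "mem (ptr v + 0) = \<alpha> v" using R[OF v] by (auto simp: row_def)
next
  show "intertwines G \<alpha> \<beta> (\<lambda>v. transport \<alpha> \<beta> Q (tw par dep v))"
    unfolding intertwines_def
  proof clarify
    fix u v assume e: "(u, v) \<in> parcs G"
    then have "edge_ok mem ptr len u v" using E by auto
    then have "transport \<alpha> \<beta> Q (tw par dep u) =
        arc (\<alpha> u) (\<alpha> v) + transport \<alpha> \<beta> Q (tw par dep v) + arc (\<beta> v) (\<beta> u)"
      using R edge_less[OF e] by (simp add: edge_ok_def row_def cls_Rep)
    then show "arc (\<alpha> u) (\<alpha> v) + transport \<alpha> \<beta> Q (tw par dep v) =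
        transport \<alpha> \<beta> Q (tw par dep u) + arc (\<beta> u) (\<beta> v)"
      by (simp add: add.assoc)
  qed
qed

text \<open>A violated edge is refuted on the closed walk that it forms with the two tree walks, by
  the contrapositive of \<open>valid_on_transport\<close>.\<close>

lemma invalid_certificate:
  assumes T: "tree n ord par dep" and e: "(u, v) \<in> parcs G"
    and R: "\<And>v. v < n \<Longrightarrow> row par dep mem ptr len v" and bad: "\<not> edge_ok mem ptr len u v"
  defines "C \<equiv> rev_path (tw par dep u) @ (u, v) # tw par dep v"
  shows "walk G q C q" "\<not> valid_on H \<alpha> \<beta> q Q C"
proof -
  have w: "walk G x (tw par dep x) q" if "x < n" for x
    using tree_walk[OF T] tree_surj[OF T that] by auto
  show "walk G q C q"
    unfolding C_def using edge_less[OF e]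
    by (intro G.walk_append[OF G.walk_rev[OF w] G.walk_Cons[OF e w]]) auto
  show "\<not> valid_on H \<alpha> \<beta> q Q C"
  proof
    assume "valid_on H \<alpha> \<beta> q Q C"
    then have "transport \<alpha> \<beta> Q (tw par dep u) =
        arc (\<alpha> u) (\<alpha> v) + transport \<alpha> \<beta> Q (tw par dep v) + arc (\<beta> v) (\<beta> u)"
      using valid_on_transport[of H \<alpha> \<beta> q Q "tw par dep u" u v "tw par dep v"]
      by (simp add: C_def add.assoc)
    then show False using bad R edge_less[OF e] by (simp add: edge_ok_def row_def cls_Rep)
  qed
qed

text \<open>Only a vertex that still has to move can be blocked, so the walk forced on
  \<open>f 0\<close> is not trivial, whereas condition (ii) on the tree walk of \<open>f 0\<close>
  would make it trivial.\<close>

lemma cycle_certificate: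
  assumes L: "lifting G H \<alpha> \<beta> (\<lambda>v i. mem (ptr v + i)) len"
    and T: "tree n ord par dep" and R: "\<forall>v<n. row par dep mem ptr len v"
    and f: "0 < k" "f k = f 0" "\<forall>i<k. blocks_by mem ptr len (f i) (f (Suc i))"
  shows "tight_closed_walk G \<alpha> (f 0) (arcs_of f k)" "f 0 \<in> set (pawalk_verts (f 0) (arcs_of f k))"
    "walk G (f 0) (tw par dep (f 0)) q" "\<not> respects_walk H \<alpha> \<beta> q Q (tw par dep (f 0))"
proof -
  interpret L: lifting G H \<alpha> \<beta> "\<lambda>v i. mem (ptr v + i)" len by (rule L)
  have b: "blocks_by mem ptr len v w \<longleftrightarrow> L.blocks v w" for v w
    by (auto simp: blocks_by_def L.blocks_def)
  show "tight_closed_walk G \<alpha> (f 0) (arcs_of f k)"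
    by (rule L.blocked_cycle_tight) (use f b in auto)
  show "f 0 \<in> set (pawalk_verts (f 0) (arcs_of f k))"
    using f(1) by (cases k) (simp_all add: arcs_of_Suc)
  have f0: "f 0 < n" "0 < len (f 0)"
    using f(1,3) edge_less by (auto simp: blocks_by_def)
  show "walk G (f 0) (tw par dep (f 0)) q" using tree_walk[OF T] tree_surj[OF T f0(1)] by auto
  show "\<not> respects_walk H \<alpha> \<beta> q Q (tw par dep (f 0))"
  proof
    assume "respects_walk H \<alpha> \<beta> q Q (tw par dep (f 0))"
    then have "Rep_word (transport \<alpha> \<beta> Q (tw par dep (f 0))) = []"
      using respects_walk_transport Rep_cls[of "[]"] by fastforce
    then show False using R[rule_format, OF f0(1)] f0(2) by (simp add: row_def)
  qed
qed

lemma moves_certificate: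
  assumes L: "lifting G H \<alpha> \<beta> (\<lambda>v i. mem (ptr v + i)) len"
    and T: "tree n ord par dep" and R: "\<forall>v<n. row par dep mem ptr len v"
    and len: "\<forall>v<n. len v \<le> K"
    and out: "inj_on out {..<n}" "out ` {..<n} = {..<n}"
      "\<forall>j<n. \<forall>w. blocks_by mem ptr len (out j) w \<longrightarrow> w \<in> out ` {..<j}"
  defines "S \<equiv> colorings \<alpha> (lifting.rounds (\<lambda>v i. mem (ptr v + i)) len (map out [0..<n]) K)"
  shows "recoloring_sequence G H \<alpha> \<beta> S" "color_walk S q = Q"
    "\<forall>v\<in>pverts G. reduced (color_walk S v)"
proof -
  interpret L: lifting G H \<alpha> \<beta> "\<lambda>v i. mem (ptr v + i)" len by (rule L)
  have "L.topological (map out [0..<n])"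
    unfolding L.topological_def
  proof (intro conjI allI impI)
    show "distinct (map out [0..<n])" using out(1) by (simp add: distinct_map lessThan_atLeast0)
    show "set (map out [0..<n]) = pverts G" using out(2) verts by (simp add: lessThan_atLeast0)
    fix xs v ys w assume os: "map out [0..<n] = xs @ v # ys" and "L.blocks v w"
    let ?j = "length xs"
    have j: "?j < n" using arg_cong[OF os, of length] by simp
    have v: "v = out ?j" using arg_cong[OF os, of "\<lambda>l. l ! ?j"] j by simp
    have "xs = take ?j (map out [0..<n])" unfolding os by simp
    also have "\<dots> = map out [0..<?j]" using j by (simp add: take_map)
    finally have xs: "set xs = out ` {..<?j}" by (metis atLeast_upt set_map)
    have "blocks_by mem ptr len v w" using \<open>L.blocks v w\<close> by (auto simp: blocks_by_def L.blocks_def)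
    then show "w \<in> set xs" using out(3) j v xs by blast
  qed
  note r = L.rounds_realize[OF this, of K, folded S_def]
  have K: "\<And>v. v \<in> pverts G \<Longrightarrow> len v \<le> K" using len verts by simp
  show "recoloring_sequence G H \<alpha> \<beta> S" using r(1) K by blast
  show "\<forall>v\<in>pverts G. reduced (color_walk S v)" using r(3) K L.sv_reduced by simp
  have "color_walk S q = Rep_word (transport \<alpha> \<beta> Q (tw par dep q))"
    using r(3)[OF K, of q] R q verts by (simp add: row_def)
  then show "color_walk S q = Q"
    using tw_q[OF T] inst by (simp add: transport_Nil Rep_cls reduced_nf_id recoloring_instance_def)
qed

end

section \<open>The algorithm\<close>

lemma wp_SeqI:
  assumes "wp G H c s P'" "\<And>t s'. P' t s' \<Longrightarrow> wp G H d s' (\<lambda>t' s''. P (t + t') s'')"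
  shows "wp G H (Seq c d) s P"
  unfolding wp_Seq by (rule wp_mono[OF assms])

context instance_nat
begin

lemma row_cong:
  "mem = mem' \<Longrightarrow> ptr v = ptr' v \<Longrightarrow> len v = len' v \<Longrightarrow>
     row par dep mem ptr len v \<longleftrightarrow> row par dep mem' ptr' len' v"
  by (simp add: row_def)

lemma rows_ok_of_row:
  assumes "\<And>v. v < n \<Longrightarrow> row par dep mem ptr len v"
  shows "rows_ok mem ptr len"
  using assms Rep_word by (auto simp: rows_ok_def row_def)

lemma items_bound:
  assumes "items_ok ptr len" "\<And>v. v < n \<Longrightarrow> len v \<le> K" "x < 4 * n"
  shows "len x \<le> K"
proof -
  have low: "len y \<le> K" if y: "y < 2 * n" for y
  proof (cases "y < n")
    case False
    then have "y = n + (y - n)" "y - n < n" using y by simp_all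
    then obtain v where "y = n + v" "v < n" by blast
    then show ?thesis using assms(1) assms(2)[of v] by (simp add: items_ok_def)
  qed (rule assms(2))
  show ?thesis
  proof (cases "x < 2 * n")
    case False
    then obtain y where y: "x = 2 * n + y" by (metis add_diff_inverse_nat)
    then have "y < 2 * n" using assms(3) by simp
    then have "len x = len y - 1" "len y \<le> K" using assms(1) low y by (simp_all add: items_ok_def)
    then show ?thesis by simp
  qed (rule low)
qed

lemma tree_dep:
  assumes "tree n ord par dep" "v < n"
  shows "dep v < n"
proof -
  have "dep (ord j) \<le> j" if "j < n" for j
    using that
  proof (induction j rule: less_induct)
    case (less j)
    show ?case
    proof (cases "j = 0")
      case False
      then have d: "dep (ord j) = Suc (dep (par (ord j)))" and p: "par (ord j) \<in> ord ` {..<j}"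
        using assms(1) less.prems by (auto simp: tree_def)
      from p obtain i where "i < j" "par (ord j) = ord i" by auto
      then show ?thesis using less.IH[of i] less.prems d by simp
    qed (use assms(1) in \<open>simp add: tree_def\<close>)
  qed
  then show ?thesis using tree_surj[OF assms] by fastforce
qed

text \<open>The summands are the search, the listing of the moves, and \<open>8 * n\<close> for a
  certificate: two tree walks, or one tree walk and a cycle of at most \<open>n\<close>
  vertices.\<close>

abbreviation "tail_cost \<equiv> 15 * (n * n + 3 * n) + pot 15 (length Q + 2 * n) n 0 0 + 8 * n + 100"

lemma tail_correct:
  assumes inp: "input s" and z: "\<And>v. v < n \<Longrightarrow> arr s STATE v = 0" "\<And>v. v < n \<Longrightarrow> arr s SCAN v = 0"
    and T: "tree n (arr s ORD) (arr s PAR) (arr s DEP)"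
    and R: "\<And>v. v < n \<Longrightarrow> row (arr s PAR) (arr s DEP) (arr s MEM) (arr s PTR) (arr s LEN) v"
    and len: "\<And>v. v < n \<Longrightarrow> arr s LEN v \<le> length Q + 2 * n"
    and E: "\<forall>(u, v)\<in>parcs G. edge_ok (arr s MEM) (arr s PTR) (arr s LEN) u v"
  shows "wp G H order_phase s
     (\<lambda>t s'. t \<le> tail_cost \<and> correct_output G H \<alpha> \<beta> q Q s')"
  unfolding order_phase_def
proof (rule wp_SeqI[OF dfs_correct[OF inp z]], assumption, assumption, goal_cases)
  case (1 t1 s1)
  note a = 1
  have L: "lifting G H \<alpha> \<beta> (\<lambda>v i. arr s MEM (arr s PTR v + i)) (arr s LEN)"
    by (rule lifting_of_rows[OF T R E])
  from a have f1: "frame {28, 29, 30, 31, 32, 33} {STATE, SCAN, STACK, POS, TOP} s s1"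
    and t1: "t1 \<le> 15 * (n * n + 3 * n) + 30" by auto
  then have arrs: "arr s1 PAR = arr s PAR" "arr s1 DEP = arr s DEP" "arr s1 MEM = arr s MEM"
    "arr s1 PTR = arr s PTR" "arr s1 LEN = arr s LEN"
    by (simp_all add: frame_def)
  have inp1: "input s1" by (rule input_frame[OF inp f1]) auto
  show ?case
  proof (cases "reg s1 33 = 1")
    case True
    let ?p = "arr s1 POS (reg s1 32)"
    let ?c = "reg s1 28 - ?p"
    have p: "?p < reg s1 28" "reg s1 28 \<le> n" "arr s1 STACK ?p = reg s1 32" and w: "reg s1 32 < n"
      and B: "\<And>j. Suc j < reg s1 28 \<Longrightarrow>
        blocks_by (arr s MEM) (arr s PTR) (arr s LEN) (arr s1 STACK j) (arr s1 STACK (Suc j))"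
        "blocks_by (arr s MEM) (arr s PTR) (arr s LEN) (arr s1 STACK (reg s1 28 - 1)) (reg s1 32)"
      using a True by (auto simp: Let_def)
    have "wp G H out_cycle s1 (\<lambda>t s'. t1 + Suc t \<le> tail_cost \<and> correct_output G H \<alpha> \<beta> q Q s')"
    proof (rule wp_mono[OF out_cycle_correct[OF p(1)]], goal_cases)
      case (1 t2 s2)
      then have c: "reg s2 1 = ?c" and st: "\<And>i. i < ?c \<Longrightarrow> arr s2 0 i = arr s1 STACK (?p + i)"
        and e: "arr s2 0 ?c = reg s1 32" "arr s2 1 0 = reg s1 32"
        and tw: "output_walk (arr s2 1) (reg s2 2) = tw (arr s PAR) (arr s DEP) (reg s1 32)"
        and v: "reg s2 0 = 2" and t2: "t2 \<le> 3 * reg s1 28 + 4 * arr s DEP (reg s1 32) + 50"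
        by (auto simp: arrs)
      have c0: "0 < ?c" using p(1) by simp
      have f0: "arr s2 0 0 = reg s1 32" using st[OF c0] p(3) by simp
      have bl: "blocks_by (arr s MEM) (arr s PTR) (arr s LEN) (arr s2 0 i) (arr s2 0 (Suc i))" if "i < ?c" for i
      proof (cases "Suc i = ?c")
        case True
        then have "?p + i = reg s1 28 - 1" by simp
        then show ?thesis using B(2) st[OF that] e(1) True by simp
      next
        case False
        then have "Suc i < ?c" using that by simp
        then show ?thesis using B(1)[of "?p + i"] st[OF that] st[of "Suc i"] by simp
      qed
      have R': "\<forall>v<n. row (arr s PAR) (arr s DEP) (arr s MEM) (arr s PTR) (arr s LEN) v"
        and bl': "\<forall>i<?c. blocks_by (arr s MEM) (arr s PTR) (arr s LEN) (arr s2 0 i) (arr s2 0 (Suc i))"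
        and eq: "arr s2 0 ?c = arr s2 0 0"
        using R bl f0 e by auto
      note cert = cycle_certificate[OF L T R' c0 eq bl', unfolded f0]
      have "arr s DEP (reg s1 32) < n" by (rule tree_dep[OF T w])
      then have "t1 + Suc t2 \<le> tail_cost" using t1 t2 p(2) by simp
      then show ?case
        using cert tw v by (simp add: correct_output_def Let_def c[unfolded One_nat_def] e[unfolded One_nat_def]
            f0 output_walk_arcs_of)
    qed
    then show ?thesis using True by simp
  next
    case False
    then have out: "inj_on (arr s1 TOP) {..<n}" "arr s1 TOP ` {..<n} = {..<n}"
      "\<forall>j<n. \<forall>w. blocks_by (arr s MEM) (arr s PTR) (arr s LEN) (arr s1 TOP j) w \<longrightarrow>
           w \<in> arr s1 TOP ` {..<j}" using a by auto
    have R': "\<forall>v<n. row (arr s PAR) (arr s DEP) (arr s MEM) (arr s PTR) (arr s LEN) v"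
      and len': "\<forall>v<n. arr s LEN v \<le> length Q + 2 * n" using R len by auto
    have L1: "lifting G H \<alpha> \<beta> (\<lambda>v i. arr s1 MEM (arr s1 PTR v + i)) (arr s1 LEN)"
      using L by (simp add: arrs)
    have "wp G H out_moves s1 (\<lambda>t s'. t1 + Suc t \<le> tail_cost \<and> correct_output G H \<alpha> \<beta> q Q s')"
    proof (rule wp_mono[OF out_moves_correct[OF inp1 L1]], goal_cases)
      case (1 t2 s2)
      then have m: "map (\<lambda>i. (arr s2 0 i, arr s2 1 i)) [0..<reg s2 1] =
          lifting.rounds (\<lambda>v i. arr s MEM (arr s PTR v + i)) (arr s LEN) (map (arr s1 TOP) [0..<n]) (length Q + 2 * n)"
        and v: "reg s2 0 = 0" and t2: "t2 \<le> pot 15 (length Q + 2 * n) n 0 0 + 20"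
        by (simp_all add: arrs)
      have "t1 + Suc t2 \<le> tail_cost" using t1 t2 by simp
      then show ?case
        using moves_certificate[OF L T R' len' out] v by (simp only: correct_output_def Let_def m) blast
    qed
    then show ?thesis using False by simp
  qed
qed

abbreviation "total_cost \<equiv> 10 * (n * (n + 2) + n) + (rowcost * n) + 20 * n + edgecost + tail_cost + 100"

lemma main_correct:
  assumes inp: "input s"
    and z: "\<And>v. v < n \<Longrightarrow> arr s VIS v = 0" "\<And>v. v < n \<Longrightarrow> arr s STATE v = 0" "\<And>v. v < n \<Longrightarrow> arr s SCAN v = 0"
    and mem: "\<And>i. i \<le> length Q \<Longrightarrow> arr s MEM i = pawalk_verts (\<alpha> q) Q ! i"
  shows "wp G H main s (\<lambda>t s'. t \<le> total_cost \<and> correct_output G H \<alpha> \<beta> q Q s')"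
  unfolding main_def
proof (rule wp_SeqI[OF bfs_correct[OF inp z(1)]], assumption, elim conjE)
  fix t1 s1
  assume t1: "t1 \<le> 10 * (n * (n + 2) + n) + 10" and f1: "frame {4, 5, 6} {ORD, PAR, DEP, VIS} s s1"
    and T1: "tree n (arr s1 ORD) (arr s1 PAR) (arr s1 DEP)"
  have inp1: "input s1" by (rule input_frame[OF inp f1]) auto
  have mem1: "\<And>i. i \<le> length Q \<Longrightarrow> arr s1 MEM i = pawalk_verts (\<alpha> q) Q ! i"
    using mem f1 by (simp add: frame_def)
  show "wp G H (rows;; items;; decide) s1
    (\<lambda>t s'. t1 + t \<le> total_cost \<and> correct_output G H \<alpha> \<beta> q Q s')"
  proof (rule wp_SeqI[OF rows_correct[OF inp1 mem1 T1]], assumption, elim conjE)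
    fix t2 s2
    assume t2: "t2 \<le> rowcost * n + 5" and f2: "frame {7, 8, 9, 10, 11, 12, 13} {MEM, PTR, LEN} s1 s2"
      and R2: "\<forall>v<n. row (arr s1 PAR) (arr s1 DEP) (arr s2 MEM) (arr s2 PTR) (arr s2 LEN) v \<and>
        arr s2 LEN v \<le> length Q + 2 * n"
    have inp2: "input s2" by (rule input_frame[OF inp1 f2]) auto
    show "wp G H (items;; decide) s2
      (\<lambda>t s'. t1 + (t2 + t) \<le> total_cost \<and> correct_output G H \<alpha> \<beta> q Q s')"
    proof (rule wp_SeqI[OF items_correct[OF inp2]], elim conjE)
      fix t3 s3
      assume t3: "t3 \<le> 20 * n + 8" and f3: "frame {14, 15, 16} {PTR, LEN, CLS} s2 s3"
        and r3: "reg s3 15 = 2 * n" "reg s3 16 = 4 * n" and it: "items_ok (arr s3 PTR) (arr s3 LEN)"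
        and low: "\<forall>v<n. arr s3 PTR v = arr s2 PTR v \<and> arr s3 LEN v = arr s2 LEN v"
        and cls: "\<forall>j<4 * n. arr s3 CLS j = j"
      have inp3: "input s3" by (rule input_frame[OF inp2 f3]) auto
      have R3: "row (arr s1 PAR) (arr s1 DEP) (arr s3 MEM) (arr s3 PTR) (arr s3 LEN) v" if "v < n" for v
      proof -
        have "row (arr s1 PAR) (arr s1 DEP) (arr s3 MEM) (arr s3 PTR) (arr s3 LEN) v \<longleftrightarrow>
            row (arr s1 PAR) (arr s1 DEP) (arr s2 MEM) (arr s2 PTR) (arr s2 LEN) v"
          by (rule row_cong) (use low f3 that in \<open>simp_all add: frame_def\<close>)
        then show ?thesis using R2 that by blast
      qed
      have len3: "arr s3 LEN v \<le> length Q + 2 * n" if "v < n" for v using R2 low that by simp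
      have pre: "edges_pre s3"
        using inp3 r3 it rows_ok_of_row[OF R3] items_bound[OF it len3] by (simp add: edges_pre_def)
      have cl: "classes_ok (arr s3 MEM) (arr s3 PTR) (arr s3 LEN) (arr s3 CLS)"
        using cls by (simp add: classes_ok_def same_def matched_def)
      show "wp G H decide s3
        (\<lambda>t s'. t1 + (t2 + (t3 + t)) \<le> total_cost \<and> correct_output G H \<alpha> \<beta> q Q s')"
        unfolding decide_def
      proof (rule wp_SeqI[OF edges_correct[OF pre cl]], elim conjE)
        fix t4 s4
        assume t4: "t4 \<le> edgecost" and f4: "frame {17, 18, 19, 20, 21, 22, 24, 25, 26} {CLS} s3 s4"
          and E: "reg s4 19 = 0 \<and> (\<forall>(u, v)\<in>parcs G. edge_ok (arr s3 MEM) (arr s3 PTR) (arr s3 LEN) u v) \<or>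
            reg s4 19 = 1 \<and> (reg s4 17, reg s4 18) \<in> parcs G \<and>
              \<not> edge_ok (arr s3 MEM) (arr s3 PTR) (arr s3 LEN) (reg s4 17) (reg s4 18)"
        have inp4: "input s4" by (rule input_frame[OF inp3 f4]) auto
        have arrs: "arr s4 MEM = arr s3 MEM" "arr s4 PTR = arr s3 PTR" "arr s4 LEN = arr s3 LEN"
          "arr s4 ORD = arr s1 ORD" "arr s4 PAR = arr s1 PAR" "arr s4 DEP = arr s1 DEP"
          "arr s4 STATE = arr s STATE" "arr s4 SCAN = arr s SCAN"
          using f1 f2 f3 f4 by (simp_all add: frame_def)
        have t: "t1 + (t2 + (t3 + (t4 + Suc t5))) \<le> total_cost" if "t5 \<le> tail_cost" for t5
          using t1 t2 t3 t4 that by simp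
        show "wp G H (Cond (Equal (Reg 19) (Num 1)) out_invalid order_phase) s4
          (\<lambda>t s'. t1 + (t2 + (t3 + (t4 + t))) \<le> total_cost \<and> correct_output G H \<alpha> \<beta> q Q s')"
        proof (cases "reg s4 19 = 1")
          case True
          then have e: "(reg s4 17, reg s4 18) \<in> parcs G"
            and bad: "\<not> edge_ok (arr s3 MEM) (arr s3 PTR) (arr s3 LEN) (reg s4 17) (reg s4 18)"
            using E by auto
          have "wp G H out_invalid s4 (\<lambda>t s'. t1 + (t2 + (t3 + (t4 + Suc t))) \<le> total_cost \<and>
            correct_output G H \<alpha> \<beta> q Q s')"
          proof (rule wp_mono[OF out_invalid_correct], elim conjE)
            fix t5 and s5 :: state
            assume t5: "t5 \<le> 4 * (arr s4 DEP (reg s4 17) + arr s4 DEP (reg s4 18)) + 50"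
              and v: "reg s5 0 = 1" and C: "output_walk (arr s5 0) (reg s5 1) =
               rev_path (tw (arr s4 PAR) (arr s4 DEP) (reg s4 17)) @
                 (reg s4 17, reg s4 18) # tw (arr s4 PAR) (arr s4 DEP) (reg s4 18)"
            have "t5 \<le> tail_cost"
              using t5 edge_less[OF e] tree_dep[OF T1, of "reg s4 17"] tree_dep[OF T1, of "reg s4 18"]
              by (simp add: arrs)
            then show "t1 + (t2 + (t3 + (t4 + Suc t5))) \<le> total_cost \<and> correct_output G H \<alpha> \<beta> q Q s5"
              using invalid_certificate[OF T1 e R3 bad] t[of t5] v C
              by (simp add: correct_output_def Let_def arrs)
          qed
          then show ?thesis using True by simp
        next
          case False
          then have E0: "\<forall>(u, v)\<in>parcs G. edge_ok (arr s4 MEM) (arr s4 PTR) (arr s4 LEN) u v"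
            using E by (simp add: arrs)
          have "wp G H order_phase s4
            (\<lambda>t s'. t \<le> tail_cost \<and> correct_output G H \<alpha> \<beta> q Q s')"
            by (rule tail_correct[OF inp4]) (use z T1 R3 len3 E0 in \<open>simp_all add: arrs\<close>)
          then have "wp G H order_phase s4
            (\<lambda>t s'. t1 + (t2 + (t3 + (t4 + Suc t))) \<le> total_cost \<and> correct_output G H \<alpha> \<beta> q Q s')"
            by (rule wp_mono) (use t in blast)
          then show ?thesis using False by simp
        qed
      qed
    qed
  qed
qed

lemma total_cost_bound: "total_cost \<le> 2000 * (n\<^sup>2 + n * length Q)"
proof -
  have "1 \<le> n" using q by simp
  then have a: "n \<le> n * n" "1 \<le> n * n" "length Q \<le> n * length Q" by simp_all
  \<comment> \<open>\<open>total_cost\<close> has leading terms \<open>185 * (n * n)\<close> and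
    \<open>33 * (n * length Q)\<close>; what 2000 leaves over, 1815 and 1967, absorbs the lower
    terms because \<open>n\<close> is positive.\<close>
  have "n * (n * 1815) = 1815 * (n * n)" "n * (length Q * 1967) = 1967 * (n * length Q)" by simp_all
  with a have "length Q * 32 + (270 + n * 398) \<le> n * (n * 1815) + n * (length Q * 1967)"
    by linarith
  then have "total_cost \<le> 2000 * (n * n + n * length Q)"
    by (simp add: pot_def algebra_simps)
  then show ?thesis by (simp add: power2_eq_square)
qed

lemma length_pawalk_verts: "length (pawalk_verts u p) = Suc (length p)" for u :: 'c
  by (induction p arbitrary: u) auto

theorem algorithm_correct:
  "\<exists>t s. exec G H main (input_state G H \<alpha> \<beta> q Q) t s \<and>
     t \<le> 2000 * ((card (pverts G))\<^sup>2 + card (pverts G) * length Q) \<and> correct_output G H \<alpha> \<beta> q Q s"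
proof -
  have c: "card (pverts G) = n" using verts by simp
  have "wp G H main (input_state G H \<alpha> \<beta> q Q)
    (\<lambda>t s'. t \<le> total_cost \<and> correct_output G H \<alpha> \<beta> q Q s')"
    by (rule main_correct)
      (auto simp: input_def input_state_def Let_def c length_pawalk_verts numeral_eq_Suc)
  then show ?thesis using total_cost_bound unfolding wp_def c by (meson order_trans)
qed

end

theorem theorem31:
  "(\<forall>(G :: 'a pair_pre_digraph) (H :: 'b pair_pre_digraph) \<alpha> \<beta> q Q.
      recoloring_instance G H \<alpha> \<beta> q Q \<longrightarrow>
        (realizable G H \<alpha> \<beta> q Q \<longleftrightarrow>
           topologically_valid G H \<alpha> \<beta> q Q \<and> respects_tight_walks G H \<alpha> \<beta> q Q)) \<and>
   (\<exists>prog c. \<forall>(G :: nat pair_pre_digraph) (H :: nat pair_pre_digraph) \<alpha> \<beta> q Q n m.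
      recoloring_instance G H \<alpha> \<beta> q Q \<longrightarrow> pverts G = {..<n} \<longrightarrow> pverts H = {..<m} \<longrightarrow>
        (\<exists>t s. exec G H prog (input_state G H \<alpha> \<beta> q Q) t s \<and>
           t \<le> c * ((card (pverts G))\<^sup>2 + card (pverts G) * length Q) \<and>
           correct_output G H \<alpha> \<beta> q Q s))"
proof (intro conjI allI impI)
  fix G :: "'a pair_pre_digraph" and H :: "'b pair_pre_digraph" and \<alpha> \<beta> q Q
  assume "recoloring_instance G H \<alpha> \<beta> q Q"
  then show "realizable G H \<alpha> \<beta> q Q \<longleftrightarrow>
      topologically_valid G H \<alpha> \<beta> q Q \<and> respects_tight_walks G H \<alpha> \<beta> q Q"
    using realizable_imp_valid[of G H \<alpha> \<beta> q Q] valid_imp_realizable[of G H \<alpha> \<beta> q Q] by blast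
next
  show "\<exists>prog c. \<forall>(G :: nat pair_pre_digraph) (H :: nat pair_pre_digraph) \<alpha> \<beta> q Q n m.
      recoloring_instance G H \<alpha> \<beta> q Q \<longrightarrow> pverts G = {..<n} \<longrightarrow> pverts H = {..<m} \<longrightarrow>
        (\<exists>t s. exec G H prog (input_state G H \<alpha> \<beta> q Q) t s \<and>
           t \<le> c * ((card (pverts G))\<^sup>2 + card (pverts G) * length Q) \<and>
           correct_output G H \<alpha> \<beta> q Q s)"
    by (intro exI[of _ main] exI[of _ 2000] allI impI instance_nat.algorithm_correct instance_nat.intro)
qed

end
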